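(* Let $\Bbbk$ be a field of characteristic $p\ge 3$, let $(L,[-,-],(-)^{[p]})$ be a restricted Lie algebra over $\Bbbk$ with $\Bbbk$-basis $\{x_i\}_{i\in I}$, and let $s(L)=\Bbbk[x_i\mid i\in I]/(x_i^p,\ i\in I)$ be the $p$-truncated symmetric algebra, with the Poisson bracket induced by the Lie bracket of $L$. Then $s(L)$ admits a natural restricted Poisson structure induced by the restricted Lie structure of $L$; that is, there is a restricted Poisson structure $(-)^{\{p\}}$ on $s(L)$ such that, for every $x\in L$, $\bar x^{\{p\}}=\overline{x^{[p]}}$, where $\bar{\phantom{x}}$ denotes the image in $s(L)$ of an element of $L$.
   Context: All algebras are over $\Bbbk$, of characteristic $p\ge 3$. A Poisson algebra is a commutative associative algebra $A$ with a Lie bracket $\{-,-\}$ satisfying $\{xy,z\}=x\{y,z\}+y\{x,z\}$. A restricted Lie algebra is a Lie algebra $L$ with a map ($p$-map) $x\mapsto x^{[p]}$ such that, with $\mathrm{ad}_x(y)=[x,y]$: (1) $\mathrm{ad}_x^p=\mathrm{ad}_{x^{[p]}}$; (2) $(\lambda x)^{[p]}=\lambda^p x^{[p]}$ for $\lambda\in\Bbbk$; (3) $(x+y)^{[p]}=x^{[p]}+y^{[p]}+\Lambda_p(x,y)$, where $\Lambda_p(x,y)=\sum_{i=1}^{p-1}\frac{s_i(x,y)}{i}$ and $s_i(x,y)$ is the coefficient of $t^{i-1}$ in the formal expression $\mathrm{ad}_{tx+y}^{p-1}(x)$. A restricted Poisson structure on a Poisson algebra $A$ is a map $(-)^{\{p\}}:A\to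 A$ such that $(A,\{-,-\},(-)^{\{p\}})$ is a restricted Lie algebra and $(x^2)^{\{p\}}=2x^p x^{\{p\}}$ for all $x\in A$. The Poisson bracket on $s(L)$ is $\{f,g\}=\sum \frac{\partial f}{\partial x_i}\frac{\partial g}{\partial x_j}[x_i,x_j]$ (sum over $i,j\in I$), i.e. the unique Poisson bracket extending the Lie bracket of $L$ on the generators. *)

theory Defs
  imports
    "HOL-Algebra.Algebra"
    "HOL-Algebra.Algebraic_Closure_Type"
    "HOL-Library.Poly_Mapping"
begin

section \<open>Lie algebras and restricted Lie algebras\<close>

text \<open>
  The base field is a type \<open>'k::field\<close>; \<^const>\<open>ring_of_type_algebra\<close> is its ring record.
  An algebra is a \<^typ>\<open>('k, 'a) module\<close> record together with a bracket; the ring multiplication of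
  the record is not used for a Lie algebra.
\<close>

locale lie_algebra =
  module "ring_of_type_algebra :: 'k ring" L
  for L :: "('k::field, 'a, 'm) module_scheme" (structure) +
  fixes br :: "'a \<Rightarrow> 'a \<Rightarrow> 'a"
  assumes br_closed: "\<lbrakk>x \<in> carrier L; y \<in> carrier L\<rbrakk> \<Longrightarrow> br x y \<in> carrier L"
    and br_add_left: "\<lbrakk>x \<in> carrier L; y \<in> carrier L; z \<in> carrier L\<rbrakk>
          \<Longrightarrow> br (x \<oplus>\<^bsub>L\<^esub> y) z = br x z \<oplus>\<^bsub>L\<^esub> br y z"
    and br_add_right: "\<lbrakk>x \<in> carrier L; y \<in> carrier L; z \<in> carrier L\<rbrakk>
          \<Longrightarrow> br x (y \<oplus>\<^bsub>L\<^esub> z) = br x y \<oplus>\<^bsub>L\<^esub> br x z"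
    and br_smult_left: "\<lbrakk>x \<in> carrier L; y \<in> carrier L\<rbrakk>
          \<Longrightarrow> br (a \<odot>\<^bsub>L\<^esub> x) y = a \<odot>\<^bsub>L\<^esub> br x y"
    and br_smult_right: "\<lbrakk>x \<in> carrier L; y \<in> carrier L\<rbrakk>
          \<Longrightarrow> br x (a \<odot>\<^bsub>L\<^esub> y) = a \<odot>\<^bsub>L\<^esub> br x y"
    and br_self: "x \<in> carrier L \<Longrightarrow> br x x = \<zero>\<^bsub>L\<^esub>"
    and jacobi: "\<lbrakk>x \<in> carrier L; y \<in> carrier L; z \<in> carrier L\<rbrakk>
          \<Longrightarrow> br x (br y z) \<oplus>\<^bsub>L\<^esub> br y (br z x) \<oplus>\<^bsub>L\<^esub> br z (br x y) = \<zero>\<^bsub>L\<^esub>"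

text \<open>
  The \<open>t\<close>-linear extension of the bracket to \<open>L[t]\<close>, an element \<open>\<Sum>n. f n t^n\<close> being given by
  its coefficient sequence \<open>f\<close>.
\<close>

definition bracket_t ::
  "('k, 'a, 'm) module_scheme \<Rightarrow> ('a \<Rightarrow> 'a \<Rightarrow> 'a) \<Rightarrow> (nat \<Rightarrow> 'a) \<Rightarrow> (nat \<Rightarrow> 'a) \<Rightarrow> (nat \<Rightarrow> 'a)"
  where "bracket_t L br f g = (\<lambda>n. \<Oplus>\<^bsub>L\<^esub>k\<in>{..n}. br (f k) (g (n - k)))"

text \<open>\<open>s\<^sub>i(x, y)\<close>: the coefficient of \<open>t^(i-1)\<close> in \<open>ad\<^bsub>tx+y\<^esub>\<^bsup>p-1\<^esup>(x)\<close>.\<close>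

definition jacobson_s ::
  "('k, 'a, 'm) module_scheme \<Rightarrow> ('a \<Rightarrow> 'a \<Rightarrow> 'a) \<Rightarrow> nat \<Rightarrow> nat \<Rightarrow> 'a \<Rightarrow> 'a \<Rightarrow> 'a"
  where "jacobson_s L br p i x y =
    ((bracket_t L br (\<lambda>n. if n = 0 then y else if n = 1 then x else \<zero>\<^bsub>L\<^esub>)) ^^ (p - 1))
      (\<lambda>n. if n = 0 then x else \<zero>\<^bsub>L\<^esub>) (i - 1)"

definition jacobson_Lambda ::
  "('k::field, 'a, 'm) module_scheme \<Rightarrow> ('a \<Rightarrow> 'a \<Rightarrow> 'a) \<Rightarrow> nat \<Rightarrow> 'a \<Rightarrow> 'a \<Rightarrow> 'a"
  where "jacobson_Lambda L br p x y =
    (\<Oplus>\<^bsub>L\<^esub>i\<in>{1..p - 1}. inverse (of_nat i) \<odot>\<^bsub>L\<^esub> jacobson_s L br p i x y)"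

locale restricted_lie_algebra =
  lie_algebra L br
  for L :: "('k::field, 'a, 'm) module_scheme" (structure) and br +
  fixes p :: nat and pmap :: "'a \<Rightarrow> 'a"
  assumes char_eq: "CHAR('k) = p"
    and pmap_closed: "x \<in> carrier L \<Longrightarrow> pmap x \<in> carrier L"
    and ad_pmap: "\<lbrakk>x \<in> carrier L; y \<in> carrier L\<rbrakk> \<Longrightarrow> (br x ^^ p) y = br (pmap x) y"
    and pmap_smult: "x \<in> carrier L \<Longrightarrow> pmap (a \<odot>\<^bsub>L\<^esub> x) = a ^ p \<odot>\<^bsub>L\<^esub> pmap x"
    and pmap_add: "\<lbrakk>x \<in> carrier L; y \<in> carrier L\<rbrakk>
          \<Longrightarrow> pmap (x \<oplus>\<^bsub>L\<^esub> y) = pmap x \<oplus>\<^bsub>L\<^esub> pmap y \<oplus>\<^bsub>L\<^esub> jacobson_Lambda L br p x y"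


section \<open>Poisson algebras and restricted Poisson structures\<close>

locale poisson_algebra =
  algebra "ring_of_type_algebra :: 'k ring" A + lie_algebra A br
  for A :: "('k::field, 'a, 'm) module_scheme" (structure) and br +
  assumes leibniz: "\<lbrakk>x \<in> carrier A; y \<in> carrier A; z \<in> carrier A\<rbrakk>
      \<Longrightarrow> br (x \<otimes>\<^bsub>A\<^esub> y) z = x \<otimes>\<^bsub>A\<^esub> br y z \<oplus>\<^bsub>A\<^esub> y \<otimes>\<^bsub>A\<^esub> br x z"

locale restricted_poisson_algebra =
  poisson_algebra A br + restricted_lie_algebra A br p pmap
  for A :: "('k::field, 'a, 'm) module_scheme" (structure) and br and p and pmap +
  assumes pmap_square: "x \<in> carrier A
      \<Longrightarrow> pmap (x [^]\<^bsub>A\<^esub> (2::nat)) = add_pow A (2::nat) (x [^]\<^bsub>A\<^esub> p \<otimes>\<^bsub>A\<^esub> pmap x)"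


section \<open>Bases\<close>

definition lincomb ::
  "('k::field, 'a, 'm) module_scheme \<Rightarrow> ('i \<Rightarrow> 'a) \<Rightarrow> ('i \<Rightarrow>\<^sub>0 'k) \<Rightarrow> 'a"
  where "lincomb L x c = (\<Oplus>\<^bsub>L\<^esub>i\<in>Poly_Mapping.keys c. Poly_Mapping.lookup c i \<odot>\<^bsub>L\<^esub> x i)"

definition is_basis ::
  "('k::field, 'a, 'm) module_scheme \<Rightarrow> 'i set \<Rightarrow> ('i \<Rightarrow> 'a) \<Rightarrow> bool"
  where "is_basis L I x \<longleftrightarrow>
    x \<in> I \<rightarrow> carrier L \<and>
    (\<forall>c. Poly_Mapping.keys c \<subseteq> I \<and> lincomb L x c = \<zero>\<^bsub>L\<^esub> \<longrightarrow> c = 0) \<and>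
    (\<forall>v\<in>carrier L. \<exists>c. Poly_Mapping.keys c \<subseteq> I \<and> v = lincomb L x c)"

text \<open>The coordinates of a vector; only meaningful if \<^term>\<open>is_basis L I x\<close>.\<close>

definition coords ::
  "('k::field, 'a, 'm) module_scheme \<Rightarrow> 'i set \<Rightarrow> ('i \<Rightarrow> 'a) \<Rightarrow> 'a \<Rightarrow> ('i \<Rightarrow>\<^sub>0 'k)"
  where "coords L I x v = (THE c. Poly_Mapping.keys c \<subseteq> I \<and> v = lincomb L x c)"


section \<open>The polynomial algebra on a basis\<close>

text \<open>
  Polynomials are finitely supported functions on monomials, monomials being finitely supported
  exponent functions; addition and (convolution) multiplication are those of
  \<^typ>\<open>('i \<Rightarrow>\<^sub>0 nat) \<Rightarrow>\<^sub>0 'k\<close>.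
\<close>

type_synonym ('i, 'k) mpoly = "('i \<Rightarrow>\<^sub>0 nat) \<Rightarrow>\<^sub>0 'k"

definition mvars :: "('i, 'k::zero) mpoly \<Rightarrow> 'i set"
  where "mvars f = (\<Union>m\<in>Poly_Mapping.keys f. Poly_Mapping.keys m)"

definition mconst :: "'k \<Rightarrow> ('i, 'k::zero) mpoly"
  where "mconst a = Poly_Mapping.single 0 a"

definition mvar :: "'i \<Rightarrow> ('i, 'k::zero_neq_one) mpoly"
  where "mvar i = Poly_Mapping.single (Poly_Mapping.single i 1) 1"

definition mpoly_ring :: "'i set \<Rightarrow> ('i, 'k::comm_ring_1) mpoly ring"
  where "mpoly_ring I = ring_of_type_algebra\<lparr>carrier := {f. mvars f \<subseteq> I}\<rparr>"

text \<open>Partial derivative; a monomial not containing \<open>i\<close> contributes \<open>0\<close>.\<close>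

definition mderiv :: "'i \<Rightarrow> ('i, 'k::comm_ring_1) mpoly \<Rightarrow> ('i, 'k) mpoly"
  where "mderiv i f = (\<Sum>m\<in>Poly_Mapping.keys f.
    Poly_Mapping.single (m - Poly_Mapping.single i 1)
      (of_nat (Poly_Mapping.lookup m i) * Poly_Mapping.lookup f m))"

text \<open>The inclusion of \<open>L\<close> as the linear forms, sending \<open>x i\<close> to the variable \<open>i\<close>.\<close>

definition lin_form ::
  "('k::field, 'a, 'm) module_scheme \<Rightarrow> 'i set \<Rightarrow> ('i \<Rightarrow> 'a) \<Rightarrow> 'a \<Rightarrow> ('i, 'k) mpoly"
  where "lin_form L I x v =
    (\<Sum>i\<in>Poly_Mapping.keys (coords L I x v).
      mconst (Poly_Mapping.lookup (coords L I x v) i) * mvar i)"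

text \<open>
  The bracket \<open>{f, g} = \<Sum>\<^bsub>i,j\<^esub> (\<partial>f/\<partial>x\<^sub>i) (\<partial>g/\<partial>x\<^sub>j) [x\<^sub>i, x\<^sub>j]\<close>. The sums run over the variables that
  occur in \<open>f\<close> and \<open>g\<close>, since the other partial derivatives vanish.
\<close>

definition poly_bracket ::
  "('k::field, 'a, 'm) module_scheme \<Rightarrow> ('a \<Rightarrow> 'a \<Rightarrow> 'a) \<Rightarrow> 'i set \<Rightarrow> ('i \<Rightarrow> 'a) \<Rightarrow>
    ('i, 'k) mpoly \<Rightarrow> ('i, 'k) mpoly \<Rightarrow> ('i, 'k) mpoly"
  where "poly_bracket L br I x f g =
    (\<Sum>i\<in>mvars f. \<Sum>j\<in>mvars g. mderiv i f * mderiv j g * lin_form L I x (br (x i) (x j)))"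


section \<open>The truncated symmetric algebra\<close>

definition trunc_ideal :: "nat \<Rightarrow> 'i set \<Rightarrow> ('i, 'k::comm_ring_1) mpoly set"
  where "trunc_ideal p I = Idl\<^bsub>mpoly_ring I\<^esub> {mvar i ^ p | i. i \<in> I}"

definition trunc_class ::
  "nat \<Rightarrow> 'i set \<Rightarrow> ('i, 'k::comm_ring_1) mpoly \<Rightarrow> ('i, 'k) mpoly set"
  where "trunc_class p I f = trunc_ideal p I +>\<^bsub>mpoly_ring I\<^esub> f"

text \<open>
  Scalar multiplication and bracket on cosets are defined as unions over representatives, in the
  same way as the multiplication \<^const>\<open>rcoset_mult\<close> of \<^const>\<open>FactRing\<close>.
\<close>

definition trunc_sym :: "nat \<Rightarrow> 'i set \<Rightarrow> ('k::comm_ring_1, ('i, 'k) mpoly set) module"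
  where "trunc_sym p I =
    ring.extend (mpoly_ring I Quot trunc_ideal p I)
      (module.fields (\<lambda>a C. \<Union>f\<in>C. trunc_class p I (mconst a * f)))"

definition trunc_bracket ::
  "('k::field, 'a, 'm) module_scheme \<Rightarrow> ('a \<Rightarrow> 'a \<Rightarrow> 'a) \<Rightarrow> nat \<Rightarrow> 'i set \<Rightarrow> ('i \<Rightarrow> 'a) \<Rightarrow>
    ('i, 'k) mpoly set \<Rightarrow> ('i, 'k) mpoly set \<Rightarrow> ('i, 'k) mpoly set"
  where "trunc_bracket L br p I x C D =
    (\<Union>f\<in>C. \<Union>g\<in>D. trunc_class p I (poly_bracket L br I x f g))"

definition trunc_incl ::
  "('k::field, 'a, 'm) module_scheme \<Rightarrow> nat \<Rightarrow> 'i set \<Rightarrow> ('i \<Rightarrow> 'a) \<Rightarrow> 'a \<Rightarrow> ('i, 'k) mpoly set"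
  where "trunc_incl L p I x v = trunc_class p I (lin_form L I x v)"

end

theory Submission
  imports Defs
begin

text \<open>
  Let \<open>A\<close> be a Poisson algebra in characteristic \<open>p\<close>. A restricted structure \<open>P\<close> on \<open>A\<close> satisfies
  \<open>P(a + b) = P(a) + P(b) + \<Lambda>\<^sub>p(a, b)\<close>, and polarizing \<open>P(a\<^sup>2) = 2 a\<^sup>p P(a)\<close> leads to a rule
  \<open>P(ab) = a\<^sup>p P(b) + b\<^sup>p P(a) + \<Phi>\<^sub>p(a, b)\<close> in which \<open>\<Phi>\<^sub>p\<close>, like \<open>\<Lambda>\<^sub>p\<close>, is a universal expression in
  brackets and products. The idea is to read the two rules as an addition and a multiplication on
  pairs \<open>(a, \<alpha>)\<close>, where \<open>\<alpha>\<close> is a candidate for \<open>P(a)\<close>. If the pairs form a commutative ring, then the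
  freeness of the polynomial ring \<open>S(L)\<close> gives a ring homomorphism \<open>x\<^sub>i \<mapsto> (x\<^sub>i, x\<^sub>i\<^sup>[\<^sup>p\<^sup>])\<close>, and its
  second component is the required map: \<open>\<Phi>\<^sub>p(a, a) = 0\<close> turns multiplicativity into the rule for
  squares. The generators \<open>x\<^sub>i\<^sup>p\<close> are sent to \<open>0\<close>, so the map descends to \<open>s(L)\<close>.

  The ring axioms for pairs are identities valid in every Poisson ring of odd characteristic \<open>p\<close>:
  \<open>\<Lambda>\<^sub>p\<close> is a cocycle (\<open>Lambda_p_cocycle\<close>), \<open>\<Phi>\<^sub>p\<close> is a multiplicative cocycle (\<open>Phi_p_assoc\<close>), and the two
  are compatible (\<open>Phi_p_add\<close>). They are proved by calculus with polynomial parameters, which takes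
  the place of the enveloping algebra. The one-form \<open>ad\<^sub>w\<^sup>p\<^sup>-\<^sup>1(dw)\<close>, formally the differential of the
  \<open>p\<close>-th power, is closed (\<open>ad_power_form_closed\<close>), and \<open>\<Lambda>\<^sub>p\<close> measures how far its primitive is from
  being additive (\<open>derivation_Lambda_p\<close>). So both sides of an identity, with an argument scaled by a
  parameter \<open>t\<close>, have the same derivative in \<open>t\<close>; being of degree at most \<open>p\<close> they can only differ in
  the coefficients of \<open>t\<^sup>0\<close> and \<open>t\<^sup>p\<close>, and those are compared directly (\<open>poly_eq_0_if_deriv\<close>).

  A derivative does not see the \<open>p\<close>-homogeneous expression \<open>\<Phi>\<^sub>p\<close> itself, and its associativity needs
  another idea. Divided by \<open>u\<^sup>p\<close>, the one-form at a unit \<open>u\<close> becomes the one-form at \<open>log u\<close>. This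
  suggests \<open>\<Phi>\<^sub>p(u, v) = (uv)\<^sup>p \<Lambda>\<^sub>p(log u, log v)\<close> (\<open>Phi_p_log\<close>), and then associativity of \<open>\<Phi>\<^sub>p\<close> is the
  cocycle identity of \<open>\<Lambda>\<^sub>p\<close>, because \<open>log(uv) = log u + log v\<close>. Only brackets with \<open>log u\<close> matter, so a
  logarithm can be adjoined formally as a variable \<open>y\<close> with \<open>{y, f} = u\<^sup>-\<^sup>1 {u, f}\<close> (\<open>log_extension\<close>). An
  arbitrary element \<open>a\<close> is reached through the unit \<open>1 + \<sigma>a\<close> of \<open>A[[\<sigma>]]\<close> by comparing the highest
  coefficients in \<open>\<sigma>\<close>.
\<close>

hide_const (open) up_ring.coeff up_ring.monom Divisibility.prime Polynomials.degree
alias keys = Poly_Mapping.keys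
alias lookup = Poly_Mapping.lookup
alias single = Poly_Mapping.single

section \<open>Poisson rings of odd prime characteristic\<close>

text \<open>
  The base field is left out: scalars are just central elements, and the coefficient rings \<open>A[t]\<close> and
  \<open>A[[\<sigma>]]\<close> used below are then Poisson rings of the same kind.
\<close>

locale poisson_ring =
  fixes B :: "'a::comm_ring_1 \<Rightarrow> 'a \<Rightarrow> 'a" and p :: nat
  assumes B_add_left: "B (x + y) z = B x z + B y z"
    and B_add_right: "B x (y + z) = B x y + B x z"
    and B_self [simp]: "B x x = 0"
    and B_jacobi: "B x (B y z) + B y (B z x) + B z (B x y) = 0"
    and B_leibniz: "B (x * y) z = x * B y z + y * B x z"
    and prime_p: "prime p"
    and p_ge_3: "3 \<le> p"
    and char_p: "of_nat p = (0::'a)"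
begin

lemma B_swap: "B y x = - B x y"
proof -
  have "B (x + y) (x + y) = B x x + B y x + (B x y + B y y)"
    by (simp only: B_add_left B_add_right)
  then show ?thesis
    by (simp add: eq_neg_iff_add_eq_0)
qed

lemma B_zero_left [simp]: "B 0 z = 0"
  using B_add_left[of 0 0 z] by simp

lemma B_zero_right [simp]: "B z 0 = 0"
  using B_add_right[of z 0 0] by simp

lemma B_minus_right: "B z (- x) = - B z x"
  using B_add_right[of z x "- x"] by (simp add: eq_neg_iff_add_eq_0 add.commute)

lemma B_diff_right: "B z (x - y) = B z x - B z y"
  using B_add_right[of z x "- y"] by (simp add: B_minus_right)

lemma B_leibniz_right: "B z (x * y) = x * B z y + y * B z x"
proof -
  have "B z (x * y) = - (x * B y z + y * B x z)"
    using B_swap[of z "x * y"] by (simp only: B_leibniz)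
  then show ?thesis
    using B_swap[of z x] B_swap[of z y] by simp
qed

lemma B_jacobi_right: "B x (B y z) = B (B x y) z + B y (B x z)"
proof -
  have "B y (B z x) = - B y (B x z)" "B z (B x y) = - B (B x y) z"
    using B_swap[of z x] B_swap[of z "B x y"] by (simp_all add: B_minus_right)
  with B_jacobi[of x y z] show ?thesis
    by (simp add: algebra_simps)
qed

lemma B_one_left [simp]: "B 1 z = 0"
  using B_leibniz[of 1 1 z] by simp

lemma B_one_right [simp]: "B z 1 = 0"
  using B_swap[of z 1] B_one_left[of z] by simp

lemma B_power_left: "B (x ^ n) z = of_nat n * x ^ (n - 1) * B x z"
proof (induction n)
  case (Suc n)
  then show ?case
    by (cases n) (simp_all add: B_leibniz algebra_simps)
qed simp

lemma B_power_right: "B z (x ^ n) = of_nat n * x ^ (n - 1) * B z x"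
  using B_power_left[of x n z] B_swap[of z "x ^ n"] B_swap[of z x] by simp

lemma B_power_p_left [simp]: "B (x ^ p) z = 0"
  by (simp add: B_power_left char_p)

lemma B_power_p_right [simp]: "B z (x ^ p) = 0"
  by (simp add: B_power_right char_p)

lemma B_of_nat_left [simp]: "B (of_nat n) z = 0"
  by (induction n) (simp_all add: B_add_left)

lemma B_of_nat_right [simp]: "B z (of_nat n) = 0"
  using B_swap[of z "of_nat n"] B_swap[of "of_nat n" z] by simp

lemma B_sum_right: "B z (sum f A) = (\<Sum>a\<in>A. B z (f a))"
  by (induction A rule: infinite_finite_induct) (simp_all add: B_add_right)

lemma B_central_mult_left: "(\<And>z. B c z = 0) \<Longrightarrow> B (c * x) z = c * B x z"
  by (simp add: B_leibniz)

lemma B_central_mult_right: "(\<And>z. B c z = 0) \<Longrightarrow> B z (c * x) = c * B z x"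
  using B_swap[of z c] by (simp add: B_leibniz_right)

lemma B_of_nat_mult_left: "B (of_nat n * x) z = of_nat n * B x z"
  by (simp add: B_leibniz)

lemma B_of_nat_mult_right: "B z (of_nat n * x) = of_nat n * B z x"
  by (simp add: B_leibniz_right)

lemma ad_zero [simp]: "(B w ^^ n) 0 = 0"
  by (induction n) simp_all

lemma ad_add: "(B w ^^ n) (x + y) = (B w ^^ n) x + (B w ^^ n) y"
  by (induction n) (simp_all add: B_add_right)

lemma ad_self:
  assumes "0 < n"
  shows "(B w ^^ n) w = 0"
  using assms by (cases n) (simp_all add: funpow_Suc_right del: funpow.simps)

lemma CHAR_eq: "CHAR('a) = p"
proof -
  have "CHAR('a) dvd p"
    using char_p of_nat_eq_0_iff_char_dvd by blast
  moreover have "CHAR('a) \<noteq> 1"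
    by simp
  ultimately show ?thesis
    using prime_p by (meson prime_nat_iff)
qed

lemma of_nat_eq_0: "p dvd n \<Longrightarrow> of_nat n = (0::'a)"
  using of_nat_eq_0_iff_char_dvd CHAR_eq by metis

lemma frobenius_add: "(x + y) ^ p = x ^ p + y ^ p" for x y :: 'a
  using freshmans_dream[of p x y] prime_p CHAR_eq by metis

lemma of_nat_power_p: "of_nat n ^ p = (of_nat n :: 'a)"
  using prime_gt_0_nat[OF prime_p] by (induction n) (simp_all add: frobenius_add zero_power)

lemma of_nat_unit:
  assumes "0 < i" "i < p"
  shows "\<exists>j. of_nat i * of_nat j = (1::'a)"
proof -
  have "coprime i p"
    using assms prime_p by (metis coprime_commute nat_dvd_not_less prime_imp_coprime)
  then obtain a b where "i * a = p * b + 1"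
    using bezout_nat[of i p] assms by (metis coprime_iff_gcd_eq_1 not_gr_zero)
  then have "of_nat i * of_nat a = (of_nat (p * b) + 1 :: 'a)"
    by (metis of_nat_1 of_nat_add of_nat_mult)
  then show ?thesis
    by (auto simp: char_p)
qed

lemma of_nat_power_inverse:
  assumes "0 < i" "i < p"
  shows "of_nat i * of_nat (i ^ (p - 2)) = (1::'a)"
proof -
  obtain j where j: "of_nat i * of_nat j = (1::'a)"
    using of_nat_unit assms by blast
  have "of_nat i * of_nat (i ^ (p - 2)) = (of_nat i ^ (p - 1) :: 'a)"
  proof -
    have "p - 1 = Suc (p - 2)"
      using p_ge_3 by simp
    then show ?thesis
      by simp
  qed
  also have "\<dots> = of_nat i ^ (p - 1) * (of_nat i * of_nat j)"
    by (simp add: j)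
  also have "\<dots> = of_nat i ^ p * of_nat j"
    using p_ge_3 by (cases p) (simp_all add: mult_ac)
  finally show ?thesis
    by (simp add: of_nat_power_p j)
qed

lemma of_nat_mult_eq_0:
  assumes "0 < i" "i < p" "of_nat i * x = (0::'a)"
  shows "x = 0"
  using of_nat_unit[OF assms(1,2)] assms(3)
  by (metis mult.commute mult.left_commute mult_1 mult_zero_right)

lemma of_nat_choose_p:
  assumes "0 < l" "l < p"
  shows "of_nat (p choose l) = (0::'a)"
  using assms prime_p by (intro of_nat_eq_0 dvd_choose_prime) auto

text \<open>
  Pascal's rule modulo \<open>p\<close>: neighbouring coefficients in row \<open>p - 1\<close> add up to a coefficient of row \<open>p\<close>.
\<close>

lemma of_nat_choose_p_minus_1:
  assumes "l < p"
  shows "of_nat ((p - 1) choose l) = ((- 1) ^ l :: 'a)"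
  using assms
proof (induction l)
  case (Suc l)
  obtain q where q: "p = Suc q"
    using Suc.prems by (cases p) auto
  have "of_nat (p choose Suc l) = (of_nat ((p - 1) choose l) + of_nat ((p - 1) choose Suc l) :: 'a)"
    by (simp add: q)
  with Suc of_nat_choose_p[of "Suc l"]
  have "of_nat ((p - 1) choose Suc l) + (- 1) ^ l = (0::'a)"
    by (simp add: add.commute)
  then show ?case
    by (simp add: eq_neg_iff_add_eq_0)
qed simp

end

section \<open>Derivations and the closed one-form\<close>

definition poisson_derivation :: "('a::comm_ring_1 \<Rightarrow> 'a \<Rightarrow> 'a) \<Rightarrow> ('a \<Rightarrow> 'a) \<Rightarrow> bool"
  where "poisson_derivation B d \<longleftrightarrow>
    (\<forall>x y. d (x + y) = d x + d y) \<and>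
    (\<forall>x y. d (x * y) = x * d y + d x * y) \<and>
    (\<forall>x y. d (B x y) = B (d x) y + B x (d y))"

lemma poisson_derivationD:
  assumes "poisson_derivation B d"
  shows "d (x + y) = d x + d y" "d (x * y) = x * d y + d x * y" "d (B x y) = B (d x) y + B x (d y)"
  using assms by (simp_all add: poisson_derivation_def)

lemma poisson_derivation_zero: "poisson_derivation B d \<Longrightarrow> d 0 = 0"
  using poisson_derivationD(1)[of B d 0 0] by simp

lemma poisson_derivation_minus: "poisson_derivation B d \<Longrightarrow> d (- x) = - d x"
  using poisson_derivationD(1)[of B d "- x" x] poisson_derivation_zero[of B d]
  by (simp add: eq_neg_iff_add_eq_0)

lemma poisson_derivation_diff: "poisson_derivation B d \<Longrightarrow> d (x - y) = d x - d y"
  using poisson_derivationD(1)[of B d x "- y"] by (simp add: poisson_derivation_minus)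

lemma poisson_derivation_one: "poisson_derivation B d \<Longrightarrow> d 1 = 0"
  using poisson_derivationD(2)[of B d 1 1] by simp

lemma poisson_derivation_of_nat: "poisson_derivation B d \<Longrightarrow> d (of_nat n) = 0"
  by (induction n) (simp_all add: poisson_derivation_zero poisson_derivation_one poisson_derivationD(1))

lemma poisson_derivation_of_nat_mult: "poisson_derivation B d \<Longrightarrow> d (of_nat n * x) = of_nat n * d x"
  by (simp add: poisson_derivationD(2) poisson_derivation_of_nat)

lemma poisson_derivation_sum: "poisson_derivation B d \<Longrightarrow> d (sum f A) = (\<Sum>a\<in>A. d (f a))"
  by (induction A rule: infinite_finite_induct)
     (simp_all add: poisson_derivation_zero poisson_derivationD(1))

lemma poisson_derivation_power:
  assumes "poisson_derivation B d"
  shows "d (x ^ n) = of_nat n * x ^ (n - 1) * d x"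
proof (induction n)
  case 0
  then show ?case
    using poisson_derivation_one[OF assms] by simp
next
  case (Suc n)
  then show ?case
    by (cases n) (simp_all add: poisson_derivationD(2)[OF assms] algebra_simps)
qed

context poisson_ring
begin

lemma poisson_derivation_power_p: "poisson_derivation B d \<Longrightarrow> d (x ^ p) = 0"
  by (simp add: poisson_derivation_power char_p)

text \<open>
  Differentiating the \<open>m + 1\<close> factors \<open>ad\<^sub>w\<close> one after another and moving the outer factors inside by
  Leibniz produces sums of binomial coefficients, which collapse by the hockey-stick identity.
\<close>

lemma derivation_ad_power:
  assumes d: "poisson_derivation B d"
  shows "d ((B w ^^ Suc m) x) =
    (\<Sum>l\<le>m. of_nat (Suc m choose Suc l) * B ((B w ^^ l) (d w)) ((B w ^^ (m - l)) x)) + (B w ^^ Suc m) (d x)"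
proof (induction m)
  case 0
  then show ?case
    by (simp add: poisson_derivationD[OF d])
next
  case (Suc m)
  let ?a = "\<lambda>l. (B w ^^ l) (d w)" and ?x = "\<lambda>l. (B w ^^ l) x"
  have "B w (\<Sum>l\<le>m. of_nat (Suc m choose Suc l) * B (?a l) (?x (m - l)))
      = (\<Sum>l\<le>m. of_nat (Suc m choose Suc l) * B (?a (Suc l)) (?x (m - l)))
        + (\<Sum>l\<le>m. of_nat (Suc m choose Suc l) * B (?a l) (?x (Suc m - l)))"
    unfolding B_sum_right sum.distrib[symmetric]
    by (intro sum.cong refl)
       (simp add: B_of_nat_mult_right B_jacobi_right[of w] distrib_left Suc_diff_le
         del: binomial_Suc_Suc)
  moreover have "(\<Sum>l\<le>Suc m. of_nat (Suc (Suc m) choose Suc l) * B (?a l) (?x (Suc m - l)))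
     = (\<Sum>l\<le>Suc m. of_nat (Suc m choose l) * B (?a l) (?x (Suc m - l)))
      + (\<Sum>l\<le>Suc m. of_nat (Suc m choose Suc l) * B (?a l) (?x (Suc m - l)))"
    unfolding sum.distrib[symmetric] by (intro sum.cong refl) (simp add: algebra_simps)
  moreover have "(\<Sum>l\<le>Suc m. of_nat (Suc m choose l) * B (?a l) (?x (Suc m - l)))
     = B (d w) (?x (Suc m)) + (\<Sum>l\<le>m. of_nat (Suc m choose Suc l) * B (?a (Suc l)) (?x (m - l)))"
    by (subst sum.atMost_Suc_shift) (simp add: mult.commute)
  moreover have "(\<Sum>l\<le>Suc m. of_nat (Suc m choose Suc l) * B (?a l) (?x (Suc m - l)))
     = (\<Sum>l\<le>m. of_nat (Suc m choose Suc l) * B (?a l) (?x (Suc m - l)))"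
    by (simp add: binomial_eq_0 del: binomial_Suc_Suc)
  moreover have "d ((B w ^^ Suc (Suc m)) x)
     = B (d w) (?x (Suc m)) + B w (d (?x (Suc m)))"
    by (simp add: poisson_derivationD[OF d])
  ultimately show ?case
    unfolding Suc.IH by (simp add: B_add_right)
qed

text \<open>
  In row \<open>p\<close> only the last binomial coefficient of \<open>derivation_ad_power\<close> survives.
\<close>

lemma ad_power_p_jacobson:
  assumes d: "poisson_derivation B d"
  shows "d ((B w ^^ p) x) = B ((B w ^^ (p - 1)) (d w)) x + (B w ^^ p) (d x)"
proof -
  obtain q where q: "p = Suc q"
    using p_ge_3 by (cases p) auto
  have "(\<Sum>l\<le>q. of_nat (p choose Suc l) * B ((B w ^^ l) (d w)) ((B w ^^ (q - l)) x))
     = (\<Sum>l\<le>q. if l = q then B ((B w ^^ l) (d w)) x else 0)"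
    by (intro sum.cong refl) (use q of_nat_choose_p in \<open>auto simp del: binomial_Suc_Suc\<close>)
  then show ?thesis
    using derivation_ad_power[OF d, of q w x] by (simp add: q)
qed

text \<open>
  The one-form \<open>dw \<mapsto> ad\<^sub>w\<^sup>p\<^sup>-\<^sup>1(dw)\<close> is closed. In row \<open>p - 1\<close> the binomial coefficients are alternating
  signs, and the resulting sum \<open>\<Sum>\<^sub>l (-1)\<^sup>l\<^sup>+\<^sup>1 {ad\<^sub>w\<^sup>l(dw), ad\<^sub>w\<^sup>p\<^sup>-\<^sup>2\<^sup>-\<^sup>l(ew)}\<close> is symmetric in \<open>d\<close> and \<open>e\<close>:
  reversing the order of summation changes the sign because \<open>p - 2\<close> is odd, and so does swapping the
  bracket.
\<close>

lemma ad_power_form_closed: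
  assumes d: "poisson_derivation B d" and e: "poisson_derivation B e" and de: "d (e w) = e (d w)"
  shows "d ((B w ^^ (p - 1)) (e w)) = e ((B w ^^ (p - 1)) (d w))"
proof -
  define m where "m = p - 2"
  have m: "p = Suc (Suc m)"
    using p_ge_3 by (simp add: m_def)
  let ?a = "\<lambda>l. (B w ^^ l) (d w)" and ?b = "\<lambda>l. (B w ^^ l) (e w)"
  have odd: "odd p"
    using prime_p p_ge_3 by (simp add: prime_odd_nat)
  have *: "(\<Sum>l\<le>m. of_nat (Suc m choose Suc l) * B (f l) (g (m - l)))
        = (\<Sum>l\<le>m. (- 1) ^ Suc l * B (f l) (g (m - l)))" for f g
    by (intro sum.cong refl)
       (use m of_nat_choose_p_minus_1 in \<open>auto simp del: binomial_Suc_Suc power_Suc\<close>)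
  have "(\<Sum>l\<le>m. (- 1) ^ Suc l * B (?b l) (?a (m - l)))
       = (\<Sum>l\<le>m. (- 1) ^ Suc (m - l) * B (?b (m - l)) (?a (m - (m - l))))"
    by (rule sum.reindex_bij_witness[of _ "\<lambda>l. m - l" "\<lambda>l. m - l"]) auto
  also have "\<dots> = (\<Sum>l\<le>m. (- 1) ^ Suc l * B (?a l) (?b (m - l)))"
  proof (intro sum.cong refl)
    fix l assume "l \<in> {..m}"
    then have l: "l \<le> m" by simp
    have "odd m"
      using odd m by simp
    then have "(- 1 :: 'a) ^ Suc (m - l) = - ((- 1) ^ Suc l)"
      using l by (cases "even l") auto
    then show "(- 1) ^ Suc (m - l) * B (?b (m - l)) (?a (m - (m - l)))
        = (- 1) ^ Suc l * B (?a l) (?b (m - l))"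
      using l B_swap[of "?b (m - l)" "?a l"] by (simp del: power_Suc)
  qed
  finally have S: "(\<Sum>l\<le>m. (- 1) ^ Suc l * B (?b l) (?a (m - l)))
        = (\<Sum>l\<le>m. (- 1) ^ Suc l * B (?a l) (?b (m - l)))" .
  show ?thesis
    using derivation_ad_power[OF d, of m w "e w"] derivation_ad_power[OF e, of m w "d w"] S
    unfolding *[of ?a ?b] *[of ?b ?a] by (simp add: m de)
qed

end

section \<open>Extension of scalars to polynomials\<close>

lemma poly_monom_induct [case_names monom add]:
  assumes "\<And>a n. P (monom a n)" and "\<And>f g. P f \<Longrightarrow> P g \<Longrightarrow> P (f + g)"
  shows "P (f :: 'a::comm_monoid_add poly)"
proof -
  have "P (\<Sum>i\<in>A. monom (coeff f i) i)" if "finite A" for A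
    using that
  proof (induction A)
    case empty
    then show ?case
      using assms(1)[of 0 0] by simp
  qed (simp add: assms)
  from this[of "{..degree f}"] show ?thesis
    by (simp add: poly_as_sum_of_monoms)
qed

definition poly_ext :: "('a::comm_ring_1 \<Rightarrow> 'a \<Rightarrow> 'a) \<Rightarrow> 'a poly \<Rightarrow> 'a poly \<Rightarrow> 'a poly"
  where "poly_ext B f g =
    (\<Sum>i\<le>degree f. \<Sum>j\<le>degree g. monom (B (coeff f i) (coeff g j)) (i + j))"

text \<open>
  The coefficients need not form a domain here, unlike for \<^const>\<open>pderiv\<close>.
\<close>

definition poly_deriv :: "'a::comm_ring_1 poly \<Rightarrow> 'a poly"
  where "poly_deriv f = (\<Sum>i\<le>degree f. monom (of_nat i * coeff f i) (i - 1))"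

lemma poly_deriv_eq:
  assumes "degree f \<le> n"
  shows "poly_deriv f = (\<Sum>i\<le>n. monom (of_nat i * coeff f i) (i - 1))"
  unfolding poly_deriv_def
  by (intro sum.mono_neutral_left) (use assms in \<open>auto simp: coeff_eq_0\<close>)

lemma poly_deriv_add: "poly_deriv (f + g) = poly_deriv f + poly_deriv g"
proof -
  define n where "n = max (degree f) (degree g)"
  have "degree f \<le> n" "degree g \<le> n" "degree (f + g) \<le> n"
    by (auto simp: n_def degree_add_le)
  then show ?thesis
    by (simp add: poly_deriv_eq[of _ n] distrib_left sum.distrib flip: add_monom)
qed

lemma poly_deriv_monom: "poly_deriv (monom a n) = monom (of_nat n * a) (n - 1)"
proof -
  have "poly_deriv (monom a n) = (\<Sum>i\<le>n. monom (of_nat i * coeff (monom a n) i) (i - 1))"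
    by (intro poly_deriv_eq degree_monom_le)
  also have "\<dots> = (\<Sum>i\<le>n. if i = n then monom (of_nat n * a) (n - 1) else 0)"
    by (intro sum.cong) auto
  finally show ?thesis
    by simp
qed

lemma poly_deriv_zero [simp]: "poly_deriv 0 = 0"
  by (simp add: poly_deriv_def)

lemma coeff_poly_deriv: "coeff (poly_deriv f) n = of_nat (Suc n) * coeff f (Suc n)"
proof (induction f rule: poly_monom_induct)
  case (monom a m)
  then show ?case
    by (cases m) (auto simp: poly_deriv_monom)
qed (simp add: poly_deriv_add algebra_simps)

lemma poly_deriv_const [simp]: "poly_deriv [:a:] = 0"
  by (rule poly_eqI) (simp add: coeff_poly_deriv)

lemma poly_deriv_mult: "poly_deriv (f * g) = f * poly_deriv g + poly_deriv f * g"
proof (induction f rule: poly_monom_induct)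
  case (monom a n)
  show ?case
  proof (induction g rule: poly_monom_induct)
    case (monom b m)
    then show ?case
      by (cases n; cases m) (simp_all add: poly_deriv_monom mult_monom add_monom algebra_simps)
  qed (simp add: poly_deriv_add algebra_simps)
qed (simp add: poly_deriv_add algebra_simps)

lemma coeff_map_poly_additive:
  fixes d :: "'a::ab_group_add \<Rightarrow> 'b::ab_group_add"
  assumes "\<And>x y. d (x + y) = d x + d y"
  shows "coeff (map_poly d f) n = d (coeff f n)"
proof -
  have "d 0 = 0"
    using assms[of 0 0] by simp
  then show ?thesis
    by (simp add: coeff_map_poly)
qed

lemma map_poly_additive:
  fixes d :: "'a::ab_group_add \<Rightarrow> 'b::ab_group_add"
  assumes "\<And>x y. d (x + y) = d x + d y"
  shows "map_poly d (f + g) = map_poly d f + map_poly d g"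
  by (rule poly_eqI) (simp add: coeff_map_poly_additive[OF assms] assms)

lemma map_poly_additive_monom:
  fixes d :: "'a::ab_group_add \<Rightarrow> 'b::ab_group_add"
  assumes "\<And>x y. d (x + y) = d x + d y"
  shows "map_poly d (monom a n) = monom (d a) n"
proof -
  have "d 0 = 0"
    using assms[of 0 0] by simp
  then show ?thesis
    by (simp add: map_poly_monom)
qed

context poisson_ring
begin

lemma poly_ext_eq:
  assumes "degree f \<le> n" "degree g \<le> m"
  shows "poly_ext B f g = (\<Sum>i\<le>n. \<Sum>j\<le>m. monom (B (coeff f i) (coeff g j)) (i + j))"
proof -
  have "poly_ext B f g = (\<Sum>i\<le>degree f. \<Sum>j\<le>m. monom (B (coeff f i) (coeff g j)) (i + j))"
    unfolding poly_ext_def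
    by (intro sum.cong refl sum.mono_neutral_left) (use assms in \<open>auto simp: coeff_eq_0\<close>)
  also have "\<dots> = (\<Sum>i\<le>n. \<Sum>j\<le>m. monom (B (coeff f i) (coeff g j)) (i + j))"
    by (intro sum.mono_neutral_left) (use assms in \<open>auto simp: coeff_eq_0\<close>)
  finally show ?thesis .
qed

lemma poly_ext_add_left:
  "poly_ext B (f + g) h = poly_ext B f h + poly_ext B g h"
proof -
  define n where "n = max (degree f) (degree g)"
  have "degree f \<le> n" "degree g \<le> n" "degree (f + g) \<le> n"
    by (auto simp: n_def degree_add_le)
  then show ?thesis
    by (simp add: poly_ext_eq[of _ n _ "degree h"] B_add_left sum.distrib flip: add_monom)
qed

lemma poly_ext_add_right:
  "poly_ext B h (f + g) = poly_ext B h f + poly_ext B h g"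
proof -
  define n where "n = max (degree f) (degree g)"
  have "degree f \<le> n" "degree g \<le> n" "degree (f + g) \<le> n"
    by (auto simp: n_def degree_add_le)
  then show ?thesis
    by (simp add: poly_ext_eq[of _ "degree h" _ n] B_add_right sum.distrib flip: add_monom)
qed

lemma poly_ext_monom:
  "poly_ext B (monom a i) (monom b j) = monom (B a b) (i + j)"
proof -
  have "poly_ext B (monom a i) (monom b j)
      = (\<Sum>k\<le>i. \<Sum>l\<le>j. monom (B (coeff (monom a i) k) (coeff (monom b j) l)) (k + l))"
    by (intro poly_ext_eq degree_monom_le)
  also have "\<dots> = (\<Sum>k\<le>i. if k = i then \<Sum>l\<le>j. monom (B a (coeff (monom b j) l)) (i + l) else 0)"
    by (intro sum.cong refl) auto
  also have "(\<Sum>l\<le>j. monom (B a (coeff (monom b j) l)) (i + l))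
      = (\<Sum>l\<le>j. if l = j then monom (B a b) (i + j) else 0)"
    by (intro sum.cong refl) auto
  also have "\<dots> = monom (B a b) (i + j)"
    by simp
  finally show ?thesis
    by (simp del: coeff_monom)
qed

lemma poly_ext_zero [simp]:
  "poly_ext B 0 f = 0" "poly_ext B f 0 = 0"
  by (simp_all add: poly_ext_def)

lemma poly_ext_swap: "poly_ext B g f = - poly_ext B f g"
proof (induction f rule: poly_monom_induct)
  case (monom a n)
  show ?case
  proof (induction g rule: poly_monom_induct)
    case (monom b m)
    then show ?case
      using B_swap[of b a] by (simp add: poly_ext_monom add.commute minus_monom)
  qed (simp add: poly_ext_add_left poly_ext_add_right)
qed (simp add: poly_ext_add_left poly_ext_add_right)

lemma two_mult_cancel:
  assumes "x + x = (0 :: 'a)"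
  shows "x = 0"
  using of_nat_mult_eq_0[of 2 x] assms p_ge_3 by (simp add: mult_2)

lemma add_triple_zero:
  assumes "a + b + c = 0" "a' + b' + c' = (0 :: 'b::ab_group_add)"
  shows "(a + a') + (b + b') + (c + c') = 0"
proof -
  have "(a + a') + (b + b') + (c + c') = (a + b + c) + (a' + b' + c')"
    by (simp only: ac_simps)
  with assms show ?thesis
    by simp
qed

lemma poisson_ring_poly: "poisson_ring (poly_ext B) p"
proof
  fix f g h :: "'a poly"
  show "poly_ext B (f + g) h = poly_ext B f h + poly_ext B g h"
    by (rule poly_ext_add_left)
  show "poly_ext B f (g + h) = poly_ext B f g + poly_ext B f h"
    by (rule poly_ext_add_right)
  show "poly_ext B f f = 0"
  proof (rule poly_eqI)
    fix n
    have "coeff (poly_ext B f f) n + coeff (poly_ext B f f) n = 0"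
      using poly_ext_swap[of f f] by (metis coeff_minus ab_group_add_class.ab_left_minus)
    then show "coeff (poly_ext B f f) n = coeff 0 n"
      using two_mult_cancel by simp
  qed
  show "poly_ext B f (poly_ext B g h) + poly_ext B g (poly_ext B h f)
      + poly_ext B h (poly_ext B f g) = 0"
  proof (induction f rule: poly_monom_induct)
    case (monom a n)
    show ?case
    proof (induction g rule: poly_monom_induct)
      case (monom b m)
      show ?case
      proof (induction h rule: poly_monom_induct)
        case (monom c l)
        have "monom (B a (B b c)) (n + (m + l)) + monom (B b (B c a)) (m + (l + n))
            + monom (B c (B a b)) (l + (n + m)) = monom 0 (n + (m + l))"
          using B_jacobi[of a b c] by (simp add: add_monom ac_simps)
        then show ?case
          by (simp add: poly_ext_monom)
      next
        case (add f g)
        then show ?case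
          by (simp only: poly_ext_add_left poly_ext_add_right add_triple_zero)
      qed
    next
      case (add f g)
      then show ?case
        by (simp only: poly_ext_add_left poly_ext_add_right add_triple_zero)
    qed
  next
    case (add f g)
    then show ?case
      by (simp only: poly_ext_add_left poly_ext_add_right add_triple_zero)
  qed
  show "poly_ext B (f * g) h = f * poly_ext B g h + g * poly_ext B f h"
  proof (induction f rule: poly_monom_induct)
    case (monom a n)
    show ?case
    proof (induction g rule: poly_monom_induct)
      case (monom b m)
      show ?case
      proof (induction h rule: poly_monom_induct)
        case (monom c l)
        then show ?case
          by (simp add: poly_ext_monom mult_monom B_leibniz add_monom ac_simps)
      qed (simp add: poly_ext_add_right algebra_simps)
    qed (simp add: poly_ext_add_left algebra_simps)
  qed (simp add: poly_ext_add_left algebra_simps)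
  show "of_nat p = (0 :: 'a poly)"
    by (simp add: of_nat_poly char_p)
qed (fact prime_p p_ge_3)+

lemma poly_ext_const: "poly_ext B [:a:] [:b:] = [:B a b:]"
  using poly_ext_monom[of a 0 b 0] by (simp add: monom_0)

lemma coeff_poly_ext_const: "coeff (poly_ext B [:a:] f) n = B a (coeff f n)"
proof (induction f rule: poly_monom_induct)
  case (monom b m)
  then show ?case
    using poly_ext_monom[of a 0 b m] by (simp add: monom_0)
qed (simp add: poly_ext_add_right B_add_right)

lemma poisson_derivation_poly_deriv: "poisson_derivation (poly_ext B) poly_deriv"
proof -
  have "poly_deriv (poly_ext B f g) =
      poly_ext B (poly_deriv f) g + poly_ext B f (poly_deriv g)" for f g
  proof (induction f rule: poly_monom_induct)
    case (monom a n)
    show ?case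
    proof (induction g rule: poly_monom_induct)
      case (monom b m)
      show ?case
        by (cases n; cases m)
           (simp_all add: poly_deriv_monom poly_ext_monom add_monom
             B_of_nat_mult_left B_of_nat_mult_right B_add_left B_add_right distrib_right)
    qed (simp add: poly_deriv_add poly_ext_add_right algebra_simps)
  qed (simp add: poly_deriv_add poly_ext_add_left algebra_simps)
  then show ?thesis
    by (simp add: poisson_derivation_def poly_deriv_add poly_deriv_mult)
qed

lemma poisson_derivation_map_poly:
  assumes d: "poisson_derivation B d"
  shows "poisson_derivation (poly_ext B) (map_poly d)"
proof -
  note [simp] = poisson_derivationD[OF d]
  note a = map_poly_additive[of d, OF poisson_derivationD(1)[OF d]]
  note m = map_poly_additive_monom[of d, OF poisson_derivationD(1)[OF d]]
  have "map_poly d (f * g) = f * map_poly d g + map_poly d f * g" for f g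
  proof (induction f rule: poly_monom_induct)
    case (monom x n)
    show ?case
      by (induction g rule: poly_monom_induct)
         (simp_all add: a m mult_monom add_monom algebra_simps)
  qed (simp add: a algebra_simps)
  moreover have "map_poly d (poly_ext B f g)
      = poly_ext B (map_poly d f) g + poly_ext B f (map_poly d g)" for f g
  proof (induction f rule: poly_monom_induct)
    case (monom x n)
    show ?case
      by (induction g rule: poly_monom_induct)
         (simp_all add: a m poly_ext_monom poly_ext_add_right add_monom algebra_simps)
  qed (simp add: a poly_ext_add_left algebra_simps)
  ultimately show ?thesis
    by (simp add: poisson_derivation_def a)
qed

lemma poly_deriv_map_poly:
  assumes d: "poisson_derivation B d"
  shows "poly_deriv (map_poly d f) = map_poly d (poly_deriv f)"
  by (rule poly_eqI)
     (simp add: coeff_poly_deriv coeff_map_poly_additive[of d, OF poisson_derivationD(1)[OF d]]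
       poisson_derivation_of_nat_mult[OF d] poisson_derivationD(1)[OF d] distrib_right)

lemma poly_poly_ext:
  assumes "\<And>z. B c z = 0"
  shows "poly (poly_ext B f g) c = B (poly f c) (poly g c)"
proof (induction f rule: poly_monom_induct)
  case (monom a n)
  have *: "B (c ^ m) z = 0" for m z
    by (simp add: B_power_left assms)
  show ?case
  proof (induction g rule: poly_monom_induct)
    case (monom b m)
    show ?case
      using B_central_mult_left[of "c ^ n" a "c ^ m * b", OF *] B_central_mult_right[of "c ^ m" a b, OF *]
      by (simp add: poly_ext_monom poly_monom power_add mult_ac)
  qed (simp add: poly_ext_add_right B_add_right)
qed (simp add: poly_ext_add_left B_add_left)

section \<open>Twisting by commuting derivations\<close>

text \<open>
  Adding the bivector \<open>d \<and> e\<close> of commuting Poisson derivations to a Poisson bivector preserves the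
  Jacobi identity: derivations of the bracket commute with it, and \<open>d \<and> e\<close> commutes with itself.
\<close>

lemma poisson_ring_twist:
  assumes d: "poisson_derivation B d" and e: "poisson_derivation B e"
    and de: "\<And>x. d (e x) = e (d x)"
  shows "poisson_ring (\<lambda>f g. B f g + d f * e g - e f * d g) p"
proof
  note [simp] = poisson_derivationD[OF d] poisson_derivationD[OF e] de
    poisson_derivation_diff[OF d] poisson_derivation_diff[OF e]
  fix x y z :: 'a
  show "B (x + y) z + d (x + y) * e z - e (x + y) * d z =
      B x z + d x * e z - e x * d z + (B y z + d y * e z - e y * d z)"
    by (simp add: B_add_left algebra_simps)
  show "B x (y + z) + d x * e (y + z) - e x * d (y + z) =
      B x y + d x * e y - e x * d y + (B x z + d x * e z - e x * d z)"
    by (simp add: B_add_right algebra_simps)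
  show "B x x + d x * e x - e x * d x = 0"
    by simp
  show "B (x * y) z + d (x * y) * e z - e (x * y) * d z =
      x * (B y z + d y * e z - e y * d z) + y * (B x z + d x * e z - e x * d z)"
    by (simp add: B_leibniz algebra_simps)
  have J: "B x (B y z) + B y (B z x) + B z (B x y) = 0"
    by (rule B_jacobi)
  have s: "B (d z) x = - B x (d z)" "B (d x) y = - B y (d x)" "B (d y) z = - B z (d y)"
     "B (e z) x = - B x (e z)" "B (e x) y = - B y (e x)" "B (e y) z = - B z (e y)"
    by (rule B_swap)+
  show "B x (B y z + d y * e z - e y * d z) + d x * e (B y z + d y * e z - e y * d z)
        - e x * d (B y z + d y * e z - e y * d z)
      + (B y (B z x + d z * e x - e z * d x) + d y * e (B z x + d z * e x - e z * d x)
        - e y * d (B z x + d z * e x - e z * d x))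
      + (B z (B x y + d x * e y - e x * d y) + d z * e (B x y + d x * e y - e x * d y)
        - e z * d (B x y + d x * e y - e x * d y)) = 0"
    (is "?l = 0")
  proof -
    have "?l = B x (B y z) + B y (B z x) + B z (B x y)"
      by (simp add: B_add_right B_diff_right B_leibniz_right s algebra_simps)
    with J show ?thesis
      by simp
  qed
qed (fact prime_p p_ge_3 char_p)+

end

section \<open>Adjoining logarithms\<close>

text \<open>
  The twist of \<open>A[y]\<close> by \<open>\<partial>/\<partial>y\<close> and \<open>h\<close>. It makes \<open>{y, a} = h(a)\<close> for constants \<open>a\<close>, so with
  \<open>h = u\<^sup>-\<^sup>1 {u, -}\<close> the variable \<open>y\<close> behaves like \<open>log u\<close>.
\<close>

definition log_bracket ::
  "('a::comm_ring_1 \<Rightarrow> 'a \<Rightarrow> 'a) \<Rightarrow> ('a \<Rightarrow> 'a) \<Rightarrow> 'a poly \<Rightarrow> 'a poly \<Rightarrow> 'a poly"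
  where "log_bracket B h f g =
    poly_ext B f g + poly_deriv f * map_poly h g - map_poly h f * poly_deriv g"

context poisson_ring
begin

lemma poisson_ring_log_bracket:
  assumes h: "poisson_derivation B h"
  shows "poisson_ring (log_bracket B h) p"
proof -
  interpret poly: poisson_ring "poly_ext B" p
    by (rule poisson_ring_poly)
  show ?thesis
    unfolding log_bracket_def[abs_def]
    by (intro poly.poisson_ring_twist poisson_derivation_poly_deriv poisson_derivation_map_poly
        poly_deriv_map_poly h)
qed

lemma bracket_inverse:
  assumes u: "u * u' = 1"
  shows "B u' z = - (u' * u' * B u z)"
proof -
  have "B (u * u') z = 0"
    by (simp add: u)
  then have "u' * (u * B u' z + u' * B u z) = 0"
    by (simp only: B_leibniz mult_zero_right)
  moreover have "u' * (u * B u' z) = B u' z"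
    using u by (metis mult.assoc mult.commute mult_1)
  ultimately have "B u' z + u' * (u' * B u z) = 0"
    by (simp only: distrib_left)
  then show ?thesis
    by (simp add: eq_neg_iff_add_eq_0 mult.assoc)
qed

text \<open>
  The terms in which \<open>u\<^sup>-\<^sup>1\<close> is differentiated are \<open>\<mp> u\<^sup>-\<^sup>2 {u, x} {u, y}\<close> and cancel.
\<close>

lemma poisson_derivation_log:
  assumes u: "u * u' = 1"
  shows "poisson_derivation B (\<lambda>a. u' * B u a)"
proof -
  note i = bracket_inverse[OF u]
  have i': "B z u' = u' * u' * B u z" for z
    using B_swap[of z u'] i[of z] by simp
  have "u' * B u (B x y) = B (u' * B u x) y + B x (u' * B u y)" for x y
    by (simp add: B_jacobi_right[of u] B_leibniz B_leibniz_right i i' algebra_simps)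
  then show ?thesis
    by (simp add: poisson_derivation_def B_add_right B_leibniz_right algebra_simps)
qed

lemma log_bracket_const:
  assumes h: "poisson_derivation B h"
  shows "log_bracket B h [:a:] [:b:] = [:B a b:]"
  by (simp add: log_bracket_def poly_ext_const)

text \<open>
  For \<open>f = y\<close> this holds as well, since both sides are \<open>0\<close>; so the relation is the one expected of
  \<open>y = log u\<close> on the whole extension.
\<close>

lemma log_bracket_variable:
  assumes u: "u * u' = 1"
  defines "h \<equiv> \<lambda>a. u' * B u a"
  shows "log_bracket B h [:0, 1:] f * [:u:] = log_bracket B h [:u:] f"
proof -
  have h: "poisson_derivation B h"
    unfolding h_def by (rule poisson_derivation_log) fact
  have 1: "poly_deriv [:0, 1:] = 1"
    by (rule poly_eqI) (auto simp: coeff_poly_deriv coeff_pCons split: nat.splits)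
  have 2: "map_poly h [:0, 1:] = 0" "map_poly h [:u:] = 0"
  proof -
    have "h 0 = 0" "h 1 = 0" "h u = 0"
      by (simp_all add: h_def)
    then show "map_poly h [:0, 1:] = 0" "map_poly h [:u:] = 0"
      by (simp_all add: map_poly_pCons)
  qed
  have 3: "poly_ext B [:0, 1:] f = 0"
  proof (induction f rule: poly_monom_induct)
    case (monom b m)
    show ?case
      using poly_ext_monom[of 1 1 b m] by (simp add: monom_altdef)
  qed (simp add: poly_ext_add_right)
  have "map_poly h f * [:u:] = poly_ext B [:u:] f"
  proof (rule poly_eqI)
    fix n
    have "u * (u' * B u (coeff f n)) = B u (coeff f n)"
      by (simp add: u flip: mult.assoc)
    then show "coeff (map_poly h f * [:u:]) n = coeff (poly_ext B [:u:] f) n"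
      by (simp add: coeff_map_poly_additive[OF poisson_derivationD(1)[OF h]]
          coeff_poly_ext_const) (simp add: h_def)
  qed
  then show ?thesis
    by (simp add: log_bracket_def 1 2 3)
qed

text \<open>
  A derivation extends to \<open>A[y]\<close> by \<open>y \<mapsto> du / u\<close>, as it must for \<open>y = log u\<close>. The correction
  \<open>(du / u) \<partial>/\<partial>y\<close> compensates the commutator of \<open>d\<close> with \<open>h\<close>, which is the bracket with \<open>du / u\<close>.
\<close>

lemma poisson_derivation_log_bracket:
  assumes u: "u * u' = 1" and d: "poisson_derivation B d"
  defines "h \<equiv> \<lambda>a. u' * B u a"
  shows "poisson_derivation (log_bracket B h) (\<lambda>f. map_poly d f + [:u' * d u:] * poly_deriv f)"
proof -
  have h: "poisson_derivation B h"
    unfolding h_def by (rule poisson_derivation_log) fact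
  interpret poly: poisson_ring "poly_ext B" p
    by (rule poisson_ring_poly)
  define c where "c = u' * d u"
  let ?B = "poly_ext B" and ?d = "map_poly d" and ?h = "map_poly h" and ?t = poly_deriv
  note D = poisson_derivation_map_poly[OF d] and H = poisson_derivation_map_poly[OF h]
    and T = poisson_derivation_poly_deriv
  note dt = poly_deriv_map_poly[OF d] and ht = poly_deriv_map_poly[OF h]
  have du': "d u' = - (u' * u' * d u)"
  proof -
    have "u * d u' + d u * u' = 0"
      using poisson_derivationD(2)[OF d, of u u'] poisson_derivation_one[OF d] u by simp
    then have "u' * (u * d u' + d u * u') = 0"
      by simp
    moreover have "u' * (u * d u') = d u'"
      using u by (metis mult.assoc mult.commute mult_1)
    ultimately have "d u' + u' * u' * d u = 0"
      by (simp add: distrib_left mult_ac)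
    then show ?thesis
      by (simp add: eq_neg_iff_add_eq_0)
  qed
  have c: "d (h a) = h (d a) + B c a" for a
    by (simp add: h_def c_def poisson_derivationD[OF d] du' B_leibniz bracket_inverse[OF u] algebra_simps)
  have C: "?d (?h f) = ?h (?d f) + ?B [:c:] f" for f
    by (rule poly_eqI)
       (simp add: coeff_map_poly_additive[OF poisson_derivationD(1)[OF h]]
         coeff_map_poly_additive[OF poisson_derivationD(1)[OF d]] coeff_poly_ext_const c)
  have s: "?B f [:c:] = - ?B [:c:] f" for f
    by (rule poly_ext_swap)
  have "?d (log_bracket B h f g) + [:c:] * ?t (log_bracket B h f g)
      = log_bracket B h (?d f + [:c:] * ?t f) g + log_bracket B h f (?d g + [:c:] * ?t g)" for f g
    by (simp only: log_bracket_def poisson_derivationD[OF D] poisson_derivationD[OF H]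
        poisson_derivationD[OF T] poisson_derivation_diff[OF D] poisson_derivation_diff[OF T]
        dt ht C poly.B_leibniz poly.B_leibniz_right poly.B_add_left poly.B_add_right
        poly_deriv_const s)
       (simp add: algebra_simps)
  moreover have "?d (f * g) + [:c:] * ?t (f * g) = f * (?d g + [:c:] * ?t g) + (?d f + [:c:] * ?t f) * g" for f g
    by (simp only: poisson_derivationD[OF D] poisson_derivationD[OF T]) (simp add: algebra_simps)
  moreover have "?d (f + g) + [:c:] * ?t (f + g) = (?d f + [:c:] * ?t f) + (?d g + [:c:] * ?t g)" for f g
    by (simp only: poisson_derivationD[OF D] poisson_derivationD[OF T]) (simp add: algebra_simps)
  ultimately show ?thesis
    unfolding poisson_derivation_def c_def[symmetric] by blast
qed

end

section \<open>Jacobson's polynomial\<close>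

text \<open>
  \<open>Lambda_coeff B x y k i\<close> is the coefficient of \<open>t\<^sup>i\<close> in \<open>ad\<^bsub>tx+y\<^esub>\<^sup>k(x)\<close>.
\<close>

primrec Lambda_coeff :: "('a::comm_ring_1 \<Rightarrow> 'a \<Rightarrow> 'a) \<Rightarrow> 'a \<Rightarrow> 'a \<Rightarrow> nat \<Rightarrow> nat \<Rightarrow> 'a" where
  "Lambda_coeff B x y 0 i = (if i = 0 then x else 0)"
| "Lambda_coeff B x y (Suc k) i = B y (Lambda_coeff B x y k i) + (if i = 0 then 0 else B x (Lambda_coeff B x y k (i - 1)))"

text \<open>
  Jacobson's \<open>\<Lambda>\<^sub>p\<close>; by Fermat's little theorem \<open>i\<^sup>p\<^sup>-\<^sup>2\<close> represents \<open>1/i\<close> in characteristic \<open>p\<close>.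
\<close>

definition Lambda_p :: "('a::comm_ring_1 \<Rightarrow> 'a \<Rightarrow> 'a) \<Rightarrow> nat \<Rightarrow> 'a \<Rightarrow> 'a \<Rightarrow> 'a"
  where "Lambda_p B p x y = (\<Sum>i=1..p - 1. of_nat (i ^ (p - 2)) * Lambda_coeff B x y (p - 1) (i - 1))"

definition poisson_hom ::
  "('a::comm_ring_1 \<Rightarrow> 'a \<Rightarrow> 'a) \<Rightarrow> ('b::comm_ring_1 \<Rightarrow> 'b \<Rightarrow> 'b) \<Rightarrow> ('a \<Rightarrow> 'b) \<Rightarrow> bool"
  where "poisson_hom B B' h \<longleftrightarrow> h 1 = 1 \<and>
    (\<forall>x y. h (x + y) = h x + h y \<and> h (x * y) = h x * h y \<and> h (B x y) = B' (h x) (h y))"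

lemma poisson_homD:
  assumes "poisson_hom B B' h"
  shows "h 1 = 1" "h (x + y) = h x + h y" "h (x * y) = h x * h y" "h (B x y) = B' (h x) (h y)"
  using assms by (simp_all add: poisson_hom_def)

lemma poisson_hom_zero: "poisson_hom B B' h \<Longrightarrow> h 0 = 0"
  using poisson_homD(2)[of B B' h 0 0] by simp

lemma poisson_hom_minus: "poisson_hom B B' h \<Longrightarrow> h (- x) = - h x"
  using poisson_homD(2)[of B B' h "- x" x] poisson_hom_zero[of B B' h]
  by (simp add: eq_neg_iff_add_eq_0)

lemma poisson_hom_diff: "poisson_hom B B' h \<Longrightarrow> h (x - y) = h x - h y"
  using poisson_homD(2)[of B B' h x "- y"] by (simp add: poisson_hom_minus)

lemma poisson_hom_of_nat: "poisson_hom B B' h \<Longrightarrow> h (of_nat n) = of_nat n"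
  by (induction n) (simp_all add: poisson_hom_zero poisson_homD)

lemma poisson_hom_power: "poisson_hom B B' h \<Longrightarrow> h (x ^ n) = h x ^ n"
  by (induction n) (simp_all add: poisson_homD)

lemma poisson_hom_sum: "poisson_hom B B' h \<Longrightarrow> h (sum f A) = (\<Sum>a\<in>A. h (f a))"
  by (induction A rule: infinite_finite_induct) (simp_all add: poisson_hom_zero poisson_homD)

lemma poisson_hom_ad: "poisson_hom B B' h \<Longrightarrow> h ((B w ^^ n) x) = (B' (h w) ^^ n) (h x)"
  by (induction n) (simp_all add: poisson_homD)

lemma poisson_hom_comp:
  "poisson_hom B B' h \<Longrightarrow> poisson_hom B' B'' h' \<Longrightarrow> poisson_hom B B'' (\<lambda>x. h' (h x))"
  by (simp add: poisson_hom_def)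

lemma poisson_hom_Lambda_coeff:
  assumes "poisson_hom B B' h"
  shows "h (Lambda_coeff B x y k i) = Lambda_coeff B' (h x) (h y) k i"
  by (induction k arbitrary: i) (simp_all add: poisson_homD[OF assms] poisson_hom_zero[OF assms])

lemma poisson_hom_Lambda_p:
  assumes "poisson_hom B B' h"
  shows "h (Lambda_p B p x y) = Lambda_p B' p (h x) (h y)"
  by (simp add: Lambda_p_def poisson_hom_sum[OF assms] poisson_homD[OF assms] poisson_hom_of_nat[OF assms]
      poisson_hom_Lambda_coeff[OF assms] del: of_nat_power)

text \<open>
  Taking the coefficient at a fixed degree bound is compatible with products and brackets once the
  bounds are added, even if that coefficient vanishes. This is how a polynomial identity between
  \<open>1 + \<sigma>a\<close> and the like is specialized to one between the \<open>a\<close>.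
\<close>

definition has_top :: "nat \<Rightarrow> 'a::comm_ring_1 poly \<Rightarrow> 'a \<Rightarrow> bool"
  where "has_top n F f \<longleftrightarrow> degree F \<le> n \<and> coeff F n = f"

lemma has_top_const: "has_top 0 [:a:] a"
  by (simp add: has_top_def)

lemma has_top_linear: "has_top 1 [:b, a:] a"
  by (simp add: has_top_def)

lemma has_top_const_linear: "has_top 1 [:b:] 0"
  by (simp add: has_top_def)

lemma has_top_monom: "has_top n (monom a n) a"
  by (simp add: has_top_def degree_monom_le)

lemma has_top_zero: "has_top n 0 0"
  by (simp add: has_top_def)

lemma has_top_add: "has_top n F f \<Longrightarrow> has_top n G g \<Longrightarrow> has_top n (F + G) (f + g)"
  by (auto simp: has_top_def degree_add_le)

lemma has_top_diff: "has_top n F f \<Longrightarrow> has_top n G g \<Longrightarrow> has_top n (F - G) (f - g)"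
  by (auto simp: has_top_def degree_diff_le)

lemma has_top_mult:
  assumes "has_top n F f" "has_top m G g"
  shows "has_top (n + m) (F * G) (f * g)"
proof -
  have F: "degree F \<le> n" and G: "degree G \<le> m"
    using assms by (auto simp: has_top_def)
  have "coeff (F * G) (n + m) = (\<Sum>i\<le>n + m. if i = n then f * g else 0)"
    unfolding coeff_mult
  proof (intro sum.cong refl)
    fix i assume "i \<in> {..n + m}"
    show "coeff F i * coeff G (n + m - i) = (if i = n then f * g else 0)"
    proof (cases i n rule: linorder_cases)
      case less
      then show ?thesis
        using G by (simp add: coeff_eq_0)
    next
      case greater
      then show ?thesis
        using F by (simp add: coeff_eq_0)
    qed (use assms in \<open>auto simp: has_top_def\<close>)
  qed
  moreover have "degree (F * G) \<le> n + m"
    using degree_mult_le[of F G] F G by linarith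
  ultimately show ?thesis
    by (simp add: has_top_def)
qed

lemma has_top_power: "has_top n F f \<Longrightarrow> has_top (k * n) (F ^ k) (f ^ k)"
proof (induction k)
  case 0
  then show ?case
    using has_top_const[of 1] by (simp add: one_pCons)
next
  case (Suc k)
  then show ?case
    using has_top_mult[of n F f "k * n" "F ^ k" "f ^ k"] by simp
qed

lemma has_top_of_nat_mult: "has_top n F f \<Longrightarrow> has_top n (of_nat k * F) ((of_nat k) * f)"
  using has_top_mult[OF has_top_const[of "of_nat k"], of n F f] by (simp add: of_nat_poly)

lemma has_top_sum:
  assumes "\<And>i. i \<in> A \<Longrightarrow> has_top n (F i) (f i)"
  shows "has_top n (sum F A) (sum f A)"
  using assms by (induction A rule: infinite_finite_induct) (simp_all add: has_top_zero has_top_add)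

lemma has_top_raise: "has_top n F f \<Longrightarrow> n < m \<Longrightarrow> has_top m F 0"
  by (simp add: has_top_def coeff_eq_0)

context poisson_ring
begin

lemma has_top_bracket:
  assumes "has_top n F f" "has_top m G g"
  shows "has_top (n + m) (poly_ext B F G) (B f g)"
proof -
  have F: "degree F \<le> n" "coeff F n = f" and G: "degree G \<le> m" "coeff G m = g"
    using assms by (auto simp: has_top_def)
  have *: "poly_ext B F G = (\<Sum>i\<le>n. \<Sum>j\<le>m. monom (B (coeff F i) (coeff G j)) (i + j))"
    using F G by (intro poly_ext_eq)
  have "has_top (n + m) (\<Sum>i\<le>n. \<Sum>j\<le>m. monom (B (coeff F i) (coeff G j)) (i + j))
      (\<Sum>i\<le>n. \<Sum>j\<le>m. if i = n \<and> j = m then B f g else 0)"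
  proof (intro has_top_sum)
    fix i j assume "i \<in> {..n}" "j \<in> {..m}"
    then show "has_top (n + m) (monom (B (coeff F i) (coeff G j)) (i + j)) (if i = n \<and> j = m then B f g else 0)"
      using F G has_top_monom[of "i + j"] has_top_raise[OF has_top_monom, of "i + j" "n + m"] by auto
  qed
  also have "(\<Sum>i\<le>n. \<Sum>j\<le>m. if i = n \<and> j = m then B f g else 0)
      = (\<Sum>i\<le>n. if i = n then \<Sum>j\<le>m. if j = m then B f g else 0 else 0)"
    by (intro sum.cong refl) auto
  finally show ?thesis
    by (simp add: *)
qed

lemma has_top_ad:
  assumes "has_top m W w" "has_top n V x"
  shows "has_top (k * m + n) ((poly_ext B W ^^ k) V) ((B w ^^ k) x)"
proof (induction k)
  case (Suc k)
  then show ?case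
    using has_top_bracket[OF assms(1) Suc.IH] by (simp add: add.assoc)
qed (use assms in simp)

lemma has_top_Lambda_coeff:
  assumes "has_top n V x" "has_top n Y y"
  shows "has_top (Suc k * n) (Lambda_coeff (poly_ext B) V Y k i) (Lambda_coeff B x y k i)"
proof (induction k arbitrary: i)
  case 0
  then show ?case
    using assms by (simp add: has_top_zero)
next
  case (Suc k)
  have "has_top (Suc (Suc k) * n) (poly_ext B Y (Lambda_coeff (poly_ext B) V Y k j)) (B y (Lambda_coeff B x y k j))"
    "has_top (Suc (Suc k) * n) (poly_ext B V (Lambda_coeff (poly_ext B) V Y k j)) (B x (Lambda_coeff B x y k j))" for j
    using has_top_bracket[OF assms(1) Suc.IH] has_top_bracket[OF assms(2) Suc.IH] by simp_all
  then show ?case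
    by (auto intro!: has_top_add simp: has_top_zero)
qed

lemma has_top_Lambda_p:
  assumes "has_top n V x" "has_top n Y y"
  shows "has_top (p * n) (Lambda_p (poly_ext B) p V Y) (Lambda_p B p x y)"
proof -
  have "Suc (p - 1) = p"
    using p_ge_3 by simp
  then show ?thesis
    unfolding Lambda_p_def using has_top_Lambda_coeff[OF assms, of "p - 1"]
    by (intro has_top_sum has_top_of_nat_mult) simp
qed

lemma poisson_hom_eval:
  assumes "\<And>z. B c z = 0"
  shows "poisson_hom (poly_ext B) B (\<lambda>F. poly F c)"
  by (simp add: poisson_hom_def poly_poly_ext[OF assms])

lemmas poisson_hom_eval_0 = poisson_hom_eval[of 0, OF B_zero_left]
lemmas poisson_hom_eval_1 = poisson_hom_eval[of 1, OF B_one_left]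

text \<open>
  The substitute for integration: in characteristic \<open>p\<close> a vanishing derivative kills all coefficients
  strictly between \<open>0\<close> and \<open>p\<close>.
\<close>

lemma poly_eq_0_if_deriv:
  fixes F :: "'a poly"
  assumes "poly_deriv F = 0" "poly F 0 = 0" "has_top p F 0"
  shows "F = 0"
proof (rule poly_eqI)
  fix n
  consider "n = 0" | "0 < n" "n < p" | "n = p" | "p < n"
    by linarith
  then show "coeff F n = coeff 0 n"
  proof cases
    case 1
    then show ?thesis
      using assms by (simp add: poly_0_coeff_0)
  next
    case 2
    have "coeff (poly_deriv F) (n - 1) = 0"
      by (simp add: assms(1))
    then have "of_nat n * coeff F n = 0"
      using 2 by (simp add: coeff_poly_deriv)
    then have "coeff F n = 0"
      by (rule of_nat_mult_eq_0[OF 2])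
    then show ?thesis
      by simp
  qed (use assms(3) in \<open>auto simp: has_top_def coeff_eq_0\<close>)
qed

lemma Lambda_coeff_zero [simp]: "Lambda_coeff B 0 y k i = 0"
  by (induction k arbitrary: i) simp_all

lemma Lambda_p_zero_left [simp]: "Lambda_p B p 0 y = 0"
  by (simp add: Lambda_p_def)

lemma Lambda_coeff_commuting:
  assumes "B x y = 0"
  shows "Lambda_coeff B x y (Suc k) i = 0"
proof (induction k arbitrary: i)
  case 0
  then show ?case
    using assms B_swap[of y x] by simp
next
  case (Suc k)
  then show ?case
    by (simp only: Lambda_coeff.simps(2)[of B x y "Suc k"]) simp
qed

lemma Lambda_p_commuting:
  assumes "B x y = 0"
  shows "Lambda_p B p x y = 0"
proof -
  have "p - 1 = Suc (p - 2)"
    using p_ge_3 by simp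
  then have "Lambda_coeff B x y (p - 1) i = 0" for i
    using Lambda_coeff_commuting[OF assms] by metis
  then show ?thesis
    by (simp add: Lambda_p_def)
qed

lemma Lambda_p_zero_right [simp]: "Lambda_p B p x 0 = 0"
  by (rule Lambda_p_commuting) simp

lemma Lambda_coeff_eq_0: "k < i \<Longrightarrow> Lambda_coeff B x y k i = 0"
  by (induction k arbitrary: i) simp_all

lemma Lambda_coeff_diag: "Lambda_coeff B x y k k = (B x ^^ k) x"
  by (induction k) (simp_all add: Lambda_coeff_eq_0)

lemma coeff_ad_path:
  "coeff ((poly_ext B [:y, x:] ^^ k) [:x:]) n = Lambda_coeff B x y k n"
proof (induction k arbitrary: n)
  case 0
  then show ?case
    by (simp add: coeff_pCons split: nat.splits)
next
  case (Suc k)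
  have *: "coeff (poly_ext B [:y, x:] F) n = B y (coeff F n) + (if n = 0 then 0 else B x (coeff F (n - 1)))"
    for F
  proof (induction F rule: poly_monom_induct)
    case (monom a m)
    have "[:y, x:] = monom y 0 + monom x 1"
      by (simp add: monom_altdef)
    then show ?case
      by (auto simp: poly_ext_add_left poly_ext_monom)
  qed (simp add: poly_ext_add_right B_add_right)
  show ?case
    by (simp add: * Suc.IH)
qed

lemma Lambda_coeff_path:
  "Lambda_coeff (poly_ext B) (monom x 1) [:y:] k i = monom (Lambda_coeff B x y k i) (Suc i)"
proof (induction k arbitrary: i)
  case 0
  then show ?case
    by simp
next
  case (Suc k)
  have "poly_ext B [:y:] (monom a m) = monom (B y a) m" for a m
    using poly_ext_monom[of y 0 a m] by (simp add: monom_0)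
  then show ?case
    using Suc by (cases i) (simp_all add: poly_ext_monom add_monom)
qed

lemma Lambda_p_path_eval: "poly (Lambda_p (poly_ext B) p (monom x 1) [:y:]) 1 = Lambda_p B p x y"
  by (simp add: poisson_hom_Lambda_p[OF poisson_hom_eval_1] poly_monom)

text \<open>
  Along the path \<open>tx + y\<close> the expression \<open>\<Lambda>\<^sub>p(tx, y) = \<Sum>\<^sub>i s\<^sub>i t\<^sup>i / i\<close> is by construction the primitive of
  \<open>ad\<^bsub>tx+y\<^esub>\<^sup>p\<^sup>-\<^sup>1(x)\<close>; the coefficient of \<open>t\<^sup>p\<^sup>-\<^sup>1\<close>, which has no primitive, is \<open>ad\<^sub>x\<^sup>p\<^sup>-\<^sup>1(x) = 0\<close>.
\<close>

lemma poly_deriv_Lambda_p_path: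
  "poly_deriv (Lambda_p (poly_ext B) p (monom x 1) [:y:])
    = (poly_ext B [:y, x:] ^^ (p - 1)) [:x:]"
proof (rule poly_eqI)
  fix n
  have "coeff (Lambda_p (poly_ext B) p (monom x 1) [:y:]) m
     = (\<Sum>i=1..p - 1. if i = m then of_nat (m ^ (p - 2)) * Lambda_coeff B x y (p - 1) (m - 1) else 0)" for m
    unfolding Lambda_p_def coeff_sum Lambda_coeff_path
    by (intro sum.cong refl) (auto simp: of_nat_poly simp del: of_nat_power)
  then have *: "coeff (Lambda_p (poly_ext B) p (monom x 1) [:y:]) (Suc n)
     = (if n < p - 1 then of_nat (Suc n ^ (p - 2)) * Lambda_coeff B x y (p - 1) n else 0)"
    by (auto simp del: of_nat_power)
  consider "n < p - 1" | "n = p - 1" | "p - 1 < n"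
    by linarith
  then show "coeff (poly_deriv (Lambda_p (poly_ext B) p (monom x 1) [:y:])) n
    = coeff ((poly_ext B [:y, x:] ^^ (p - 1)) [:x:]) n"
  proof cases
    case 1
    then have "of_nat (Suc n) * of_nat (Suc n ^ (p - 2)) = (1 :: 'a)"
      by (intro of_nat_power_inverse) auto
    moreover have "coeff (Lambda_p (poly_ext B) p (monom x 1) [:y:]) (Suc n)
        = of_nat (Suc n ^ (p - 2)) * Lambda_coeff B x y (p - 1) n"
      using 1 * by simp
    ultimately show ?thesis
      by (simp only: coeff_poly_deriv coeff_ad_path mult_1_left flip: mult.assoc)
  next
    case 2
    then show ?thesis
      using ad_self[of "p - 1" x] p_ge_3
      unfolding coeff_poly_deriv * coeff_ad_path by (simp add: Lambda_coeff_diag)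
  next
    case 3
    then show ?thesis
      unfolding coeff_poly_deriv * coeff_ad_path by (simp add: Lambda_coeff_eq_0)
  qed
qed

text \<open>
  If \<open>P\<close> were a primitive of the closed one-form, this would be the differential of
  \<open>P(x + y) - P(x) - P(y)\<close>. For the proof, \<open>d\<close> acts on the coefficients of \<open>A[t]\<close> and commutes with
  \<open>\<partial>/\<partial>t\<close>, so closedness along the path \<open>tx + y\<close> shows that \<open>d(\<Lambda>\<^sub>p(tx, y))\<close> and \<open>ad\<^bsub>tx+y\<^esub>\<^sup>p\<^sup>-\<^sup>1(d(tx + y))\<close>
  have the same derivative. The two remaining terms are the coefficients of \<open>t\<^sup>0\<close> and \<open>t\<^sup>p\<close>.
\<close>

lemma derivation_Lambda_p:
  assumes d: "poisson_derivation B d"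
  shows "d (Lambda_p B p x y) =
    (B (x + y) ^^ (p - 1)) (d x + d y) - (B x ^^ (p - 1)) (d x) - (B y ^^ (p - 1)) (d y)"
proof -
  interpret P: poisson_ring "poly_ext B" p
    by (rule poisson_ring_poly)
  let ?B = "poly_ext B"
  define H where "H = Lambda_p ?B p (monom x 1) [:y:]"
  define W where "W = [:y, x:]"
  have TH: "poly_deriv H = (?B W ^^ (p - 1)) [:x:]"
    unfolding H_def W_def by (rule poly_deriv_Lambda_p_path)
  define D where "D = map_poly d"
  have D: "poisson_derivation ?B D" and T: "poisson_derivation ?B poly_deriv"
    unfolding D_def by (rule poisson_derivation_map_poly[OF d] poisson_derivation_poly_deriv)+
  have DT: "poly_deriv (D F) = D (poly_deriv F)" for F
    unfolding D_def by (rule poly_deriv_map_poly[OF d])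
  have coeff_D: "coeff (D F) n = d (coeff F n)" for F n
    unfolding D_def by (rule coeff_map_poly_additive) (rule poisson_derivationD(1)[OF d])
  have DW: "D W = [:d y, d x:]"
    by (rule poly_eqI)
       (auto simp: coeff_D W_def coeff_pCons poisson_derivation_zero[OF d] split: nat.splits)
  have TW: "poly_deriv W = [:x:]"
    by (rule poly_eqI) (auto simp: coeff_poly_deriv W_def coeff_pCons split: nat.splits)
  have W_eval: "poly W 0 = y" "poly (D W) 0 = d y" "poly W 1 = x + y" "poly (D W) 1 = d x + d y"
    unfolding DW unfolding W_def by (simp_all add: add.commute)
  \<comment> \<open>The last two terms cancel the coefficients of \<open>t\<^sup>0\<close> and \<open>t\<^sup>p\<close>.\<close>
  define F where "F = D H - (?B W ^^ (p - 1)) (D W)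
    + [:(B y ^^ (p - 1)) (d y):] + monom ((B x ^^ (p - 1)) (d x)) p"
  have "poly_deriv F = 0"
  proof -
    have "poly_deriv (D H) = poly_deriv ((?B W ^^ (p - 1)) (D W))"
      using P.ad_power_form_closed[OF T D DT, of W]
      by (simp only: DT TH TW)
    then show ?thesis
      by (simp add: F_def poly_deriv_add poisson_derivation_diff[OF T] poly_deriv_monom char_p)
  qed
  moreover have top: "has_top p H 0"
    using has_top_Lambda_p[OF has_top_monom has_top_const_linear, of x y] by (simp add: H_def)
  have degD: "degree (D H) \<le> degree H"
    by (rule degree_le) (simp add: coeff_D coeff_eq_0 poisson_derivation_zero[OF d])
  have "has_top p F 0"
  proof -
    have 1: "has_top p (D H) 0"
      using top degD poisson_derivation_zero[OF d] by (auto simp: has_top_def coeff_D)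
    have "has_top ((p - 1) * 1 + 1) ((?B W ^^ (p - 1)) (D W)) ((B x ^^ (p - 1)) (d x))"
      unfolding DW unfolding W_def by (intro has_top_ad has_top_linear)
    then have 2: "has_top p ((?B W ^^ (p - 1)) (D W)) ((B x ^^ (p - 1)) (d x))"
      using p_ge_3 by simp
    have 3: "has_top p [:a:] 0" for a :: 'a
      by (rule has_top_raise[OF has_top_const]) (use p_ge_3 in simp)
    have "has_top p F (0 - (B x ^^ (p - 1)) (d x) + 0 + (B x ^^ (p - 1)) (d x))"
      unfolding F_def by (intro has_top_add has_top_diff 1 2 3 has_top_monom)
    then show ?thesis
      by simp
  qed
  moreover have "poly F 0 = 0"
  proof -
    have "poly (D H) 0 = d (poly H 0)"
      by (simp add: poly_0_coeff_0 coeff_D)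
    also have "poly H 0 = 0"
      unfolding H_def by (simp add: poisson_hom_Lambda_p[OF poisson_hom_eval_0] poly_monom)
    finally show ?thesis
      using p_ge_3 by (simp add: F_def power_0_left poisson_hom_ad[OF poisson_hom_eval_0] W_eval poly_monom
          poisson_derivation_zero[OF d])
  qed
  ultimately have "F = 0"
    using poly_eq_0_if_deriv by blast
  then have "poly F 1 = 0"
    by simp
  moreover have "poly (D H) 1 = d (poly H 1)"
  proof -
    have "poly (D H) 1 = (\<Sum>i\<le>degree H. coeff (D H) i)"
      unfolding poly_altdef power_one mult_1_right
      by (intro sum.mono_neutral_left) (use degD in \<open>auto simp: coeff_eq_0\<close>)
    then show ?thesis
      by (simp add: coeff_D poly_altdef poisson_derivation_sum[OF d])
  qed
  moreover have "poly H 1 = Lambda_p B p x y"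
    unfolding H_def by (rule Lambda_p_path_eval)
  ultimately show ?thesis
    by (simp add: F_def poisson_hom_ad[OF poisson_hom_eval_1] W_eval poly_monom
        algebra_simps)
qed

text \<open>
  Both sides would be \<open>P(x + y + z) - P(x) - P(y) - P(z)\<close>. With \<open>tx\<close> in place of \<open>x\<close> their derivatives
  in \<open>t\<close> agree by \<open>derivation_Lambda_p\<close>.
\<close>

lemma Lambda_p_cocycle: "Lambda_p B p x z + Lambda_p B p y (x + z) = Lambda_p B p y z + Lambda_p B p x (y + z)"
proof -
  interpret P: poisson_ring "poly_ext B" p
    by (rule poisson_ring_poly)
  let ?B = "poly_ext B"
  define V where "V = monom x 1"
  have TV: "poly_deriv V = [:x:]"
    by (simp add: V_def poly_deriv_monom monom_0)
  have adX: "(?B V ^^ (p - 1)) [:x:] = 0"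
  proof -
    have "?B V [:x:] = 0"
      using poly_ext_monom[of x 1 x 0] by (simp add: V_def monom_0)
    moreover have "p - 1 = Suc (p - 2)"
      using p_ge_3 by simp
    ultimately show ?thesis
      by (simp add: funpow_Suc_right del: funpow.simps)
  qed
  note T = poisson_derivation_poly_deriv
  note dLam = P.derivation_Lambda_p[OF T]
  define F where "F = Lambda_p ?B p V [:z:] + Lambda_p ?B p [:y:] (V + [:z:]) - Lambda_p ?B p [:y:] [:z:]
    - Lambda_p ?B p V [:y + z:]"
  have "poly_deriv F = 0"
  proof -
    have *: "[:y:] + (V + [:z:]) = V + [:y + z:]"
      by (simp add: add.left_commute[of "[:y:]"])
    show ?thesis
      by (simp add: F_def poisson_derivation_diff[OF T] poly_deriv_add dLam TV adX *)
  qed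
  moreover have "poly F 0 = 0"
    by (simp add: F_def poisson_hom_Lambda_p[OF poisson_hom_eval_0] V_def poly_monom)
  moreover have "has_top p F 0"
  proof -
    have V: "has_top 1 V x" and C: "has_top 1 [:a:] 0" for a :: 'a
      unfolding V_def by (rule has_top_monom has_top_const_linear)+
    have "has_top (p * 1) F (Lambda_p B p x 0 + Lambda_p B p 0 (x + 0) - Lambda_p B p 0 0 - Lambda_p B p x 0)"
      unfolding F_def by (intro has_top_add has_top_diff has_top_Lambda_p V C)
    then show ?thesis
      by simp
  qed
  ultimately have "F = 0"
    using poly_eq_0_if_deriv by blast
  then have "poly F 1 = 0"
    by simp
  then show ?thesis
    by (simp add: F_def poisson_hom_Lambda_p[OF poisson_hom_eval_1] V_def poly_monom algebra_simps)
qed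

lemma Lambda_p_swap: "Lambda_p B p y x = Lambda_p B p x y"
  using Lambda_p_cocycle[of x 0 y] by simp

lemma Lambda_p_assoc: "Lambda_p B p x y + Lambda_p B p (x + y) z = Lambda_p B p y z + Lambda_p B p x (y + z)"
  using Lambda_p_cocycle[of x y z]
  by (simp only: Lambda_p_swap[of z "x + y"] Lambda_p_swap[of z y] add.commute[of z y])

text \<open>
  Jacobson's formula for \<open>ad\<close>: both \<open>ad\<^bsub>tx+y\<^esub>\<^sup>p(z)\<close> and \<open>{\<Lambda>\<^sub>p(tx, y), z}\<close> have the derivative
  \<open>{ad\<^bsub>tx+y\<^esub>\<^sup>p\<^sup>-\<^sup>1(x), z}\<close>.
\<close>

lemma ad_power_p_add:
  "(B (x + y) ^^ p) z = (B x ^^ p) z + (B y ^^ p) z + B (Lambda_p B p x y) z"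
proof -
  interpret P: poisson_ring "poly_ext B" p
    by (rule poisson_ring_poly)
  let ?B = "poly_ext B"
  define W where "W = [:y, x:]"
  have TW: "poly_deriv W = [:x:]"
    by (rule poly_eqI) (auto simp: coeff_poly_deriv W_def coeff_pCons split: nat.splits)
  note T = poisson_derivation_poly_deriv
  define H where "H = Lambda_p ?B p (monom x 1) [:y:]"
  have TH: "poly_deriv H = (?B W ^^ (p - 1)) [:x:]"
    unfolding H_def W_def by (rule poly_deriv_Lambda_p_path)
  define F where "F = (?B W ^^ p) [:z:] - ?B H [:z:] - [:(B y ^^ p) z:] - monom ((B x ^^ p) z) p"
  have "poly_deriv F = 0"
    using P.ad_power_p_jacobson[OF T, of W "[:z:]"]
    by (simp add: F_def poisson_derivation_diff[OF T] poisson_derivationD(3)[OF T] TH TW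
        poly_deriv_monom char_p)
  moreover have "poly F 0 = 0"
    using p_ge_3
    by (simp add: power_0_left F_def poisson_hom_ad[OF poisson_hom_eval_0] poisson_homD(4)[OF poisson_hom_eval_0]
        H_def poisson_hom_Lambda_p[OF poisson_hom_eval_0] W_def poly_monom)
  moreover have "has_top p F 0"
  proof -
    have 1: "has_top (p * 1 + 0) ((?B W ^^ p) [:z:]) ((B x ^^ p) z)"
      unfolding W_def by (intro has_top_ad has_top_linear has_top_const)
    have "has_top (p * 1) H (Lambda_p B p x 0)"
      unfolding H_def by (intro has_top_Lambda_p has_top_monom has_top_const_linear)
    then have "has_top p H 0"
      by simp
    then have 2: "has_top (p + 0) (?B H [:z:]) (B 0 z)"
      by (intro has_top_bracket has_top_const)
    have 3: "has_top p [:a:] 0" for a :: 'a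
      by (rule has_top_raise[OF has_top_const]) (use p_ge_3 in simp)
    have "has_top p F ((B x ^^ p) z - 0 - 0 - (B x ^^ p) z)"
      unfolding F_def using 1 2 by (intro has_top_diff 3 has_top_monom) simp_all
    then show ?thesis
      by simp
  qed
  ultimately have "F = 0"
    using poly_eq_0_if_deriv by blast
  then have "poly F 1 = 0"
    by simp
  then show ?thesis
    by (simp add: F_def poisson_hom_ad[OF poisson_hom_eval_1] poisson_homD(4)[OF poisson_hom_eval_1]
        H_def poisson_hom_Lambda_p[OF poisson_hom_eval_1] W_def poly_monom algebra_simps)
qed

end

section \<open>The multiplicative deviation\<close>

text \<open>
  For units, \<open>Phi_coeff B u v k i\<close> is \<open>(uv)\<^sup>k\<^sup>+\<^sup>1\<close> times the coefficient of \<open>t\<^sup>i\<close> in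
  \<open>ad\<^bsub>t log u + log v\<^esub>\<^sup>k\<^sup>+\<^sup>1(log u)\<close>. The recursion clears all denominators, so it makes sense for arbitrary
  \<open>u\<close> and \<open>v\<close>.
\<close>

primrec Phi_coeff :: "('a::comm_ring_1 \<Rightarrow> 'a \<Rightarrow> 'a) \<Rightarrow> 'a \<Rightarrow> 'a \<Rightarrow> nat \<Rightarrow> nat \<Rightarrow> 'a" where
  "Phi_coeff B u v 0 i = (if i = 0 then B v u else 0)"
| "Phi_coeff B u v (Suc k) i =
    u * B v (Phi_coeff B u v k i) - of_nat (Suc k) * B v u * Phi_coeff B u v k i +
    (if i = 0 then 0 else v * B u (Phi_coeff B u v k (i - 1)) + of_nat (Suc k) * B v u * Phi_coeff B u v k (i - 1))"

text \<open>
  For units this is \<open>(uv)\<^sup>p \<Lambda>\<^sub>p(log u, log v)\<close>: the coefficients carry the factor \<open>(uv)\<^sup>p\<^sup>-\<^sup>1\<close>, and the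
  remaining \<open>uv\<close> stands in front.
\<close>

definition Phi_p :: "('a::comm_ring_1 \<Rightarrow> 'a \<Rightarrow> 'a) \<Rightarrow> nat \<Rightarrow> 'a \<Rightarrow> 'a \<Rightarrow> 'a"
  where "Phi_p B p u v = u * v * (\<Sum>i=1..p - 1. of_nat (i ^ (p - 2)) * Phi_coeff B u v (p - 2) (i - 1))"

text \<open>
  A logarithm enters brackets only, so this relation is all that is required of it.
\<close>

definition is_log :: "('a::comm_ring_1 \<Rightarrow> 'a \<Rightarrow> 'a) \<Rightarrow> 'a \<Rightarrow> 'a \<Rightarrow> bool"
  where "is_log B y u \<longleftrightarrow> u dvd 1 \<and> (\<forall>f. B y f * u = B u f)"

lemma poisson_hom_Phi_coeff:
  assumes "poisson_hom B B' h"
  shows "h (Phi_coeff B u v k i) = Phi_coeff B' (h u) (h v) k i"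
  by (induction k arbitrary: i)
     (simp_all add: poisson_homD[OF assms] poisson_hom_zero[OF assms] poisson_hom_diff[OF assms]
       poisson_hom_of_nat[OF assms] del: of_nat_Suc)

lemma poisson_hom_Phi_p:
  assumes "poisson_hom B B' h"
  shows "h (Phi_p B p u v) = Phi_p B' p (h u) (h v)"
  by (simp add: Phi_p_def poisson_hom_sum[OF assms] poisson_homD[OF assms] poisson_hom_of_nat[OF assms]
      poisson_hom_Phi_coeff[OF assms] del: of_nat_power)

lemma unit_cancel: "u dvd 1 \<Longrightarrow> x * u = y * u \<Longrightarrow> x = (y :: 'a::comm_ring_1)"
  by (metis dvd_def mult.assoc mult.right_neutral)

context poisson_ring
begin

lemma is_log_mult:
  assumes "is_log B y u" "is_log B z v"
  shows "is_log B (y + z) (u * v)"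
proof -
  have "B (y + z) f * (u * v) = B (u * v) f" for f
  proof -
    have "B (y + z) f * (u * v) = v * (B y f * u) + u * (B z f * v)"
      by (simp add: B_add_left algebra_simps)
    with assms show ?thesis
      by (simp add: is_log_def B_leibniz)
  qed
  moreover have "u * v dvd 1"
    using assms by (metis is_log_def mult_dvd_mono mult_1)
  ultimately show ?thesis
    by (simp add: is_log_def)
qed

text \<open>
  Bracketing \<open>(uv)\<^sup>k\<^sup>+\<^sup>1 c\<close> with a logarithm also hits the factor \<open>(uv)\<^sup>k\<^sup>+\<^sup>1\<close>. Since
  \<open>{log v, uv} = {v, u} = - {log u, uv}\<close>, this accounts for the terms with \<open>B v u\<close> in the recursion.
\<close>

lemma Phi_coeff_log:
  assumes y: "is_log B y u" and z: "is_log B z v"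
  shows "(u * v) ^ Suc k * Lambda_coeff B y z (Suc k) i = Phi_coeff B u v k i"
proof -
  have zq: "B z (u * v) = B v u"
  proof (rule unit_cancel[of v])
    show "B z (u * v) * v = B v u * v"
    proof -
      have "B z (u * v) * v = B v (u * v)"
        using z by (simp only: is_log_def)
      then show ?thesis
        by (simp add: B_leibniz_right mult.commute)
    qed
  qed (use z in \<open>simp add: is_log_def\<close>)
  have yq: "B y (u * v) = - B v u"
  proof (rule unit_cancel[of u])
    show "B y (u * v) * u = - B v u * u"
    proof -
      have "B y (u * v) * u = B u (u * v)"
        using y by (simp only: is_log_def)
      then show ?thesis
        using B_swap[of u v] by (simp add: B_leibniz_right mult.commute)
    qed
  qed (use y in \<open>simp add: is_log_def\<close>)
  have step: "(u * v) ^ Suc (Suc k) * B w c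
      = u * v * B w ((u * v) ^ Suc k * c) - of_nat (Suc k) * ((u * v) ^ Suc k * c) * B w (u * v)" for w c k
  proof -
    have "B w ((u * v) ^ Suc k * c) = (u * v) ^ Suc k * B w c + c * (of_nat (Suc k) * (u * v) ^ k * B w (u * v))"
      by (subst B_leibniz_right) (simp only: B_power_right diff_Suc_1)
    then show ?thesis
      by (simp del: of_nat_Suc add: algebra_simps)
  qed
  show ?thesis
  proof (induction k arbitrary: i)
    case 0
    have "u * v * B z y = B v u"
    proof (rule unit_cancel[of 1])
      have "u * v * B z y = u * (B z y * v)"
        by (simp add: mult_ac)
      also have "\<dots> = u * B v y"
        using z by (simp add: is_log_def)
      also have "\<dots> = - (B y v * u)"
        using B_swap[of v y] by (simp add: mult.commute)
      also have "\<dots> = B v u"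
        using y B_swap[of u v] by (simp add: is_log_def)
      finally show "u * v * B z y * 1 = B v u * 1"
        by simp
    qed simp
    then show ?case
      by simp
  next
    case (Suc k)
    have "(u * v) ^ Suc (Suc k) * B z (Lambda_coeff B y z (Suc k) j)
        = u * B v (Phi_coeff B u v k j) - of_nat (Suc k) * B v u * Phi_coeff B u v k j" for j
    proof -
      have "u * v * B z (Phi_coeff B u v k j) = u * B v (Phi_coeff B u v k j)"
      proof -
        have "u * v * B z (Phi_coeff B u v k j) = u * (B z (Phi_coeff B u v k j) * v)"
          by (simp add: mult_ac)
        with z show ?thesis
          by (simp add: is_log_def)
      qed
      then show ?thesis
        unfolding step Suc.IH zq by (simp del: of_nat_Suc add: mult_ac)
    qed
    moreover have "(u * v) ^ Suc (Suc k) * B y (Lambda_coeff B y z (Suc k) j)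
        = v * B u (Phi_coeff B u v k j) + of_nat (Suc k) * B v u * Phi_coeff B u v k j" for j
    proof -
      have "u * v * B y (Phi_coeff B u v k j) = v * B u (Phi_coeff B u v k j)"
      proof -
        have "u * v * B y (Phi_coeff B u v k j) = v * (B y (Phi_coeff B u v k j) * u)"
          by (simp add: mult_ac)
        with y show ?thesis
          by (simp add: is_log_def)
      qed
      then show ?thesis
        unfolding step Suc.IH yq by (simp del: of_nat_Suc add: mult_ac)
    qed
    ultimately show ?case
      unfolding Lambda_coeff.simps(2)[of B y z "Suc k"] Phi_coeff.simps(2) distrib_left
      by (simp del: of_nat_Suc power_Suc Lambda_coeff.simps Phi_coeff.simps)
  qed
qed

lemma Phi_p_log:
  assumes "is_log B y u" "is_log B z v"
  shows "Phi_p B p u v = (u * v) ^ p * Lambda_p B p y z"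
proof -
  have *: "p - 1 = Suc (p - 2)" "p = Suc (p - 1)"
    using p_ge_3 by simp_all
  have "Phi_coeff B u v (p - 2) i = (u * v) ^ (p - 1) * Lambda_coeff B y z (p - 1) i" for i
    using Phi_coeff_log[OF assms, of "p - 2" i] * by metis
  moreover have "(u * v) ^ p = u * v * (u * v) ^ (p - 1)"
    using *(2) by (metis power_Suc)
  ultimately show ?thesis
    by (simp add: Phi_p_def Lambda_p_def sum_distrib_left mult_ac)
qed

lemma ad_log:
  assumes y: "is_log B y u"
  shows "u ^ n * (B y ^^ n) x = (B u ^^ n) x"
proof (induction n)
  case (Suc n)
  have "B u ((B u ^^ n) x) = B u (u ^ n * (B y ^^ n) x)"
    by (simp add: Suc)
  also have "\<dots> = u ^ n * B u ((B y ^^ n) x)"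
    by (simp add: B_leibniz_right B_power_right)
  also have "\<dots> = u ^ n * (B y ((B y ^^ n) x) * u)"
    using y by (simp add: is_log_def)
  finally show ?case
    by (simp add: mult_ac)
qed simp

lemma ad_log_scaled:
  assumes y: "is_log B y u"
  shows "u ^ p * (B y ^^ (p - 1)) x = (B u ^^ (p - 1)) (x * u)"
proof -
  have *: "u * (B u ^^ n) x = (B u ^^ n) (x * u)" for n
    by (induction n) (simp_all add: mult.commute B_leibniz_right[of u u, simplified, symmetric])
  have "u ^ p = u * u ^ (p - 1)"
    using p_ge_3 by (simp flip: power_Suc)
  then show ?thesis
    using ad_log[OF y, of "p - 1" x] by (simp add: mult.assoc *)
qed

text \<open>
  Both sides are \<open>(uvw)\<^sup>p\<close> times the two sides of \<open>Lambda_p_assoc\<close> at the logarithms.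
\<close>

lemma Phi_p_assoc_log:
  assumes "is_log B x u" "is_log B y v" "is_log B z w"
  shows "w ^ p * Phi_p B p u v + Phi_p B p (u * v) w = u ^ p * Phi_p B p v w + Phi_p B p u (v * w)"
proof -
  note P = Phi_p_log[OF assms(1,2)] Phi_p_log[OF is_log_mult[OF assms(1,2)] assms(3)]
    Phi_p_log[OF assms(2,3)] Phi_p_log[OF assms(1) is_log_mult[OF assms(2,3)]]
  have "w ^ p * Phi_p B p u v + Phi_p B p (u * v) w = (u * v * w) ^ p * (Lambda_p B p x y + Lambda_p B p (x + y) z)"
    by (simp add: P power_mult_distrib algebra_simps)
  also have "\<dots> = u ^ p * Phi_p B p v w + Phi_p B p u (v * w)"
    unfolding Lambda_p_assoc by (simp add: P power_mult_distrib algebra_simps)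
  finally show ?thesis .
qed

lemma Phi_p_swap_log:
  assumes "is_log B x u" "is_log B y v"
  shows "Phi_p B p v u = Phi_p B p u v"
  by (simp add: Phi_p_log[OF assms] Phi_p_log[OF assms(2,1)] Lambda_p_swap[of y x] mult.commute)

lemma ad_power_p_mult_log:
  assumes y: "is_log B y u" and z: "is_log B z v"
  shows "(B (u * v) ^^ p) x = v ^ p * (B u ^^ p) x + u ^ p * (B v ^^ p) x + B (Phi_p B p u v) x"
proof -
  have "(B (u * v) ^^ p) x = (u * v) ^ p * (B (y + z) ^^ p) x"
    by (simp add: ad_log[OF is_log_mult[OF y z]])
  also have "\<dots> = v ^ p * (u ^ p * (B y ^^ p) x) + u ^ p * (v ^ p * (B z ^^ p) x)
      + (u * v) ^ p * B (Lambda_p B p y z) x"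
    by (simp add: ad_power_p_add power_mult_distrib algebra_simps)
  also have "(u * v) ^ p * B (Lambda_p B p y z) x = B (Phi_p B p u v) x"
    by (simp add: Phi_p_log[OF y z] B_central_mult_left)
  finally show ?thesis
    by (simp add: ad_log[OF y] ad_log[OF z])
qed

lemma derivation_Phi_p_log:
  assumes d: "poisson_derivation B d" and y: "is_log B y u" and z: "is_log B z v"
    and dy: "d y * u = d u" and dz: "d z * v = d v"
  shows "d (Phi_p B p u v) = (B (u * v) ^^ (p - 1)) (d (u * v))
    - v ^ p * (B u ^^ (p - 1)) (d u) - u ^ p * (B v ^^ (p - 1)) (d v)"
proof -
  have duv: "(d y + d z) * (u * v) = d (u * v)"
  proof -
    have "(d y + d z) * (u * v) = v * (d y * u) + u * (d z * v)"
      by (simp add: algebra_simps)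
    also have "\<dots> = d (u * v)"
      unfolding dy dz by (simp add: poisson_derivationD[OF d] algebra_simps)
    finally show ?thesis .
  qed
  have "d (Phi_p B p u v) = (u * v) ^ p * d (Lambda_p B p y z)"
    by (simp add: Phi_p_log[OF y z] poisson_derivationD[OF d] poisson_derivation_power_p[OF d])
  also have "\<dots> = (u * v) ^ p * (B (y + z) ^^ (p - 1)) (d y + d z)
     - v ^ p * (u ^ p * (B y ^^ (p - 1)) (d y)) - u ^ p * (v ^ p * (B z ^^ (p - 1)) (d z))"
    by (simp add: derivation_Lambda_p[OF d] power_mult_distrib algebra_simps)
  finally show ?thesis
    by (simp only: ad_log_scaled[OF is_log_mult[OF y z]] ad_log_scaled[OF y] ad_log_scaled[OF z]
        duv dy dz)
qed

lemma const_unit: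
  assumes "u dvd 1"
  shows "[:u:] dvd (1 :: 'a poly)"
proof -
  obtain u' where "1 = u * u'"
    using assms by (elim dvdE)
  then have "1 = [:u:] * [:u':]"
    by (simp add: one_pCons mult.commute)
  then show ?thesis
    by (rule dvdI)
qed

text \<open>
  The last conjunct keeps the logarithms found so far, which allows the construction to be iterated.
\<close>

lemma log_extension:
  assumes "u dvd 1" and d: "poisson_derivation B d"
  shows "\<exists>B' (y :: 'a poly) D. poisson_ring B' p \<and> poisson_hom B B' (\<lambda>a. [:a:]) \<and> is_log B' y [:u:] \<and>
    poisson_derivation B' D \<and> (\<forall>a. D [:a:] = [:d a:]) \<and> D y * [:u:] = [:d u:] \<and>
    (\<forall>z v. is_log B z v \<longrightarrow> is_log B' [:z:] [:v:])"
proof -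
  obtain u' where u: "u * u' = 1"
    using assms(1) by (metis dvd_def)
  define h where "h = (\<lambda>a. u' * B u a)"
  have h: "poisson_derivation B h"
    unfolding h_def by (rule poisson_derivation_log[OF u])
  define B' where "B' = log_bracket B h"
  define D where "D = (\<lambda>f. map_poly d f + [:u' * d u:] * poly_deriv f)"
  have unit: "[:u:] dvd 1"
    by (rule const_unit[OF assms(1)])
  have 1: "poisson_ring B' p"
    unfolding B'_def by (rule poisson_ring_log_bracket[OF h])
  have 2: "poisson_hom B B' (\<lambda>a. [:a:])"
    by (simp add: poisson_hom_def B'_def log_bracket_const[OF h])
  have 3: "is_log B' [:0, 1:] [:u:]"
    using unit log_bracket_variable[OF u] by (simp add: is_log_def B'_def h_def)
  have 4: "poisson_derivation B' D"
    unfolding B'_def D_def h_def by (rule poisson_derivation_log_bracket[OF u d])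
  have 5: "D [:a:] = [:d a:]" for a
    by (simp add: D_def map_poly_pCons poisson_derivation_zero[OF d])
  have 6: "D [:0, 1:] * [:u:] = [:d u:]"
  proof -
    have "poly_deriv [:0, 1 :: 'a:] = 1"
      by (rule poly_eqI) (auto simp: coeff_poly_deriv coeff_pCons split: nat.splits)
    moreover have "map_poly d [:0, 1:] = 0"
      by (simp add: map_poly_pCons poisson_derivation_zero[OF d] poisson_derivation_one[OF d])
    moreover have "u' * d u * u = d u"
      using u by (metis mult.assoc mult.commute mult_1)
    ultimately show ?thesis
      by (simp add: D_def mult.commute mult.left_commute)
  qed
  have 7: "is_log B' [:z:] [:v:]" if z: "is_log B z v" for z v
  proof -
    have "h z * v = h v"
    proof -
      have "B u z * v = B u v"
        using z B_swap[of u z] B_swap[of u v] by (simp add: is_log_def)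
      then show ?thesis
        by (simp add: h_def mult.assoc)
    qed
    then have hz: "map_poly h [:z:] * [:v:] = map_poly h [:v:]"
      by (simp add: map_poly_pCons poisson_derivation_zero[OF h] mult.commute)
    have "poly_ext B [:z:] f * [:v:] = poly_ext B [:v:] f" for f
    proof (rule poly_eqI)
      fix n
      show "coeff (poly_ext B [:z:] f * [:v:]) n = coeff (poly_ext B [:v:] f) n"
        using z by (simp add: is_log_def coeff_poly_ext_const mult.commute)
    qed
    moreover have "map_poly h [:z:] * poly_deriv f * [:v:] = map_poly h [:v:] * poly_deriv f" for f
      unfolding hz[symmetric] by (simp only: ac_simps)
    ultimately have "B' [:z:] f * [:v:] = B' [:v:] f" for f
      by (simp only: B'_def log_bracket_def poly_deriv_const left_diff_distrib mult_zero_left add_0_right)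
    moreover have "[:v:] dvd 1"
      using z const_unit by (simp add: is_log_def)
    ultimately show ?thesis
      by (simp add: is_log_def)
  qed
  show ?thesis
    using 1 2 3 4 5 6 7 by blast
qed

lemma poisson_derivation_0: "poisson_derivation B (\<lambda>_. 0)"
  by (simp add: poisson_derivation_def)

lemma log_extension2:
  assumes "u dvd 1" "v dvd 1" and d: "poisson_derivation B d"
  shows "\<exists>B' (y :: 'a poly poly) z D. poisson_ring B' p \<and> poisson_hom B B' (\<lambda>a. [:[:a:]:]) \<and>
    is_log B' y [:[:u:]:] \<and> is_log B' z [:[:v:]:] \<and> poisson_derivation B' D \<and>
    (\<forall>a. D [:[:a:]:] = [:[:d a:]:]) \<and> D y * [:[:u:]:] = [:[:d u:]:] \<and> D z * [:[:v:]:] = [:[:d v:]:]"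
proof -
  obtain B1 D1 and y :: "'a poly" where 1: "poisson_ring B1 p" "poisson_hom B B1 (\<lambda>a. [:a:])"
    "is_log B1 y [:u:]" "poisson_derivation B1 D1" "\<And>a. D1 [:a:] = [:d a:]" "D1 y * [:u:] = [:d u:]"
    using log_extension[OF assms(1) d] by blast
  obtain B2 D2 and z :: "'a poly poly" where 2: "poisson_ring B2 p" "poisson_hom B1 B2 (\<lambda>a. [:a:])"
    "is_log B2 z [:[:v:]:]" "poisson_derivation B2 D2" "\<And>a. D2 [:a:] = [:D1 a:]"
    "D2 z * [:[:v:]:] = [:D1 [:v:]:]" "\<And>z v. is_log B1 z v \<Longrightarrow> is_log B2 [:z:] [:v:]"
    using poisson_ring.log_extension[OF 1(1) const_unit[OF assms(2)] 1(4)] by blast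
  have "D2 [:y:] * [:[:u:]:] = [:D1 y * [:u:]:]"
    by (simp add: 2 mult.commute)
  then show ?thesis
    using 1 2 poisson_hom_comp[OF 1(2) 2(2)] 2(7)[OF 1(3)]
    by (intro exI[of _ B2] exI[of _ "[:y:]"] exI[of _ z] exI[of _ D2]) simp
qed

lemma log_extension3:
  assumes "u dvd 1" "v dvd 1" "w dvd 1"
  shows "\<exists>B' (x :: 'a poly poly poly) y z. poisson_ring B' p \<and> poisson_hom B B' (\<lambda>a. [:[:[:a:]:]:]) \<and>
    is_log B' x [:[:[:u:]:]:] \<and> is_log B' y [:[:[:v:]:]:] \<and> is_log B' z [:[:[:w:]:]:]"
proof -
  obtain B2 D2 and x y :: "'a poly poly" where 2: "poisson_ring B2 p" "poisson_hom B B2 (\<lambda>a. [:[:a:]:])"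
    "is_log B2 x [:[:u:]:]" "is_log B2 y [:[:v:]:]" "poisson_derivation B2 D2"
    using log_extension2[OF assms(1,2) poisson_derivation_0] by blast
  interpret P2: poisson_ring B2 p
    by fact
  interpret P1: poisson_ring "poly_ext B" p
    by (rule poisson_ring_poly)
  obtain B3 D3 and z :: "'a poly poly poly" where 3: "poisson_ring B3 p" "poisson_hom B2 B3 (\<lambda>a. [:a:])"
    "is_log B3 z [:[:[:w:]:]:]" "\<And>z v. is_log B2 z v \<Longrightarrow> is_log B3 [:z:] [:v:]"
    using P2.log_extension[OF P1.const_unit[OF const_unit[OF assms(3)]] 2(5)] by blast
  show ?thesis
    using 3(1,3) poisson_hom_comp[OF 2(2) 3(2)] 3(4)[OF 2(3)] 3(4)[OF 2(4)] by blast
qed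

lemma Phi_p_assoc_unit:
  assumes "u dvd 1" "v dvd 1" "w dvd 1"
  shows "w ^ p * Phi_p B p u v + Phi_p B p (u * v) w = u ^ p * Phi_p B p v w + Phi_p B p u (v * w)"
proof -
  obtain B' and x y z :: "'a poly poly poly" where E: "poisson_ring B' p" "poisson_hom B B' (\<lambda>a. [:[:[:a:]:]:])"
    "is_log B' x [:[:[:u:]:]:]" "is_log B' y [:[:[:v:]:]:]" "is_log B' z [:[:[:w:]:]:]"
    using log_extension3[OF assms] by blast
  let ?e = "\<lambda>a. [:[:[:a:]:]:]"
  note h = poisson_homD(2,3)[OF E(2)] poisson_hom_power[OF E(2)] poisson_hom_Phi_p[OF E(2)]
  have "?e (w ^ p * Phi_p B p u v + Phi_p B p (u * v) w) = ?e (u ^ p * Phi_p B p v w + Phi_p B p u (v * w))"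
    unfolding h by (rule poisson_ring.Phi_p_assoc_log[OF E(1,3-5)])
  then show ?thesis
    by simp
qed

lemma Phi_p_swap_unit:
  assumes "u dvd 1" "v dvd 1"
  shows "Phi_p B p v u = Phi_p B p u v"
proof -
  obtain B' and y z :: "'a poly poly" where E: "poisson_ring B' p" "poisson_hom B B' (\<lambda>a. [:[:a:]:])"
    "is_log B' y [:[:u:]:]" "is_log B' z [:[:v:]:]"
    using log_extension2[OF assms poisson_derivation_0] by blast
  have "[:[:Phi_p B p v u:]:] = [:[:Phi_p B p u v:]:]"
    unfolding poisson_hom_Phi_p[OF E(2)] by (rule poisson_ring.Phi_p_swap_log[OF E(1,3,4)])
  then show ?thesis
    by simp
qed

lemma ad_power_p_mult_unit:
  assumes "u dvd 1" "v dvd 1"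
  shows "(B (u * v) ^^ p) x = v ^ p * (B u ^^ p) x + u ^ p * (B v ^^ p) x + B (Phi_p B p u v) x"
proof -
  obtain B' and y z :: "'a poly poly" where E: "poisson_ring B' p" "poisson_hom B B' (\<lambda>a. [:[:a:]:])"
    "is_log B' y [:[:u:]:]" "is_log B' z [:[:v:]:]"
    using log_extension2[OF assms poisson_derivation_0] by blast
  let ?e = "\<lambda>a. [:[:a:]:]"
  note h = poisson_homD(2,3,4)[OF E(2)] poisson_hom_power[OF E(2)] poisson_hom_Phi_p[OF E(2)] poisson_hom_ad[OF E(2)]
  have "?e ((B (u * v) ^^ p) x) = ?e (v ^ p * (B u ^^ p) x + u ^ p * (B v ^^ p) x + B (Phi_p B p u v) x)"
    unfolding h by (rule poisson_ring.ad_power_p_mult_log[OF E(1,3,4)])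
  then show ?thesis
    by simp
qed

lemma derivation_Phi_p_unit:
  assumes "u dvd 1" "v dvd 1" and d: "poisson_derivation B d"
  shows "d (Phi_p B p u v) = (B (u * v) ^^ (p - 1)) (d (u * v))
    - v ^ p * (B u ^^ (p - 1)) (d u) - u ^ p * (B v ^^ (p - 1)) (d v)"
proof -
  obtain B' D and y z :: "'a poly poly" where E: "poisson_ring B' p" "poisson_hom B B' (\<lambda>a. [:[:a:]:])"
    "is_log B' y [:[:u:]:]" "is_log B' z [:[:v:]:]" "poisson_derivation B' D"
    "\<And>a. D [:[:a:]:] = [:[:d a:]:]" "D y * [:[:u:]:] = [:[:d u:]:]" "D z * [:[:v:]:] = [:[:d v:]:]"
    using log_extension2[OF assms] by blast
  let ?e = "\<lambda>a. [:[:a:]:]"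
  note h = poisson_homD(2,3,4)[OF E(2)] poisson_hom_power[OF E(2)] poisson_hom_Phi_p[OF E(2)]
    poisson_hom_ad[OF E(2)] poisson_hom_diff[OF E(2)] E(6)[symmetric]
  have "?e (d (Phi_p B p u v)) = ?e ((B (u * v) ^^ (p - 1)) (d (u * v))
    - v ^ p * (B u ^^ (p - 1)) (d u) - u ^ p * (B v ^^ (p - 1)) (d v))"
    unfolding h by (rule poisson_ring.derivation_Phi_p_log[OF E(1,5,3,4)]) (simp_all only: E)
  then show ?thesis
    by simp
qed

end

section \<open>From units to arbitrary elements\<close>

definition fps_bracket_ext :: "('a::comm_ring_1 \<Rightarrow> 'a \<Rightarrow> 'a) \<Rightarrow> 'a fps \<Rightarrow> 'a fps \<Rightarrow> 'a fps"
  where "fps_bracket_ext B f g = Abs_fps (\<lambda>n. \<Sum>k\<le>n. B (fps_nth f k) (fps_nth g (n - k)))"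

text \<open>
  Identities for power series hold if they hold modulo every power of the variable, and there a
  series can be replaced by a polynomial.
\<close>

definition agrees :: "nat \<Rightarrow> 'a::comm_ring_1 poly \<Rightarrow> 'a fps \<Rightarrow> bool"
  where "agrees n F f \<longleftrightarrow> (\<forall>k\<le>n. coeff F k = fps_nth f k)"

lemma ex_agrees: "\<exists>F. agrees n F f"
  by (rule exI[of _ "\<Sum>i\<le>n. monom (fps_nth f i) i"]) (auto simp: agrees_def coeff_sum)

lemma agrees_add: "agrees n F f \<Longrightarrow> agrees n G g \<Longrightarrow> agrees n (F + G) (f + g)"
  by (simp add: agrees_def)

lemma agrees_mult: "agrees n F f \<Longrightarrow> agrees n G g \<Longrightarrow> agrees n (F * G) (f * g)"
  by (auto simp: agrees_def coeff_mult fps_mult_nth atMost_atLeast0 intro!: sum.cong)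

lemma agrees_eqI:
  assumes "\<And>n. \<exists>F G. agrees n F f \<and> agrees n G g \<and> F = G"
  shows "f = g"
proof (rule fps_ext)
  fix n
  show "fps_nth f n = fps_nth g n"
    using assms[of n] by (auto simp: agrees_def)
qed

lemma agrees_fps_of_poly: "agrees n F (fps_of_poly F)"
  by (simp add: agrees_def)

text \<open>
  The geometric series. It is the reason for passing from \<open>A[\<sigma>]\<close> to \<open>A[[\<sigma>]]\<close>.
\<close>

lemma fps_linear_unit: "fps_of_poly [:1, a:] dvd (1 :: 'a::comm_ring_1 fps)"
proof (rule dvdI)
  show "1 = fps_of_poly [:1, a:] * Abs_fps (\<lambda>n. (- a) ^ n)"
  proof (rule fps_ext)
    fix n
    show "fps_nth 1 n = fps_nth (fps_of_poly [:1, a:] * Abs_fps (\<lambda>n. (- a) ^ n)) n"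
    proof (cases n)
      case (Suc m)
      have "fps_nth (fps_of_poly [:1, a:] * Abs_fps (\<lambda>n. (- a) ^ n)) n
          = (\<Sum>i\<in>{0, 1}. coeff [:1, a:] i * (- a) ^ (n - i))"
        unfolding fps_mult_nth
        by (intro sum.mono_neutral_cong_right) (auto simp: Suc coeff_pCons split: nat.splits)
      then show ?thesis
        by (simp add: Suc)
    qed (simp add: fps_mult_nth)
  qed
qed

context poisson_ring
begin

lemma coeff_poly_ext:
  "coeff (poly_ext B F G) n = (\<Sum>k\<le>n. B (coeff F k) (coeff G (n - k)))"
proof (induction F rule: poly_monom_induct)
  case (monom a i)
  show ?case
  proof (induction G rule: poly_monom_induct)
    case (monom b j)
    have "(\<Sum>k\<le>n. B (coeff (monom a i) k) (coeff (monom b j) (n - k)))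
        = (\<Sum>k\<le>n. if k = i then B a (coeff (monom b j) (n - i)) else 0)"
      by (intro sum.cong refl) auto
    then show ?case
      by (auto simp: poly_ext_monom)
  qed (simp add: poly_ext_add_right B_add_right sum.distrib)
qed (simp add: poly_ext_add_left B_add_left sum.distrib)

lemma agrees_bracket:
  "agrees n F f \<Longrightarrow> agrees n G g \<Longrightarrow> agrees n (poly_ext B F G) (fps_bracket_ext B f g)"
  by (auto simp: agrees_def coeff_poly_ext fps_bracket_ext_def intro!: sum.cong)

lemma poisson_ring_fps: "poisson_ring (fps_bracket_ext B) p"
proof -
  interpret P: poisson_ring "poly_ext B" p
    by (rule poisson_ring_poly)
  note a = agrees_add agrees_mult agrees_bracket
  show ?thesis
  proof
    fix x y z :: "'a fps"
    show "fps_bracket_ext B (x + y) z = fps_bracket_ext B x z + fps_bracket_ext B y z"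
    proof (rule agrees_eqI)
      fix n
      obtain F G H where "agrees n F x" "agrees n G y" "agrees n H z"
        using ex_agrees by metis
      then show "\<exists>F G. agrees n F (fps_bracket_ext B (x + y) z)
          \<and> agrees n G (fps_bracket_ext B x z + fps_bracket_ext B y z) \<and> F = G"
        by (intro exI conjI) (rule a | assumption | rule P.B_add_left)+
    qed
    show "fps_bracket_ext B x (y + z) = fps_bracket_ext B x y + fps_bracket_ext B x z"
    proof (rule agrees_eqI)
      fix n
      obtain F G H where "agrees n F x" "agrees n G y" "agrees n H z"
        using ex_agrees by metis
      then show "\<exists>F G. agrees n F (fps_bracket_ext B x (y + z))
          \<and> agrees n G (fps_bracket_ext B x y + fps_bracket_ext B x z) \<and> F = G"
        by (intro exI conjI) (rule a | assumption | rule P.B_add_right)+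
    qed
    show "fps_bracket_ext B x x = 0"
    proof (rule agrees_eqI)
      fix n
      obtain F where "agrees n F x"
        using ex_agrees by metis
      then show "\<exists>F G. agrees n F (fps_bracket_ext B x x) \<and> agrees n G 0 \<and> F = G"
        using agrees_fps_of_poly[of n 0] agrees_bracket[of n F x F x] by auto
    qed
    show "fps_bracket_ext B x (fps_bracket_ext B y z) + fps_bracket_ext B y (fps_bracket_ext B z x)
        + fps_bracket_ext B z (fps_bracket_ext B x y) = 0" (is "?l = 0")
    proof (rule agrees_eqI)
      fix n
      obtain F G H where "agrees n F x" "agrees n G y" "agrees n H z"
        using ex_agrees by metis
      then have "agrees n (poly_ext B F (poly_ext B G H) + poly_ext B G (poly_ext B H F)
        + poly_ext B H (poly_ext B F G)) ?l"
        by (intro a)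
      then show "\<exists>F G. agrees n F ?l \<and> agrees n G 0 \<and> F = G"
        using agrees_fps_of_poly[of n 0] P.B_jacobi[of F G H] by auto
    qed
    show "fps_bracket_ext B (x * y) z = x * fps_bracket_ext B y z + y * fps_bracket_ext B x z"
    proof (rule agrees_eqI)
      fix n
      obtain F G H where "agrees n F x" "agrees n G y" "agrees n H z"
        using ex_agrees by metis
      then show "\<exists>F G. agrees n F (fps_bracket_ext B (x * y) z)
          \<and> agrees n G (x * fps_bracket_ext B y z + y * fps_bracket_ext B x z) \<and> F = G"
        by (intro exI conjI) (rule a | assumption | rule P.B_leibniz)+
    qed
    show "of_nat p = (0 :: 'a fps)"
      by (simp add: char_p flip: fps_of_nat)
  qed (fact prime_p p_ge_3)+
qed

lemma poisson_hom_fps_of_poly: "poisson_hom (poly_ext B) (fps_bracket_ext B) fps_of_poly"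
proof -
  have "fps_of_poly (poly_ext B F G) = fps_bracket_ext B (fps_of_poly F) (fps_of_poly G)" for F G
    by (rule fps_ext) (simp add: coeff_poly_ext fps_bracket_ext_def)
  then show ?thesis
    by (simp add: poisson_hom_def fps_of_poly_add fps_of_poly_mult)
qed

lemma poisson_derivation_fps:
  assumes d: "poisson_derivation B d"
  shows "poisson_derivation (fps_bracket_ext B) (\<lambda>f. Abs_fps (\<lambda>n. d (fps_nth f n)))"
  unfolding poisson_derivation_def
proof (intro conjI allI)
  fix f g :: "'a fps"
  show "Abs_fps (\<lambda>n. d (fps_nth (f + g) n)) = Abs_fps (\<lambda>n. d (fps_nth f n)) + Abs_fps (\<lambda>n. d (fps_nth g n))"
    by (rule fps_ext) (simp add: poisson_derivationD[OF d])
  show "Abs_fps (\<lambda>n. d (fps_nth (f * g) n)) = f * Abs_fps (\<lambda>n. d (fps_nth g n)) + Abs_fps (\<lambda>n. d (fps_nth f n)) * g"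
    by (rule fps_ext)
       (simp add: fps_mult_nth poisson_derivation_sum[OF d] poisson_derivationD[OF d] sum.distrib)
  show "Abs_fps (\<lambda>n. d (fps_nth (fps_bracket_ext B f g) n))
      = fps_bracket_ext B (Abs_fps (\<lambda>n. d (fps_nth f n))) g + fps_bracket_ext B f (Abs_fps (\<lambda>n. d (fps_nth g n)))"
    by (rule fps_ext)
       (simp add: fps_bracket_ext_def poisson_derivation_sum[OF d] poisson_derivationD[OF d] sum.distrib)
qed

lemma has_top_Phi_coeff:
  assumes "has_top m U u" "has_top n V v"
  shows "has_top (Suc k * (m + n)) (Phi_coeff (poly_ext B) U V k i) (Phi_coeff B u v k i)"
proof (induction k arbitrary: i)
  case 0
  then show ?case
    using has_top_bracket[OF assms(2,1)] by (simp add: has_top_zero add.commute)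
next
  case (Suc k)
  let ?B = "poly_ext B"
  have 1: "has_top (m + (n + Suc k * (m + n))) (U * ?B V (Phi_coeff ?B U V k i)) (u * B v (Phi_coeff B u v k i))" for i
    by (intro has_top_mult has_top_bracket assms Suc.IH)
  have 2: "has_top (n + (m + Suc k * (m + n))) (V * ?B U (Phi_coeff ?B U V k i)) (v * B u (Phi_coeff B u v k i))" for i
    by (intro has_top_mult has_top_bracket assms Suc.IH)
  have 3: "has_top ((n + m) + Suc k * (m + n)) (of_nat (Suc k) * ?B V U * Phi_coeff ?B U V k i)
      (of_nat (Suc k) * B v u * Phi_coeff B u v k i)" for i
    by (intro has_top_mult has_top_bracket has_top_of_nat_mult assms Suc.IH)
  have e: "m + (n + Suc k * (m + n)) = Suc (Suc k) * (m + n)"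
    "n + (m + Suc k * (m + n)) = Suc (Suc k) * (m + n)"
    "(n + m) + Suc k * (m + n) = Suc (Suc k) * (m + n)"
    by simp_all
  show ?case
    unfolding Phi_coeff.simps(2) using 1 2 3 unfolding e
    by (auto intro!: has_top_add has_top_diff has_top_zero simp del: of_nat_Suc mult_Suc)
qed

lemma has_top_Phi_p:
  assumes "has_top m U u" "has_top n V v"
  shows "has_top (p * (m + n)) (Phi_p (poly_ext B) p U V) (Phi_p B p u v)"
proof -
  have "p = Suc (Suc (p - 2))"
    using p_ge_3 by simp
  then have e: "(m + n) + Suc (p - 2) * (m + n) = p * (m + n)"
    by (metis mult_Suc)
  have "has_top ((m + n) + Suc (p - 2) * (m + n)) (Phi_p (poly_ext B) p U V) (Phi_p B p u v)"
    unfolding Phi_p_def by (intro has_top_mult has_top_sum has_top_of_nat_mult has_top_Phi_coeff assms)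
  then show ?thesis
    by (simp only: e)
qed

lemma has_top_unique: "has_top n F f \<Longrightarrow> has_top n F g \<Longrightarrow> f = g"
  by (simp add: has_top_def)

lemma fps_of_poly_inject: "fps_of_poly F = fps_of_poly G \<Longrightarrow> F = G"
  by (simp add: fps_of_poly_eq_iff)

lemma has_top_eq:
  assumes "fps_of_poly F = fps_of_poly G" "has_top n F f" "has_top n G g"
  shows "f = g"
  using assms fps_of_poly_inject has_top_unique by blast

text \<open>
  Here and in the next three lemmas the identity for units is applied to \<open>1 + \<sigma>a\<close>, \<open>1 + \<sigma>b\<close>, \<open>\<dots>\<close> in
  \<open>A[[\<sigma>]]\<close>. Both sides are polynomials in \<open>\<sigma>\<close>, and their coefficients at the degree bound are the two
  sides for \<open>a\<close>, \<open>b\<close>, \<open>\<dots>\<close>.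
\<close>

lemma Phi_p_assoc: "c ^ p * Phi_p B p a b + Phi_p B p (a * b) c = a ^ p * Phi_p B p b c + Phi_p B p a (b * c)"
proof (rule has_top_eq)
  let ?P = "Phi_p (poly_ext B) p" and ?U = "\<lambda>a. [:1, a:]"
  interpret F: poisson_ring "fps_bracket_ext B" p
    by (rule poisson_ring_fps)
  note h = poisson_homD(2,3)[OF poisson_hom_fps_of_poly] poisson_hom_power[OF poisson_hom_fps_of_poly]
    poisson_hom_Phi_p[OF poisson_hom_fps_of_poly]
  show "fps_of_poly (?U c ^ p * ?P (?U a) (?U b) + ?P (?U a * ?U b) (?U c))
      = fps_of_poly (?U a ^ p * ?P (?U b) (?U c) + ?P (?U a) (?U b * ?U c))"
    unfolding h by (intro F.Phi_p_assoc_unit fps_linear_unit)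
  have e: "p * 1 + p * (1 + 1) = p * 3" "p * (1 + 1 + 1) = p * 3" "p * (1 + (1 + 1)) = p * 3"
    by simp_all
  show "has_top (p * 3) (?U c ^ p * ?P (?U a) (?U b) + ?P (?U a * ?U b) (?U c))
     (c ^ p * Phi_p B p a b + Phi_p B p (a * b) c)"
    using has_top_mult[OF has_top_power has_top_Phi_p] has_top_Phi_p[OF has_top_mult]
    by (intro has_top_add) (metis e has_top_linear)+
  show "has_top (p * 3) (?U a ^ p * ?P (?U b) (?U c) + ?P (?U a) (?U b * ?U c))
     (a ^ p * Phi_p B p b c + Phi_p B p a (b * c))"
    using has_top_mult[OF has_top_power has_top_Phi_p] has_top_Phi_p[OF _ has_top_mult]
    by (intro has_top_add) (metis e has_top_linear)+
qed

lemma Phi_p_swap: "Phi_p B p b a = Phi_p B p a b"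
proof (rule has_top_eq)
  let ?P = "Phi_p (poly_ext B) p" and ?U = "\<lambda>a. [:1, a:]"
  interpret F: poisson_ring "fps_bracket_ext B" p
    by (rule poisson_ring_fps)
  show "fps_of_poly (?P (?U b) (?U a)) = fps_of_poly (?P (?U a) (?U b))"
    unfolding poisson_hom_Phi_p[OF poisson_hom_fps_of_poly] by (intro F.Phi_p_swap_unit fps_linear_unit)
  show "has_top (p * (1 + 1)) (?P (?U b) (?U a)) (Phi_p B p b a)"
    "has_top (p * (1 + 1)) (?P (?U a) (?U b)) (Phi_p B p a b)"
    by (intro has_top_Phi_p has_top_linear)+
qed

lemma ad_power_p_mult:
  "(B (a * b) ^^ p) x = b ^ p * (B a ^^ p) x + a ^ p * (B b ^^ p) x + B (Phi_p B p a b) x"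
proof (rule has_top_eq)
  let ?B = "poly_ext B"
  let ?P = "Phi_p ?B p" and ?U = "\<lambda>a. [:1, a:]"
  interpret F: poisson_ring "fps_bracket_ext B" p
    by (rule poisson_ring_fps)
  note h = poisson_homD(2,3,4)[OF poisson_hom_fps_of_poly] poisson_hom_power[OF poisson_hom_fps_of_poly]
    poisson_hom_Phi_p[OF poisson_hom_fps_of_poly] poisson_hom_ad[OF poisson_hom_fps_of_poly]
  show "fps_of_poly ((?B (?U a * ?U b) ^^ p) [:x:])
      = fps_of_poly (?U b ^ p * (?B (?U a) ^^ p) [:x:] + ?U a ^ p * (?B (?U b) ^^ p) [:x:] + ?B (?P (?U a) (?U b)) [:x:])"
    unfolding h by (intro F.ad_power_p_mult_unit fps_linear_unit)
  show "has_top (p * (1 + 1) + 0) ((?B (?U a * ?U b) ^^ p) [:x:]) ((B (a * b) ^^ p) x)"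
    by (intro has_top_ad has_top_mult has_top_linear has_top_const)
  have "has_top (p * 1 + (p * 1 + 0)) (?U b ^ p * (?B (?U a) ^^ p) [:x:]) (b ^ p * (B a ^^ p) x)" for a b
    by (intro has_top_ad has_top_mult has_top_power has_top_linear has_top_const)
  moreover have "has_top (p * (1 + 1) + 0) (?B (?P (?U a) (?U b)) [:x:]) (B (Phi_p B p a b) x)"
    by (intro has_top_bracket has_top_Phi_p has_top_linear has_top_const)
  moreover have "p * 1 + (p * 1 + 0) = p * (1 + 1) + 0"
    by simp
  ultimately show "has_top (p * (1 + 1) + 0) (?U b ^ p * (?B (?U a) ^^ p) [:x:] + ?U a ^ p * (?B (?U b) ^^ p) [:x:] + ?B (?P (?U a) (?U b)) [:x:])
     (b ^ p * (B a ^^ p) x + a ^ p * (B b ^^ p) x + B (Phi_p B p a b) x)"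
    by (metis has_top_add)
qed

lemma derivation_Phi_p:
  assumes d: "poisson_derivation B d"
  shows "d (Phi_p B p a b) = (B (a * b) ^^ (p - 1)) (d (a * b))
    - b ^ p * (B a ^^ (p - 1)) (d a) - a ^ p * (B b ^^ (p - 1)) (d b)"
proof (rule has_top_eq)
  let ?B = "poly_ext B"
  let ?P = "Phi_p ?B p" and ?U = "\<lambda>a. [:1, a:]"
  interpret F: poisson_ring "fps_bracket_ext B" p
    by (rule poisson_ring_fps)
  define D where "D = map_poly d"
  define D' where "D' = (\<lambda>f. Abs_fps (\<lambda>n. d (fps_nth f n)))"
  have D': "poisson_derivation (fps_bracket_ext B) D'"
    unfolding D'_def by (rule poisson_derivation_fps[OF d])
  have cD: "coeff (D F) n = d (coeff F n)" for F n
    unfolding D_def by (rule coeff_map_poly_additive) (rule poisson_derivationD(1)[OF d])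
  have D_fps: "fps_of_poly (D F) = D' (fps_of_poly F)" for F
    by (rule fps_ext) (simp add: D'_def cD)
  have D_top: "has_top n F f \<Longrightarrow> has_top n (D F) (d f)" for n F f
    by (auto simp: has_top_def cD coeff_eq_0 poisson_derivation_zero[OF d] intro!: degree_le)
  note h = poisson_homD(2,3,4)[OF poisson_hom_fps_of_poly] poisson_hom_power[OF poisson_hom_fps_of_poly]
    poisson_hom_Phi_p[OF poisson_hom_fps_of_poly] poisson_hom_ad[OF poisson_hom_fps_of_poly]
    poisson_hom_diff[OF poisson_hom_fps_of_poly] D_fps
  show "fps_of_poly (D (?P (?U a) (?U b)))
      = fps_of_poly ((?B (?U a * ?U b) ^^ (p - 1)) (D (?U a * ?U b))
        - ?U b ^ p * (?B (?U a) ^^ (p - 1)) (D (?U a)) - ?U a ^ p * (?B (?U b) ^^ (p - 1)) (D (?U b)))"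
    unfolding h by (intro F.derivation_Phi_p_unit fps_linear_unit D')
  show "has_top (p * (1 + 1)) (D (?P (?U a) (?U b))) (d (Phi_p B p a b))"
    by (intro D_top has_top_Phi_p has_top_linear)
  have "has_top ((p - 1) * (1 + 1) + (1 + 1)) ((?B (?U a * ?U b) ^^ (p - 1)) (D (?U a * ?U b)))
      ((B (a * b) ^^ (p - 1)) (d (a * b)))"
    by (intro has_top_ad D_top has_top_mult has_top_linear)
  moreover have "has_top (p * 1 + ((p - 1) * 1 + 1)) (?U b ^ p * (?B (?U a) ^^ (p - 1)) (D (?U a)))
      (b ^ p * (B a ^^ (p - 1)) (d a))" for a b
    by (intro has_top_ad has_top_mult has_top_power D_top has_top_linear)
  moreover have "(p - 1) * (1 + 1) + (1 + 1) = p * (1 + 1)" "p * 1 + ((p - 1) * 1 + 1) = p * (1 + 1)"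
    using p_ge_3 by simp_all
  ultimately show "has_top (p * (1 + 1)) ((?B (?U a * ?U b) ^^ (p - 1)) (D (?U a * ?U b))
        - ?U b ^ p * (?B (?U a) ^^ (p - 1)) (D (?U a)) - ?U a ^ p * (?B (?U b) ^^ (p - 1)) (D (?U b)))
     ((B (a * b) ^^ (p - 1)) (d (a * b))
    - b ^ p * (B a ^^ (p - 1)) (d a) - a ^ p * (B b ^^ (p - 1)) (d b))"
    by (metis has_top_diff)
qed

lemma Phi_coeff_commuting:
  assumes "B v u = 0"
  shows "Phi_coeff B u v k i = 0"
  by (induction k arbitrary: i) (simp_all add: assms)

lemma Phi_p_commuting:
  assumes "B u v = 0"
  shows "Phi_p B p u v = 0"
proof -
  have "B v u = 0"
    using assms B_swap[of v u] by simp
  then show ?thesis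
    by (simp add: Phi_p_def Phi_coeff_commuting)
qed

lemma Phi_p_zero [simp]: "Phi_p B p 0 v = 0" "Phi_p B p u 0 = 0"
  by (simp_all add: Phi_p_def)

text \<open>
  With \<open>tf\<close> in place of \<open>f\<close>, all terms are differentiated by \<open>derivation_Phi_p\<close> and
  \<open>derivation_Lambda_p\<close>, and the derivatives cancel. At \<open>t = 0\<close> and in the coefficient of \<open>t\<^sup>p\<close> the
  identity is the case in which \<open>f\<close> or \<open>h\<close> is \<open>0\<close>.
\<close>

lemma Phi_p_add:
  "Phi_p B p (f + h) g = Phi_p B p f g + Phi_p B p h g + Lambda_p B p (f * g) (h * g) - g ^ p * Lambda_p B p f h"
proof -
  interpret P: poisson_ring "poly_ext B" p
    by (rule poisson_ring_poly)
  let ?B = "poly_ext B"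
  note T = poisson_derivation_poly_deriv
  define V where "V = monom f 1"
  have TV: "poly_deriv V = [:f:]"
    by (simp add: V_def poly_deriv_monom monom_0)
  have Vg: "V * [:g:] = monom (f * g) 1"
    by (simp add: V_def smult_monom mult.commute)
  have ad: "(?B (monom a 1) ^^ (p - 1)) [:a:] = 0" for a
  proof -
    have "?B (monom a 1) [:a:] = 0"
      using poly_ext_monom[of a 1 a 0] by (simp add: monom_0)
    moreover have "p - 1 = Suc (p - 2)"
      using p_ge_3 by simp
    ultimately show ?thesis
      by (simp add: funpow_Suc_right del: funpow.simps)
  qed
  have adV: "(?B V ^^ (p - 1)) [:f:] = 0" and adVg: "(?B (V * [:g:]) ^^ (p - 1)) ([:f:] * [:g:]) = 0"
    using ad[of f] ad[of "f * g"] unfolding Vg by (simp_all add: V_def mult.commute)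
  define F where "F = Phi_p ?B p (V + [:h:]) [:g:] - Phi_p ?B p V [:g:] - Phi_p ?B p [:h:] [:g:]
    - Lambda_p ?B p (V * [:g:]) ([:h:] * [:g:]) + [:g:] ^ p * Lambda_p ?B p V [:h:]"
  have "poly_deriv F = 0"
  proof -
    have 1: "poly_deriv (Phi_p ?B p (V + [:h:]) [:g:])
      = (?B ((V + [:h:]) * [:g:]) ^^ (p - 1)) ([:f:] * [:g:]) - [:g:] ^ p * (?B (V + [:h:]) ^^ (p - 1)) [:f:]"
      by (subst P.derivation_Phi_p[OF T])
         (simp only: poly_deriv_add poly_deriv_mult TV poly_deriv_const P.ad_zero mult_zero_right
            add_0_right add_0_left diff_zero)
    have 2: "poly_deriv (Phi_p ?B p V [:g:]) = 0"
      by (subst P.derivation_Phi_p[OF T])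
         (simp only: poly_deriv_add poly_deriv_mult TV poly_deriv_const P.ad_zero mult_zero_right
            add_0_right add_0_left diff_zero adV adVg)
    have 3: "poly_deriv (Phi_p ?B p [:h:] [:g:]) = 0"
      by (subst P.derivation_Phi_p[OF T])
         (simp only: poly_deriv_add poly_deriv_mult poly_deriv_const P.ad_zero mult_zero_right mult_zero_left
            add_0_right add_0_left diff_zero)
    have 4: "poly_deriv (Lambda_p ?B p (V * [:g:]) ([:h:] * [:g:]))
       = (?B ((V + [:h:]) * [:g:]) ^^ (p - 1)) ([:f:] * [:g:])"
      by (subst P.derivation_Lambda_p[OF T])
         (simp only: poly_deriv_add poly_deriv_mult TV poly_deriv_const P.ad_zero mult_zero_right mult_zero_left
            add_0_right add_0_left diff_zero adVg distrib_right)
    have 5: "poly_deriv ([:g:] ^ p * Lambda_p ?B p V [:h:]) = [:g:] ^ p * (?B (V + [:h:]) ^^ (p - 1)) [:f:]"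
      unfolding poly_deriv_mult P.poisson_derivation_power_p[OF T]
      by (subst P.derivation_Lambda_p[OF T])
         (simp only: poly_deriv_add poly_deriv_mult TV poly_deriv_const P.ad_zero mult_zero_right mult_zero_left
            add_0_right add_0_left diff_zero adV)
    show ?thesis
      by (simp only: F_def poly_deriv_add poisson_derivation_diff[OF T] 1 2 3 4 5) simp
  qed
  moreover have "poly F 0 = 0"
    by (simp add: F_def poisson_hom_Lambda_p[OF poisson_hom_eval_0] poisson_hom_Phi_p[OF poisson_hom_eval_0]
        V_def poly_monom)
  moreover have "has_top p F 0"
  proof -
    have V: "has_top 1 V f" and C: "has_top 1 [:a:] 0" and C0: "has_top 0 [:a:] a" for a :: 'a
      unfolding V_def by (rule has_top_monom has_top_const_linear has_top_const)+
    have 1: "has_top (p * (1 + 0)) (Phi_p ?B p (V + [:h:]) [:g:]) (Phi_p B p (f + 0) g)"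
      "has_top (p * (1 + 0)) (Phi_p ?B p V [:g:]) (Phi_p B p f g)"
      "has_top (p * (1 + 0)) (Phi_p ?B p [:h:] [:g:]) (Phi_p B p 0 g)"
      "has_top (p * (1 + 0)) (Lambda_p ?B p (V * [:g:]) ([:h:] * [:g:])) (Lambda_p B p (f * g) (0 * g))"
      "has_top (p * 0 + p * 1) ([:g:] ^ p * Lambda_p ?B p V [:h:]) (g ^ p * Lambda_p B p f 0)"
      by (intro has_top_Phi_p has_top_Lambda_p has_top_mult has_top_power has_top_add V C C0)+
    have "p * (1 + 0) = p" "p * 0 + p * 1 = p"
      by simp_all
    note 2 = 1[unfolded this]
    have "has_top p F (Phi_p B p (f + 0) g - Phi_p B p f g - Phi_p B p 0 g - Lambda_p B p (f * g) (0 * g) + g ^ p * Lambda_p B p f 0)"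
      unfolding F_def by (intro has_top_add has_top_diff 2)
    then show ?thesis
      by simp
  qed
  ultimately have "F = 0"
    using poly_eq_0_if_deriv by blast
  then have "poly F 1 = 0"
    by simp
  then show ?thesis
    by (simp add: F_def poisson_hom_Lambda_p[OF poisson_hom_eval_1] poisson_hom_Phi_p[OF poisson_hom_eval_1]
        V_def poly_monom algebra_simps)
qed

end

section \<open>Commutative ring of pairs\<close>

text \<open>
  The two laws are designed so that \<open>a \<mapsto> (a, P a)\<close> is a ring homomorphism precisely if \<open>P\<close> obeys the
  sum rule and the product rule.
\<close>

definition pair_add :: "('a::comm_ring_1 \<Rightarrow> 'a \<Rightarrow> 'a) \<Rightarrow> nat \<Rightarrow> 'a \<times> 'a \<Rightarrow> 'a \<times> 'a \<Rightarrow> 'a \<times> 'a"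
  where "pair_add B p s t = (fst s + fst t, snd s + snd t + Lambda_p B p (fst s) (fst t))"

definition pair_mult :: "('a::comm_ring_1 \<Rightarrow> 'a \<Rightarrow> 'a) \<Rightarrow> nat \<Rightarrow> 'a \<times> 'a \<Rightarrow> 'a \<times> 'a \<Rightarrow> 'a \<times> 'a"
  where "pair_mult B p s t =
    (fst s * fst t, fst s ^ p * snd t + fst t ^ p * snd s + Phi_p B p (fst s) (fst t))"

context poisson_ring
begin

lemma p_pos: "0 < p"
  using p_ge_3 by simp

lemma Phi_p_one: "Phi_p B p 1 a = 0" "Phi_p B p a 1 = 0"
  by (simp_all add: Phi_p_commuting)

sublocale pair_add: comm_monoid_set "pair_add B p" "(0, 0)"
proof
  fix s t u :: "'a \<times> 'a"
  show "pair_add B p (pair_add B p s t) u = pair_add B p s (pair_add B p t u)"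
    using Lambda_p_assoc[of "fst s" "fst t" "fst u"] by (simp add: pair_add_def algebra_simps)
  show "pair_add B p s t = pair_add B p t s"
    by (simp add: pair_add_def Lambda_p_swap[of "fst s"] add.commute)
  show "pair_add B p s (0, 0) = s"
    by (simp add: pair_add_def)
qed

sublocale pair_mult: comm_monoid_set "pair_mult B p" "(1, 0)"
proof
  fix s t u :: "'a \<times> 'a"
  show "pair_mult B p (pair_mult B p s t) u = pair_mult B p s (pair_mult B p t u)"
    using Phi_p_assoc[of "fst u" "fst s" "fst t"]
    by (simp add: pair_mult_def power_mult_distrib algebra_simps)
  show "pair_mult B p s t = pair_mult B p t s"
    by (simp add: pair_mult_def Phi_p_swap[of "fst s"] mult.commute add.commute)
  show "pair_mult B p s (1, 0) = s"
    by (simp add: pair_mult_def Phi_p_one)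
qed

lemma pair_distrib:
  "pair_mult B p (pair_add B p s t) u = pair_add B p (pair_mult B p s u) (pair_mult B p t u)"
  by (simp add: pair_mult_def pair_add_def frobenius_add Phi_p_add algebra_simps)

lemma pair_zero_mult: "pair_mult B p (0, 0) s = (0, 0)"
  using p_pos by (simp add: pair_mult_def zero_power)

lemma pair_distrib_right:
  "pair_mult B p u (pair_add B p s t) = pair_add B p (pair_mult B p u s) (pair_mult B p u t)"
  by (simp only: pair_mult.commute[of u] pair_distrib)

lemma pair_add_central:
  assumes "\<And>z. B c z = 0"
  shows "pair_add B p (c, 0) (d, 0) = (c + d, 0)"
  by (simp add: pair_add_def Lambda_p_commuting assms)

lemma pair_mult_central:
  assumes "\<And>z. B c z = 0"
  shows "pair_mult B p (c, 0) s = (c * fst s, c ^ p * snd s)"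
  by (simp add: pair_mult_def Phi_p_commuting assms)

end

section \<open>Polynomials in several variables\<close>

lemma mpoly_sum_singles: "f = (\<Sum>m\<in>keys f. single m (lookup f m))"
  by (rule poly_mapping_eqI)
     (auto simp: lookup_sum lookup_single when_def not_in_keys_iff_lookup_eq_zero)

lemma mpoly_single_induct [case_names single add]:
  assumes "\<And>m c. P (single m c)" "\<And>f g. P f \<Longrightarrow> P g \<Longrightarrow> P (f + g)"
  shows "P (f :: 'm \<Rightarrow>\<^sub>0 'k::comm_monoid_add)"
proof -
  have "P (\<Sum>m\<in>A. single m (lookup f m))" if "finite A" for A
    using that
  proof (induction A)
    case empty
    then show ?case
      using assms(1)[of undefined 0] by simp
  qed (simp add: assms)
  then show ?thesis
    using mpoly_sum_singles[of f] by (metis finite_keys)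
qed

lemma mconst_add: "mconst (a + b) = mconst a + mconst b"
  by (simp add: mconst_def single_add)

lemma mconst_mult: "mconst (a * b) = mconst a * (mconst b :: ('i, 'k::comm_ring_1) mpoly)"
  by (simp add: mconst_def mult_single)

lemma mconst_0 [simp]: "mconst 0 = 0"
  by (simp add: mconst_def)

lemma mconst_1 [simp]: "mconst 1 = 1"
  by (simp add: mconst_def)

lemma mconst_of_nat: "mconst (of_nat n) = (of_nat n :: ('i, 'k::comm_ring_1) mpoly)"
  by (simp add: mconst_def)

lemma mconst_power: "mconst (a ^ n) = (mconst a :: ('i, 'k::comm_ring_1) mpoly) ^ n"
  by (induction n) (simp_all add: mconst_mult)

lemma mpoly_single_in_induct:
  fixes P :: "('i, 'k::comm_ring_1) mpoly \<Rightarrow> bool"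
  assumes "keys m \<subseteq> I"
    and const: "\<And>c. P (mconst c)"
    and var: "\<And>i f. i \<in> I \<Longrightarrow> P f \<Longrightarrow> P (mvar i * f)"
  shows "P (single m c)"
  using assms(1)
proof (induction "\<Sum>i\<in>keys m. lookup m i" arbitrary: m rule: less_induct)
  case less
  show ?case
  proof (cases "m = 0")
    case True
    then show ?thesis
      using const[of c] by (simp add: mconst_def)
  next
    case False
    then obtain i where i: "i \<in> keys m"
      by (metis keys_eq_empty all_not_in_conv)
    define n where "n = m - single i 1"
    have m: "m = single i 1 + n"
      by (rule poly_mapping_eqI)
         (use i in \<open>auto simp: n_def lookup_add lookup_minus lookup_single when_def in_keys_iff\<close>)
    have le: "lookup n j \<le> lookup m j" for j
      by (simp add: n_def lookup_minus)
    have keys: "keys n \<subseteq> keys m"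
      using le by (metis in_keys_iff le_zero_eq subsetI)
    have "(\<Sum>i\<in>keys n. lookup n i) \<le> (\<Sum>i\<in>keys m. lookup n i)"
      using keys by (intro sum_mono2) auto
    also have "\<dots> < (\<Sum>i\<in>keys m. lookup m i)"
    proof (rule sum_strict_mono_ex1)
      show "\<exists>j\<in>keys m. lookup n j < lookup m j"
        using i by (intro bexI[of _ i]) (auto simp: n_def lookup_minus in_keys_iff)
    qed (use le in auto)
    finally have "P (single n c)"
      using less keys by blast
    then have "P (mvar i * single n c)"
      using var i less.prems by blast
    then show ?thesis
      by (simp add: m mvar_def mult_single)
  qed
qed

lemma mpoly_in_induct [consumes 1, case_names const add var]:
  fixes P :: "('i, 'k::comm_ring_1) mpoly \<Rightarrow> bool"
  assumes "mvars f \<subseteq> I"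
    and const: "\<And>c. P (mconst c)"
    and add: "\<And>f g. P f \<Longrightarrow> P g \<Longrightarrow> P (f + g)"
    and var: "\<And>i f. i \<in> I \<Longrightarrow> P f \<Longrightarrow> P (mvar i * f)"
  shows "P f"
proof -
  have "P (\<Sum>m\<in>A. single m (lookup f m))" if "A \<subseteq> keys f" for A
  proof -
    have "finite A"
      using that by (rule finite_subset) simp
    then show ?thesis
      using that
    proof (induction A)
      case empty
      then show ?case
        using const[of 0] by simp
    next
      case (insert m A)
      have "P (single m (lookup f m))"
      proof (rule mpoly_single_in_induct[of m I])
        show "keys m \<subseteq> I"
          using insert.prems assms(1) by (auto simp: mvars_def)
      qed (use const var in auto)
      then show ?case
        using insert add by simp
    qed
  qed
  then show ?thesis
    using mpoly_sum_singles[of f] by (metis order_refl)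
qed

lemma mpoly_induct [case_names const add var]:
  fixes P :: "('i, 'k::comm_ring_1) mpoly \<Rightarrow> bool"
  assumes "\<And>c. P (mconst c)" "\<And>f g. P f \<Longrightarrow> P g \<Longrightarrow> P (f + g)" "\<And>i f. P f \<Longrightarrow> P (mvar i * f)"
  shows "P f"
  by (rule mpoly_in_induct[of f UNIV]) (use assms in auto)

section \<open>The p-map of a polynomial Poisson algebra\<close>

text \<open>
  The image of a monomial, and then of a polynomial, under the homomorphism to the ring of pairs that
  sends \<open>x\<^sub>i\<close> to \<open>(x\<^sub>i, r i)\<close> and a scalar \<open>c\<close> to \<open>(c, 0)\<close>. Sums and products of pairs are the iterated
  operations of the two commutative monoids.
\<close>

definition monomial_pair ::
  "(('i, 'k::comm_ring_1) mpoly \<Rightarrow> ('i, 'k) mpoly \<Rightarrow> ('i, 'k) mpoly) \<Rightarrow> nat \<Rightarrow> ('i \<Rightarrow> ('i, 'k) mpoly) \<Rightarrow>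
    ('i \<Rightarrow>\<^sub>0 nat) \<Rightarrow> ('i, 'k) mpoly \<times> ('i, 'k) mpoly"
  where "monomial_pair B p r m = comm_monoid_set.F (pair_mult B p) (1, 0)
    (\<lambda>i. (pair_mult B p (mvar i, r i) ^^ lookup m i) (1, 0)) (keys m)"

definition poly_pair ::
  "(('i, 'k::comm_ring_1) mpoly \<Rightarrow> ('i, 'k) mpoly \<Rightarrow> ('i, 'k) mpoly) \<Rightarrow> nat \<Rightarrow> ('i \<Rightarrow> ('i, 'k) mpoly) \<Rightarrow>
    ('i, 'k) mpoly \<Rightarrow> ('i, 'k) mpoly \<times> ('i, 'k) mpoly"
  where "poly_pair B p r f = comm_monoid_set.F (pair_add B p) (0, 0)
    (\<lambda>m. pair_mult B p (mconst (lookup f m), 0) (monomial_pair B p r m)) (keys f)"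

locale mpoly_poisson = poisson_ring B p
  for B :: "('i, 'k::comm_ring_1) mpoly \<Rightarrow> ('i, 'k) mpoly \<Rightarrow> ('i, 'k) mpoly" and p +
  fixes r :: "'i \<Rightarrow> ('i, 'k) mpoly"
  assumes B_mconst: "B (mconst c) f = 0"
    and ad_mvar: "(B (mvar i) ^^ p) f = B (r i) f"
begin

abbreviation "pair_power s n \<equiv> (pair_mult B p s ^^ n) (1, 0)"

lemma pair_power_add: "pair_power s (m + n) = pair_mult B p (pair_power s m) (pair_power s n)"
  by (induction m) (simp_all add: pair_mult.assoc pair_mult.left_neutral)

lemma monomial_pair_eq:
  assumes "finite S" "keys m \<subseteq> S"
  shows "monomial_pair B p r m = pair_mult.F (\<lambda>i. pair_power (mvar i, r i) (lookup m i)) S"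
  unfolding monomial_pair_def
  by (rule pair_mult.mono_neutral_left) (use assms in \<open>auto simp: in_keys_iff\<close>)

lemma monomial_pair_add:
  "monomial_pair B p r (m + n) = pair_mult B p (monomial_pair B p r m) (monomial_pair B p r n)"
proof -
  let ?S = "keys m \<union> keys n"
  have "monomial_pair B p r (m + n) = pair_mult.F (\<lambda>i. pair_power (mvar i, r i) (lookup (m + n) i)) ?S"
    by (rule monomial_pair_eq) (simp_all add: keys_add)
  also have "\<dots> = pair_mult.F (\<lambda>i. pair_mult B p (pair_power (mvar i, r i) (lookup m i))
      (pair_power (mvar i, r i) (lookup n i))) ?S"
    by (simp only: lookup_add pair_power_add)
  also have "\<dots> = pair_mult B p (monomial_pair B p r m) (monomial_pair B p r n)"
    unfolding pair_mult.distrib by (simp add: monomial_pair_eq[of ?S])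
  finally show ?thesis .
qed

lemma monomial_pair_0: "monomial_pair B p r 0 = (1, 0)"
  by (simp add: monomial_pair_def)

lemma monomial_pair_var: "monomial_pair B p r (single i 1) = (mvar i, r i)"
  by (simp add: monomial_pair_eq[of "{i}"] pair_mult.right_neutral)

lemma poly_pair_eq:
  assumes "finite S" "keys f \<subseteq> S"
  shows "poly_pair B p r f = pair_add.F (\<lambda>m. pair_mult B p (mconst (lookup f m), 0) (monomial_pair B p r m)) S"
  unfolding poly_pair_def
  by (rule pair_add.mono_neutral_left) (use assms in \<open>auto simp: in_keys_iff pair_zero_mult\<close>)

lemma poly_pair_add: "poly_pair B p r (f + g) = pair_add B p (poly_pair B p r f) (poly_pair B p r g)"
proof -
  let ?S = "keys f \<union> keys g"
  have "poly_pair B p r (f + g)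
     = pair_add.F (\<lambda>m. pair_mult B p (mconst (lookup (f + g) m), 0) (monomial_pair B p r m)) ?S"
    by (rule poly_pair_eq) (simp_all add: keys_add)
  also have "\<dots> = pair_add.F (\<lambda>m. pair_add B p (pair_mult B p (mconst (lookup f m), 0) (monomial_pair B p r m))
     (pair_mult B p (mconst (lookup g m), 0) (monomial_pair B p r m))) ?S"
    by (simp only: lookup_add mconst_add pair_add_central[OF B_mconst, symmetric] pair_distrib)
  also have "\<dots> = pair_add B p (poly_pair B p r f) (poly_pair B p r g)"
    unfolding pair_add.distrib by (simp add: poly_pair_eq[of ?S])
  finally show ?thesis .
qed

lemma poly_pair_single:
  "poly_pair B p r (single m c) = pair_mult B p (mconst c, 0) (monomial_pair B p r m)"
  by (simp add: poly_pair_eq[of "{m}"] pair_add.right_neutral)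

lemma poly_pair_mult: "poly_pair B p r (f * g) = pair_mult B p (poly_pair B p r f) (poly_pair B p r g)"
proof (induction f rule: mpoly_single_induct)
  case (single m c)
  show ?case
  proof (induction g rule: mpoly_single_induct)
    case (single n d)
    have "pair_mult B p (mconst c, 0) (mconst d, 0) = (mconst (c * d), 0)"
      by (simp add: pair_mult_central[OF B_mconst] mconst_mult)
    then show ?case
      by (simp only: mult_single poly_pair_single monomial_pair_add pair_mult.assoc pair_mult.left_commute
          flip: \<open>pair_mult B p (mconst c, 0) (mconst d, 0) = (mconst (c * d), 0)\<close>)
  qed (simp add: distrib_left poly_pair_add pair_distrib_right)
qed (simp add: distrib_right poly_pair_add pair_distrib)

lemma poly_pair_mconst: "poly_pair B p r (mconst c) = (mconst c, 0)"
  by (simp add: mconst_def poly_pair_single monomial_pair_0 pair_mult.right_neutral)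

lemma poly_pair_mvar: "poly_pair B p r (mvar i) = (mvar i, r i)"
  using poly_pair_single[of "single i 1" 1]
  by (simp only: monomial_pair_var mconst_1 pair_mult.left_neutral flip: mvar_def)

lemma fst_poly_pair [simp]: "fst (poly_pair B p r f) = f"
  by (induction f rule: mpoly_induct)
     (simp_all add: poly_pair_mconst poly_pair_add poly_pair_mult poly_pair_mvar pair_add_def pair_mult_def)

definition p_map :: "('i, 'k) mpoly \<Rightarrow> ('i, 'k) mpoly"
  where "p_map f = snd (poly_pair B p r f)"

lemma p_map_add: "p_map (f + g) = p_map f + p_map g + Lambda_p B p f g"
  by (simp add: p_map_def poly_pair_add pair_add_def)

lemma p_map_mult: "p_map (f * g) = f ^ p * p_map g + g ^ p * p_map f + Phi_p B p f g"
  by (simp add: p_map_def poly_pair_mult pair_mult_def)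

lemma p_map_mconst [simp]: "p_map (mconst c) = 0"
  by (simp add: p_map_def poly_pair_mconst)

lemma p_map_mvar [simp]: "p_map (mvar i) = r i"
  by (simp add: p_map_def poly_pair_mvar)

lemma p_map_scale: "p_map (mconst c * f) = mconst (c ^ p) * p_map f"
  by (simp add: p_map_mult Phi_p_commuting B_mconst mconst_power)

lemma p_map_power: "p_map (f ^ n) = of_nat n * f ^ (p * (n - 1)) * p_map f"
proof (induction n)
  case 0
  then show ?case
    using p_map_mconst[of 1] by simp
next
  case (Suc n)
  have "Phi_p B p f (f ^ n) = 0"
    by (rule Phi_p_commuting) (simp add: B_power_right)
  then have "p_map (f ^ Suc n) = f ^ p * (of_nat n * f ^ (p * (n - 1)) * p_map f) + f ^ (p * n) * p_map f"
    using p_map_mult[of f "f ^ n"] Suc by (simp add: mult.commute flip: power_mult)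
  also have "f ^ p * (of_nat n * f ^ (p * (n - 1)) * p_map f) = of_nat n * f ^ (p * n) * p_map f"
    by (cases n) (simp_all add: power_add mult_ac)
  finally show ?case
    by (simp add: algebra_simps)
qed

lemma p_map_square: "p_map (f ^ 2) = 2 * f ^ p * p_map f"
  using p_map_power[of f 2] by simp

text \<open>
  The elements with this property contain the scalars and the variables, and by Jacobson's formula
  and \<open>ad_power_p_mult\<close> they are closed under sums and products.
\<close>

lemma ad_p_map: "(B f ^^ p) g = B (p_map f) g"
proof (induction f arbitrary: g rule: mpoly_induct)
  case (const c)
  have "(B (mconst c) ^^ p) g = 0"
    using p_pos by (cases p) (simp_all add: B_mconst)
  then show ?case
    by simp
next
  case (add f h)
  then show ?case
    unfolding ad_power_p_add p_map_add by (simp add: B_add_left)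
next
  case (var i f)
  then show ?case
    unfolding ad_power_p_mult p_map_mult by (simp add: B_add_left B_central_mult_left ad_mvar)
qed

end

section \<open>Biderivations on polynomials\<close>

lemma finite_mvars [simp]: "finite (mvars f)"
  by (simp add: mvars_def)

lemma mvars_mconst [simp]: "mvars (mconst c) = {}"
  by (auto simp: mvars_def mconst_def)

lemma mvars_mvar: "mvars (mvar i) = {i}"
  by (auto simp: mvars_def mvar_def)

lemma mvars_add: "mvars (f + g) \<subseteq> mvars f \<union> mvars g"
  using keys_add[of f g] by (fastforce simp: mvars_def)

lemma mvars_uminus: "mvars (- f) = mvars (f :: ('i, 'k::comm_ring_1) mpoly)"
  by (simp add: mvars_def in_keys_iff[abs_def] keys.rep_eq)

lemma mvars_mult: "mvars (f * g) \<subseteq> mvars f \<union> mvars (g :: ('i, 'k::comm_ring_1) mpoly)"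
proof
  fix i assume "i \<in> mvars (f * g)"
  then obtain m where m: "m \<in> keys (f * g)" "i \<in> keys m"
    by (auto simp: mvars_def)
  then obtain a b where "m = a + b" "a \<in> keys f" "b \<in> keys g"
    using keys_mult[of f g] by blast
  then show "i \<in> mvars f \<union> mvars g"
    using m(2) keys_add[of a b] by (auto simp: mvars_def)
qed

lemma mderiv_eq:
  assumes "finite S" "keys f \<subseteq> S"
  shows "mderiv i f = (\<Sum>m\<in>S. single (m - single i 1)
      (of_nat (lookup m i) * lookup f m))"
  unfolding mderiv_def
  by (rule sum.mono_neutral_left) (use assms in \<open>auto simp: in_keys_iff\<close>)

lemma mderiv_add: "mderiv i (f + g) = mderiv i f + mderiv i g"
proof -
  let ?S = "keys f \<union> keys g"
  have "mderiv i (f + g) = (\<Sum>m\<in>?S. single (m - single i 1)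
      (of_nat (lookup m i) * lookup (f + g) m))"
    by (rule mderiv_eq) (simp_all add: keys_add)
  also have "\<dots> = mderiv i f + mderiv i g"
    by (simp add: mderiv_eq[of ?S] lookup_add distrib_left single_add sum.distrib)
  finally show ?thesis .
qed

lemma mderiv_single:
  "mderiv i (single m c)
    = single (m - single i 1) (of_nat (lookup m i) * c)"
  by (simp add: mderiv_eq[of "{m}"])

lemma mderiv_mult:
  fixes f g :: "('i, 'k::comm_ring_1) mpoly"
  shows "mderiv i (f * g) = f * mderiv i g + g * mderiv i f"
proof (induction f rule: mpoly_single_induct)
  case (single m c)
  show ?case
  proof (induction g rule: mpoly_single_induct)
    case (single n d)
    let ?s = "single i (1 :: nat)"
    have 1: "m + (n - ?s) = m + n - ?s" if "lookup n i \<noteq> 0" for m n :: "'i \<Rightarrow>\<^sub>0 nat"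
      by (rule poly_mapping_eqI) (use that in \<open>auto simp: lookup_add lookup_minus lookup_single when_def\<close>)
    have 2: "single (m + n - ?s) (of_nat (lookup n i) * (c * d))
        = single m c * single (n - ?s) (of_nat (lookup n i) * d)"
      for m n and c d :: 'k
      using 1[of n m] by (cases "lookup n i = 0") (simp_all add: mult_single mult_ac)
    have "mderiv i (single m c * single n d)
        = single (m + n - ?s) (of_nat (lookup n i) * (c * d))
          + single (n + m - ?s) (of_nat (lookup m i) * (d * c))"
      by (simp add: mderiv_single mult_single lookup_add distrib_left single_add ac_simps)
    then show ?case
      unfolding 2 mderiv_single .
  qed (simp add: mderiv_add algebra_simps)
qed (simp add: mderiv_add algebra_simps)

lemma mderiv_mconst [simp]: "mderiv i (mconst c) = 0"
  by (simp add: mconst_def mderiv_single)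

lemma mderiv_mvar: "mderiv i (mvar j) = (if i = j then 1 else 0)"
  by (simp add: mvar_def mderiv_single lookup_single when_def)

lemma mderiv_eq_0:
  assumes "i \<notin> mvars f"
  shows "mderiv i f = 0"
  unfolding mderiv_def
proof (intro sum.neutral ballI)
  fix m assume "m \<in> keys f"
  then have "lookup m i = 0"
    using assms by (auto simp: mvars_def in_keys_iff)
  then show "single (m - single i 1)
      (of_nat (lookup m i) * lookup f m) = 0"
    by simp
qed

lemma mvars_mderiv: "mvars (mderiv i f) \<subseteq> mvars f"
proof
  fix j assume "j \<in> mvars (mderiv i f)"
  then obtain n where n: "n \<in> keys (mderiv i f)" "j \<in> keys n"
    by (auto simp: mvars_def)
  have "n \<in> (\<lambda>m. m - single i 1) ` keys f"
  proof (rule ccontr)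
    assume "\<not> ?thesis"
    then have "lookup (mderiv i f) n = 0"
      by (auto simp: mderiv_def lookup_sum lookup_single when_def intro!: sum.neutral)
    with n show False
      by (simp add: in_keys_iff)
  qed
  then obtain m where "m \<in> keys f" "n = m - single i 1"
    by blast
  moreover from this have "j \<in> keys m"
    using n(2) by (auto simp: in_keys_iff lookup_minus)
  ultimately show "j \<in> mvars f"
    by (auto simp: mvars_def)
qed

definition bivector_bracket ::
  "('i \<Rightarrow> 'i \<Rightarrow> ('i, 'k::comm_ring_1) mpoly) \<Rightarrow> ('i, 'k) mpoly \<Rightarrow> ('i, 'k) mpoly \<Rightarrow> ('i, 'k) mpoly"
  where "bivector_bracket c f g = (\<Sum>i\<in>mvars f. \<Sum>j\<in>mvars g. mderiv i f * mderiv j g * c i j)"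

lemma bivector_bracket_eq:
  assumes "finite S" "mvars f \<subseteq> S" "finite T" "mvars g \<subseteq> T"
  shows "bivector_bracket c f g = (\<Sum>i\<in>S. \<Sum>j\<in>T. mderiv i f * mderiv j g * c i j)"
proof -
  have "bivector_bracket c f g = (\<Sum>i\<in>mvars f. \<Sum>j\<in>T. mderiv i f * mderiv j g * c i j)"
    unfolding bivector_bracket_def
    by (intro sum.cong refl sum.mono_neutral_left) (use assms in \<open>auto simp: mderiv_eq_0\<close>)
  also have "\<dots> = (\<Sum>i\<in>S. \<Sum>j\<in>T. mderiv i f * mderiv j g * c i j)"
    by (intro sum.mono_neutral_left) (use assms in \<open>auto simp: mderiv_eq_0\<close>)
  finally show ?thesis .
qed

lemma bivector_bracket_add_left:
  "bivector_bracket c (f + g) h = bivector_bracket c f h + bivector_bracket c g h"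
  using mvars_add[of f g]
  by (simp add: bivector_bracket_eq[of "mvars f \<union> mvars g" _ "mvars h"] mderiv_add distrib_right sum.distrib)

lemma bivector_bracket_add_right:
  "bivector_bracket c h (f + g) = bivector_bracket c h f + bivector_bracket c h g"
  using mvars_add[of f g]
  by (simp add: bivector_bracket_eq[of "mvars h" _ "mvars f \<union> mvars g"] mderiv_add
      distrib_right distrib_left sum.distrib)

lemma bivector_bracket_leibniz:
  "bivector_bracket c (f * g) h = f * bivector_bracket c g h + g * bivector_bracket c f h"
  using mvars_mult[of f g]
  by (simp add: bivector_bracket_eq[of "mvars f \<union> mvars g" _ "mvars h"] mderiv_mult sum_distrib_left
      distrib_right sum.distrib mult.assoc)

lemma bivector_bracket_mconst [simp]: "bivector_bracket c (mconst a) f = 0"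
  by (simp add: bivector_bracket_def)

lemma bivector_bracket_mvar: "bivector_bracket c (mvar i) (mvar j) = c i j"
  by (simp add: bivector_bracket_def mvars_mvar mderiv_mvar)

lemma bivector_bracket_swap:
  assumes "\<And>i j. c j i = - c i j"
  shows "bivector_bracket c g f = - bivector_bracket c f g"
proof -
  have "bivector_bracket c g f = (\<Sum>i\<in>mvars f. \<Sum>j\<in>mvars g. mderiv j g * mderiv i f * c j i)"
    unfolding bivector_bracket_def by (rule sum.swap)
  also have "\<dots> = - bivector_bracket c f g"
    unfolding bivector_bracket_def sum_negf[symmetric]
  proof (intro sum.cong refl)
    fix i j
    show "mderiv j g * mderiv i f * c j i = - (mderiv i f * mderiv j g * c i j)"
      unfolding assms[of j i] by (simp add: mult.commute)
  qed
  finally show ?thesis .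
qed

lemma mvars_sum: "mvars (sum f A) \<subseteq> (\<Union>a\<in>A. mvars (f a))"
proof (induction A rule: infinite_finite_induct)
  case (insert x A)
  then show ?case
    using mvars_add[of "f x" "sum f A"] by auto
qed (simp_all add: mvars_def)

lemma mvars_bivector_bracket:
  assumes "mvars f \<subseteq> I" "mvars g \<subseteq> I" "\<And>i j. mvars (c i j) \<subseteq> I"
  shows "mvars (bivector_bracket c f g) \<subseteq> I"
proof -
  have "mvars (mderiv i f * mderiv j g * c i j) \<subseteq> I" for i j
    using mvars_mult[of "mderiv i f * mderiv j g" "c i j"] mvars_mult[of "mderiv i f" "mderiv j g"]
      mvars_mderiv[of i f] mvars_mderiv[of j g] assms by blast
  then show ?thesis
    unfolding bivector_bracket_def using mvars_sum by (smt (verit) UN_least order_trans)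
qed

text \<open>
  The Jacobiator is a derivation in each argument, so it suffices to check it on variables.
\<close>

lemma poisson_ring_bivector_bracket:
  fixes c :: "'i \<Rightarrow> 'i \<Rightarrow> ('i, 'k::comm_ring_1) mpoly"
  assumes "prime p" "3 \<le> p" "of_nat p = (0 :: 'k)"
    and swap: "\<And>i j. c j i = - c i j"
    and jacobi: "\<And>i j k. bivector_bracket c (mvar i) (c j k) + bivector_bracket c (mvar j) (c k i)
      + bivector_bracket c (mvar k) (c i j) = 0"
  shows "poisson_ring (bivector_bracket c) p"
proof
  let ?B = "bivector_bracket c"
  let ?J = "\<lambda>f g h. ?B f (?B g h) + ?B g (?B h f) + ?B h (?B f g)"
  note s = bivector_bracket_swap[of c, OF swap]
  note add = bivector_bracket_add_left[of c] bivector_bracket_add_right[of c]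
  fix f g h :: "('i, 'k) mpoly"
  show "?B (f + g) h = ?B f h + ?B g h" "?B f (g + h) = ?B f g + ?B f h"
    by (fact add)+
  show "?B (f * g) h = f * ?B g h + g * ?B f h"
    by (rule bivector_bracket_leibniz)
  show char: "of_nat p = (0 :: ('i, 'k) mpoly)"
    using assms(3) by (simp flip: mconst_of_nat)
  have leib_right: "?B h (f * g) = f * ?B h g + g * ?B h f" for f g h
    unfolding s[of h "f * g"] bivector_bracket_leibniz s[of h f] s[of h g] by simp
  have zero: "?B f 0 = 0" "?B 0 f = 0" for f
    using add(2)[of f 0 0] add(1)[of 0 0 f] by simp_all
  have const_right: "?B f (mconst a) = 0" for f a
    unfolding s[of f] by simp
  have *: "?B f f + ?B f f = 0" for f
    using s[of f f] by (metis ab_group_add_class.ab_left_minus)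
  show "?B f f = 0" for f
  proof -
    obtain q where q: "p = 2 * q + 1"
    proof -
      have "odd p"
        using assms(1,2) by (simp add: prime_odd_nat)
      then show ?thesis
        using that by (elim oddE)
    qed
    have "?B f f = of_nat p * ?B f f - of_nat q * (?B f f + ?B f f)"
      by (simp add: q algebra_simps)
    then show ?thesis
      unfolding char * by simp
  qed
  have cyc: "?J f g h = ?J g h f" for f g h
    by (simp add: add_ac)
  have J_add: "?J (f + f') g h = ?J f g h + ?J f' g h" for f f' g h
    by (simp add: add add_ac)
  have J_mult: "?J (f * f') g h = f * ?J f' g h + f' * ?J f g h" for f f' g h
    by (simp add: bivector_bracket_leibniz leib_right add s[of g f] s[of g f'] algebra_simps)
  have J_const: "?J (mconst a) g h = 0" for a g h
    by (simp add: const_right zero)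
  have J1: "?J f (mvar j) (mvar k) = 0" for f j k
  proof (induction f rule: mpoly_induct)
    case (const a)
    show ?case by (rule J_const)
  next
    case (add f g)
    then show ?case unfolding J_add by simp
  next
    case (var i f)
    have "?J (mvar i) (mvar j) (mvar k) = 0"
      using jacobi[of i j k] by (simp add: bivector_bracket_mvar)
    with var show ?case unfolding J_mult by simp
  qed
  have J2: "?J g h (mvar k) = 0" for g h k
  proof -
    have "?J h (mvar k) g = 0"
    proof (induction h rule: mpoly_induct)
      case (const a)
      show ?case by (rule J_const)
    next
      case (add f g)
      then show ?case unfolding J_add by simp
    next
      case (var i f)
      have "?J (mvar i) (mvar k) g = 0"
        using J1[of g i k] cyc by metis
      with var show ?case unfolding J_mult by simp
    qed
    then show ?thesis
      using cyc by metis
  qed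
  show "?J f g h = 0"
  proof (induction f rule: mpoly_induct)
    case (const a)
    show ?case by (rule J_const)
  next
    case (add f g)
    then show ?case unfolding J_add by simp
  next
    case (var i f)
    have "?J (mvar i) g h = 0"
      using J2[of g h i] cyc by metis
    with var show ?case unfolding J_mult by simp
  qed
qed (fact assms)+

section \<open>Leibniz rule for the p-th power of a derivation\<close>

context poisson_ring
begin

lemma ad_power_leibniz:
  "(B w ^^ n) (f * g) = (\<Sum>k\<le>n. of_nat (n choose k) * ((B w ^^ k) f * (B w ^^ (n - k)) g))"
proof (induction n)
  case (Suc n)
  let ?f = "\<lambda>k. (B w ^^ k) f" and ?g = "\<lambda>k. (B w ^^ k) g"
  have "(B w ^^ Suc n) (f * g) = (\<Sum>k\<le>n. of_nat (n choose k) * (?f k * ?g (Suc n - k)))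
      + (\<Sum>k\<le>n. of_nat (n choose k) * (?f (Suc k) * ?g (n - k)))"
    unfolding funpow.simps comp_apply Suc.IH B_sum_right sum.distrib[symmetric]
    by (intro sum.cong refl) (simp add: B_of_nat_mult_right B_leibniz_right Suc_diff_le algebra_simps)
  moreover have "(\<Sum>k\<le>Suc n. of_nat (Suc n choose k) * (?f k * ?g (Suc n - k)))
      = ?f 0 * ?g (Suc n) + (\<Sum>k\<le>n. of_nat (Suc n choose Suc k) * (?f (Suc k) * ?g (n - k)))"
    by (subst sum.atMost_Suc_shift) simp
  moreover have "(\<Sum>k\<le>n. of_nat (Suc n choose Suc k) * (?f (Suc k) * ?g (n - k)))
      = (\<Sum>k\<le>n. of_nat (n choose k) * (?f (Suc k) * ?g (n - k)))
        + (\<Sum>k\<le>n. of_nat (n choose Suc k) * (?f (Suc k) * ?g (n - k)))"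
    by (simp add: sum.distrib distrib_right)
  moreover have "(\<Sum>k\<le>n. of_nat (n choose k) * (?f k * ?g (Suc n - k)))
      = ?f 0 * ?g (Suc n) + (\<Sum>k\<le>n. of_nat (n choose Suc k) * (?f (Suc k) * ?g (n - k)))"
  proof -
    have "(\<Sum>k\<le>n. of_nat (n choose k) * (?f k * ?g (Suc n - k)))
        = (\<Sum>k\<le>Suc n. of_nat (n choose k) * (?f k * ?g (Suc n - k)))"
      by (simp add: binomial_eq_0)
    also have "\<dots> = ?f 0 * ?g (Suc n) + (\<Sum>k\<le>n. of_nat (n choose Suc k) * (?f (Suc k) * ?g (n - k)))"
      by (subst sum.atMost_Suc_shift) simp
    finally show ?thesis .
  qed
  ultimately show ?case
    by (simp only: add.assoc add.left_commute add.commute)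
qed simp

lemma ad_power_p_leibniz: "(B w ^^ p) (f * g) = f * (B w ^^ p) g + g * (B w ^^ p) f"
proof -
  have "(B w ^^ p) (f * g) = (\<Sum>k\<in>{0, p}. of_nat (p choose k) * ((B w ^^ k) f * (B w ^^ (p - k)) g))"
    unfolding ad_power_leibniz
    by (rule sum.mono_neutral_right) (use of_nat_choose_p in auto)
  then show ?thesis
    using p_pos by (simp add: mult.commute)
qed

section \<open>Closure properties\<close>

lemma of_nat_mult_closed:
  assumes "0 \<in> S" "\<And>x y. x \<in> S \<Longrightarrow> y \<in> S \<Longrightarrow> x + y \<in> S" "(x::'a) \<in> S"
  shows "of_nat n * x \<in> S"
  by (induction n) (use assms in \<open>auto simp: distrib_right\<close>)

lemma sum_closed:
  assumes "0 \<in> S" "\<And>x y. x \<in> S \<Longrightarrow> y \<in> S \<Longrightarrow> x + y \<in> S" "\<And>i. i \<in> A \<Longrightarrow> (f i :: 'a) \<in> S"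
  shows "sum f A \<in> S"
  using assms(3) by (induction A rule: infinite_finite_induct) (use assms in auto)

lemma Lambda_p_closed:
  assumes "0 \<in> J" "\<And>x y. x \<in> J \<Longrightarrow> y \<in> J \<Longrightarrow> x + y \<in> J" "\<And>x y. x \<in> J \<Longrightarrow> y \<in> S \<Longrightarrow> B y x \<in> J"
    and "x \<in> J" "x \<in> S" "y \<in> S"
  shows "Lambda_p B p x y \<in> J"
proof -
  have "Lambda_coeff B x y k i \<in> J" for k i
    by (induction k arbitrary: i) (use assms in auto)
  then show ?thesis
    unfolding Lambda_p_def by (intro sum_closed of_nat_mult_closed assms)
qed

text \<open>
  Used both for \<open>J = S\<close>, a Poisson subring, and for a Poisson ideal \<open>J\<close> of \<open>S\<close>, where it is
  enough that the first bracket \<open>{v, u}\<close> lies in \<open>J\<close>.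
\<close>

lemma Phi_p_closed:
  assumes "0 \<in> J" "\<And>x y. x \<in> J \<Longrightarrow> y \<in> J \<Longrightarrow> x + y \<in> J" "\<And>x. x \<in> J \<Longrightarrow> - x \<in> J"
    and "\<And>x y. x \<in> S \<Longrightarrow> y \<in> J \<Longrightarrow> x * y \<in> J" "\<And>x y. x \<in> J \<Longrightarrow> y \<in> S \<Longrightarrow> B y x \<in> J"
    and S: "\<And>x y. x \<in> S \<Longrightarrow> y \<in> S \<Longrightarrow> x * y \<in> S" "B v u \<in> S"
    and "u \<in> S" "v \<in> S" "B v u \<in> J"
  shows "Phi_p B p u v \<in> J"
proof -
  have "Phi_coeff B u v k i \<in> J" for k i
  proof (induction k arbitrary: i)
    case (Suc k)
    have 1: "u * B v (Phi_coeff B u v k j) \<in> J" "v * B u (Phi_coeff B u v k j) \<in> J"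
      "of_nat (Suc k) * B v u * Phi_coeff B u v k j \<in> J" for j
      using assms Suc by (auto simp only: mult.assoc intro!: of_nat_mult_closed)
    have "a - b \<in> J" if "a \<in> J" "b \<in> J" for a b
      using assms(2)[OF that(1) assms(3)[OF that(2)]] by simp
    with 1 assms(1,2) show ?case
      by (simp only: Phi_coeff.simps) auto
  qed (use assms in auto)
  then show ?thesis
    unfolding Phi_p_def by (intro assms sum_closed of_nat_mult_closed)
qed

end

section \<open>Lie algebras with a basis\<close>

lemma ring_of_type_algebra_simps [simp]:
  "carrier ring_of_type_algebra = UNIV" "a \<otimes>\<^bsub>ring_of_type_algebra\<^esub> b = a * b"
  "a \<oplus>\<^bsub>ring_of_type_algebra\<^esub> b = a + b" "\<zero>\<^bsub>ring_of_type_algebra\<^esub> = 0" "\<one>\<^bsub>ring_of_type_algebra\<^esub> = 1"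
  by (simp_all add: ring_of_type_algebra_def)

context lie_algebra
begin

lemma smult_zero [simp]: "v \<in> carrier L \<Longrightarrow> 0 \<odot>\<^bsub>L\<^esub> v = \<zero>\<^bsub>L\<^esub>"
  using smult_l_null by simp

lemma br_zero_left: "y \<in> carrier L \<Longrightarrow> br \<zero>\<^bsub>L\<^esub> y = \<zero>\<^bsub>L\<^esub>"
  using br_add_left[of "\<zero>\<^bsub>L\<^esub>" "\<zero>\<^bsub>L\<^esub>" y] br_closed[of "\<zero>\<^bsub>L\<^esub>" y]
  by (metis M.add.l_cancel_one' M.l_zero M.zero_closed)

lemma br_zero_right: "y \<in> carrier L \<Longrightarrow> br y \<zero>\<^bsub>L\<^esub> = \<zero>\<^bsub>L\<^esub>"
  using br_add_right[of y "\<zero>\<^bsub>L\<^esub>" "\<zero>\<^bsub>L\<^esub>"] br_closed[of y "\<zero>\<^bsub>L\<^esub>"]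
  by (metis M.add.l_cancel_one' M.l_zero M.zero_closed)

lemma br_anti:
  assumes "x \<in> carrier L" "y \<in> carrier L"
  shows "br x y \<oplus>\<^bsub>L\<^esub> br y x = \<zero>\<^bsub>L\<^esub>"
proof -
  have "br (x \<oplus>\<^bsub>L\<^esub> y) (x \<oplus>\<^bsub>L\<^esub> y) = (br x x \<oplus>\<^bsub>L\<^esub> br y x) \<oplus>\<^bsub>L\<^esub> (br x y \<oplus>\<^bsub>L\<^esub> br y y)"
    using assms by (simp add: br_add_left br_add_right)
  then show ?thesis
    using assms M.a_comm[of "br x y" "br y x"] by (simp add: br_self br_closed)
qed

text \<open>
  The sequence of coefficients of \<open>ad\<^bsub>tx+y\<^esub>\<^sup>k(x)\<close>, the Lie algebra counterpart of \<^const>\<open>Lambda_coeff\<close>.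
\<close>

definition path_coeff :: "'a \<Rightarrow> 'a \<Rightarrow> nat \<Rightarrow> nat \<Rightarrow> 'a"
  where "path_coeff x y k = ((bracket_t L br (\<lambda>n. if n = 0 then y else if n = 1 then x else \<zero>\<^bsub>L\<^esub>)) ^^ k)
      (\<lambda>n. if n = 0 then x else \<zero>\<^bsub>L\<^esub>)"

lemma path_coeff_0: "path_coeff x y 0 n = (if n = 0 then x else \<zero>\<^bsub>L\<^esub>)"
  by (simp add: path_coeff_def)

lemma
  assumes "x \<in> carrier L" "y \<in> carrier L"
  shows path_coeff_closed: "path_coeff x y k n \<in> carrier L"
    and path_coeff_Suc: "path_coeff x y (Suc k) n =
      br y (path_coeff x y k n) \<oplus>\<^bsub>L\<^esub> (if n = 0 then \<zero>\<^bsub>L\<^esub> else br x (path_coeff x y k (n - 1)))"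
proof -
  let ?W = "\<lambda>n. if n = 0 then y else if n = 1 then x else \<zero>\<^bsub>L\<^esub>"
  have step: "bracket_t L br ?W g n = br y (g n) \<oplus>\<^bsub>L\<^esub> (if n = 0 then \<zero>\<^bsub>L\<^esub> else br x (g (n - 1)))"
    if g: "\<And>n. g n \<in> carrier L" for g n
  proof -
    have W: "?W k \<in> carrier L" for k
      using assms by simp
    show ?thesis
    proof (cases n)
      case 0
      then show ?thesis
        using g assms by (simp add: bracket_t_def br_closed)
    next
      case (Suc m)
      have "bracket_t L br ?W g n = (\<Oplus>\<^bsub>L\<^esub>k\<in>{0, 1}. br (?W k) (g (n - k)))"
        unfolding bracket_t_def
        by (rule M.add.finprod_mono_neutral_cong_right)
           (use g assms in \<open>auto simp: Suc br_closed br_zero_left\<close>)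
      then show ?thesis
        using g assms by (simp add: Suc br_closed)
    qed
  qed
  show closed: "path_coeff x y k n \<in> carrier L" for k n
  proof (induction k arbitrary: n)
    case 0
    then show ?case
      using assms by (simp add: path_coeff_0)
  next
    case (Suc k)
    have "path_coeff x y (Suc k) n = bracket_t L br ?W (path_coeff x y k) n"
      by (simp add: path_coeff_def)
    then show ?case
      using step[of "path_coeff x y k" n] Suc assms by (simp add: br_closed)
  qed
  have "path_coeff x y (Suc k) n = bracket_t L br ?W (path_coeff x y k) n"
    by (simp add: path_coeff_def)
  then show "path_coeff x y (Suc k) n =
      br y (path_coeff x y k n) \<oplus>\<^bsub>L\<^esub> (if n = 0 then \<zero>\<^bsub>L\<^esub> else br x (path_coeff x y k (n - 1)))"
    using step[of "path_coeff x y k" n] closed by simp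
qed

lemma jacobson_Lambda_eq:
  "jacobson_Lambda L br p x y = (\<Oplus>\<^bsub>L\<^esub>i\<in>{1..p - 1}. inverse (of_nat i) \<odot>\<^bsub>L\<^esub> path_coeff x y (p - 1) (i - 1))"
  by (simp add: jacobson_Lambda_def jacobson_s_def path_coeff_def)

end

text \<open>
  The base field with the zero bracket is itself a Poisson ring.
\<close>

lemma inverse_of_nat_mod_p:
  assumes "prime p" "3 \<le> p" "of_nat p = (0 :: 'k::field)" "0 < i" "i < p"
  shows "inverse (of_nat i) = (of_nat (i ^ (p - 2)) :: 'k)"
proof -
  interpret poisson_ring "\<lambda>_ _. 0 :: 'k" p
    by unfold_locales (use assms in auto)
  show ?thesis
    using of_nat_power_inverse[OF assms(4,5)] by (rule inverse_unique)
qed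

locale lie_basis = restricted_lie_algebra L br p pmap
  for L :: "('k::field, 'a, 'm) module_scheme" (structure) and br p pmap +
  fixes I :: "'i set" and x :: "'i \<Rightarrow> 'a"
  assumes basis: "is_basis L I x" and p_ge_3: "3 \<le> p"
begin

lemma x_closed: "i \<in> I \<Longrightarrow> x i \<in> carrier L"
  using basis by (auto simp: is_basis_def)

lemma lincomb_eq:
  assumes "finite S" "keys c \<subseteq> S" "S \<subseteq> I"
  shows "lincomb L x c = (\<Oplus>\<^bsub>L\<^esub>i\<in>S. lookup c i \<odot>\<^bsub>L\<^esub> x i)"
  unfolding lincomb_def
  by (rule M.add.finprod_mono_neutral_cong_left)
     (use assms x_closed in \<open>auto simp: in_keys_iff\<close>)

lemma lincomb_add:
  assumes "keys c \<subseteq> I" "keys d \<subseteq> I"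
  shows "lincomb L x (c + d) = lincomb L x c \<oplus>\<^bsub>L\<^esub> lincomb L x d"
proof -
  let ?S = "keys c \<union> keys d"
  have "lincomb L x (c + d) = (\<Oplus>\<^bsub>L\<^esub>i\<in>?S. lookup (c + d) i \<odot>\<^bsub>L\<^esub> x i)"
    by (rule lincomb_eq) (use assms in \<open>simp_all add: keys_add\<close>)
  also have "\<dots> = (\<Oplus>\<^bsub>L\<^esub>i\<in>?S. lookup c i \<odot>\<^bsub>L\<^esub> x i \<oplus>\<^bsub>L\<^esub> lookup d i \<odot>\<^bsub>L\<^esub> x i)"
    using assms x_closed smult_l_distr[simplified]
    by (intro M.finsum_cong') (auto simp: lookup_add)
  also have "\<dots> = lincomb L x c \<oplus>\<^bsub>L\<^esub> lincomb L x d"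
    using assms x_closed by (subst M.finsum_addf) (auto simp: lincomb_eq[of ?S])
  finally show ?thesis .
qed

lemma lincomb_uminus:
  assumes "keys c \<subseteq> I"
  shows "lincomb L x c \<oplus>\<^bsub>L\<^esub> lincomb L x (- c) = \<zero>\<^bsub>L\<^esub>"
proof -
  have "keys (- c) \<subseteq> I"
    using assms by (auto simp: in_keys_iff)
  then have "lincomb L x (c + - c) = lincomb L x c \<oplus>\<^bsub>L\<^esub> lincomb L x (- c)"
    by (rule lincomb_add[OF assms])
  then show ?thesis
    by (simp add: lincomb_def)
qed

lemma coords_unique:
  assumes "keys c \<subseteq> I" "keys d \<subseteq> I" "lincomb L x c = lincomb L x d"
  shows "c = d"
proof -
  have k: "keys (- d) \<subseteq> I"
    using assms by (auto simp: in_keys_iff)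
  have "lincomb L x (c + - d) = \<zero>\<^bsub>L\<^esub>"
    using lincomb_add[OF assms(1) k] lincomb_uminus[OF assms(2)] assms(3) by simp
  moreover have "keys (c + - d) \<subseteq> I"
    using keys_add[of c "- d"] assms(1) k by blast
  ultimately have "c + - d = 0"
    using basis unfolding is_basis_def by blast
  then show ?thesis
    by simp
qed

lemma coords_lincomb:
  assumes "keys c \<subseteq> I"
  shows "coords L I x (lincomb L x c) = c"
  unfolding coords_def by (rule the_equality) (use assms coords_unique in auto)

lemma
  assumes "v \<in> carrier L"
  shows keys_coords: "keys (coords L I x v) \<subseteq> I"
    and lincomb_coords: "lincomb L x (coords L I x v) = v"
proof -
  obtain c where "keys c \<subseteq> I" "v = lincomb L x c"
    using basis assms by (auto simp: is_basis_def)
  then show "keys (coords L I x v) \<subseteq> I" "lincomb L x (coords L I x v) = v"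
    by (simp_all add: coords_lincomb)
qed

abbreviation lin :: "'a \<Rightarrow> ('i, 'k) mpoly"
  where "lin v \<equiv> lin_form L I x v"

lemma lin_form_eq:
  assumes "finite S" "keys (coords L I x v) \<subseteq> S"
  shows "lin v = (\<Sum>i\<in>S. mconst (lookup (coords L I x v) i) * mvar i)"
  unfolding lin_form_def
  by (rule sum.mono_neutral_left) (use assms in \<open>auto simp: in_keys_iff\<close>)

lemma mvars_lin: "v \<in> carrier L \<Longrightarrow> mvars (lin v) \<subseteq> I"
proof -
  assume v: "v \<in> carrier L"
  have "mvars (mconst a * mvar i :: ('i, 'k) mpoly) \<subseteq> {i}" for a i
    using mvars_mult[of "mconst a" "mvar i :: ('i, 'k) mpoly"] by (simp add: mvars_mvar)
  then show ?thesis
    unfolding lin_form_def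
    using keys_coords[OF v] mvars_sum[of "\<lambda>i. mconst (lookup (coords L I x v) i) * mvar i :: ('i, 'k) mpoly"
        "keys (coords L I x v)"] by blast
qed

lemma coords_add:
  assumes "v \<in> carrier L" "w \<in> carrier L"
  shows "coords L I x (v \<oplus>\<^bsub>L\<^esub> w) = coords L I x v + coords L I x w"
proof -
  have "lincomb L x (coords L I x v + coords L I x w) = v \<oplus>\<^bsub>L\<^esub> w"
    using assms by (simp add: lincomb_add keys_coords lincomb_coords)
  moreover have "keys (coords L I x v + coords L I x w) \<subseteq> I"
    using keys_add[of "coords L I x v" "coords L I x w"] keys_coords assms by blast
  ultimately show ?thesis
    using coords_lincomb by metis
qed

lemma lin_add:
  assumes "v \<in> carrier L" "w \<in> carrier L"
  shows "lin (v \<oplus>\<^bsub>L\<^esub> w) = lin v + lin w"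
proof -
  let ?S = "keys (coords L I x v) \<union> keys (coords L I x w)"
  have "keys (coords L I x (v \<oplus>\<^bsub>L\<^esub> w)) \<subseteq> ?S"
    by (simp add: coords_add assms keys_add)
  then show ?thesis
    by (simp add: lin_form_eq[of ?S] coords_add assms lookup_add mconst_add distrib_right sum.distrib)
qed

lemma lin_zero: "lin \<zero>\<^bsub>L\<^esub> = 0"
  using lin_add[of "\<zero>\<^bsub>L\<^esub>" "\<zero>\<^bsub>L\<^esub>"] by simp

lemma coords_smult:
  assumes "v \<in> carrier L"
  shows "lookup (coords L I x (a \<odot>\<^bsub>L\<^esub> v)) i = a * lookup (coords L I x v) i"
proof -
  define c where "c = coords L I x v"
  define d where "d = Poly_Mapping.map ((*) a) c"
  have l: "lookup d j = a * lookup c j" for j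
    by (simp add: d_def Poly_Mapping.map.rep_eq when_def)
  have c: "keys c \<subseteq> I"
    unfolding c_def by (rule keys_coords[OF assms])
  have d: "keys d \<subseteq> keys c"
    by (auto simp: in_keys_iff l)
  have "lincomb L x d = (\<Oplus>\<^bsub>L\<^esub>i\<in>keys c. a \<odot>\<^bsub>L\<^esub> (lookup c i \<odot>\<^bsub>L\<^esub> x i))"
    unfolding lincomb_eq[OF finite_keys d c]
    using c x_closed smult_assoc1[simplified] by (intro M.finsum_cong') (auto simp: l)
  also have "\<dots> = a \<odot>\<^bsub>L\<^esub> lincomb L x c"
    unfolding lincomb_def using c x_closed by (subst finsum_smult_ldistr[symmetric]) auto
  finally have "lincomb L x d = a \<odot>\<^bsub>L\<^esub> v"
    by (simp add: c_def lincomb_coords assms)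
  then have "coords L I x (a \<odot>\<^bsub>L\<^esub> v) = d"
    using coords_lincomb[of d] c d by auto
  then show ?thesis
    by (simp add: l c_def)
qed

lemma lin_smult:
  assumes "v \<in> carrier L"
  shows "lin (a \<odot>\<^bsub>L\<^esub> v) = mconst a * lin v"
proof -
  let ?S = "keys (coords L I x v)"
  have "keys (coords L I x (a \<odot>\<^bsub>L\<^esub> v)) \<subseteq> ?S"
    by (auto simp: in_keys_iff coords_smult assms)
  then show ?thesis
    by (simp add: lin_form_eq[of ?S] coords_smult assms mconst_mult sum_distrib_left mult.assoc)
qed

lemma lin_x:
  assumes "i \<in> I"
  shows "lin (x i) = mvar i"
proof -
  have "lincomb L x (single i 1) = x i"
    using x_closed[OF assms] smult_one[simplified] by (simp add: lincomb_def)
  then have "coords L I x (x i) = single i 1"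
    using coords_lincomb[of "single i 1"] assms by simp
  then show ?thesis
    by (simp add: lin_form_def)
qed

lemma basis_induct [consumes 1, case_names zero add smult x]:
  assumes "v \<in> carrier L"
    and "P \<zero>\<^bsub>L\<^esub>" "\<And>v w. v \<in> carrier L \<Longrightarrow> w \<in> carrier L \<Longrightarrow> P v \<Longrightarrow> P w \<Longrightarrow> P (v \<oplus>\<^bsub>L\<^esub> w)"
    and "\<And>a v. v \<in> carrier L \<Longrightarrow> P v \<Longrightarrow> P (a \<odot>\<^bsub>L\<^esub> v)" "\<And>i. i \<in> I \<Longrightarrow> P (x i)"
  shows "P v"
proof -
  define c where "c = coords L I x v"
  have c: "keys c \<subseteq> I"
    unfolding c_def by (rule keys_coords[OF assms(1)])
  have "P (\<Oplus>\<^bsub>L\<^esub>i\<in>A. lookup c i \<odot>\<^bsub>L\<^esub> x i)" if "finite A" "A \<subseteq> I" for A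
    using that
  proof (induction A)
    case empty
    then show ?case
      by (simp add: assms)
  next
    case (insert i A)
    then have "(\<Oplus>\<^bsub>L\<^esub>i\<in>insert i A. lookup c i \<odot>\<^bsub>L\<^esub> x i)
        = lookup c i \<odot>\<^bsub>L\<^esub> x i \<oplus>\<^bsub>L\<^esub> (\<Oplus>\<^bsub>L\<^esub>i\<in>A. lookup c i \<odot>\<^bsub>L\<^esub> x i)"
      using x_closed by (intro M.finsum_insert) auto
    moreover have "(\<Oplus>\<^bsub>L\<^esub>i\<in>A. lookup c i \<odot>\<^bsub>L\<^esub> x i) \<in> carrier L"
      using x_closed insert.prems by (intro M.finsum_closed) auto
    ultimately show ?case
      using insert x_closed by (auto intro!: assms)
  qed
  then have "P (lincomb L x c)"
    unfolding lincomb_def using c by simp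
  then show ?thesis
    by (simp add: c_def lincomb_coords assms(1))
qed

text \<open>
  The values outside \<open>I\<close> make the bracket total on all polynomials, with the superfluous variables
  central.
\<close>

definition structure_form :: "'i \<Rightarrow> 'i \<Rightarrow> ('i, 'k) mpoly"
  where "structure_form i j = (if i \<in> I \<and> j \<in> I then lin (br (x i) (x j)) else 0)"

definition PB :: "('i, 'k) mpoly \<Rightarrow> ('i, 'k) mpoly \<Rightarrow> ('i, 'k) mpoly"
  where "PB = bivector_bracket structure_form"

lemma structure_form_swap: "structure_form j i = - structure_form i j"
proof (cases "i \<in> I \<and> j \<in> I")
  case True
  have "lin (br (x i) (x j)) + lin (br (x j) (x i)) = 0"
    using True x_closed br_anti lin_zero by (simp add: br_closed flip: lin_add)
  then show ?thesis
    using True by (simp add: structure_form_def eq_neg_iff_add_eq_0 add.commute)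
qed (auto simp: structure_form_def)

lemma PB_mconst_right: "PB f (mconst a) = 0"
  using bivector_bracket_swap[of structure_form f "mconst a", OF structure_form_swap] by (simp add: PB_def)

lemma PB_zero: "PB f 0 = 0" "PB 0 f = 0"
  using PB_mconst_right[of f 0] bivector_bracket_mconst[of structure_form 0 f] by (simp_all add: PB_def)

lemma PB_scale_left: "PB (mconst a * f) g = mconst a * PB f g"
  by (simp add: PB_def bivector_bracket_leibniz)

lemma PB_scale_right: "PB g (mconst a * f) = mconst a * PB g f"
proof -
  have "PB g (mconst a * f) = - PB (mconst a * f) g" "PB g f = - PB f g"
    unfolding PB_def by (rule bivector_bracket_swap, rule structure_form_swap)+
  then show ?thesis
    by (simp add: PB_scale_left)
qed

lemma PB_lin:
  assumes "v \<in> carrier L" "w \<in> carrier L"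
  shows "PB (lin v) (lin w) = lin (br v w)"
  using assms(1)
proof (induction v rule: basis_induct)
  case (x i)
  show ?case
    using assms(2)
  proof (induction w rule: basis_induct)
    case (x j)
    then show ?case
      using \<open>i \<in> I\<close> by (simp add: lin_x PB_def bivector_bracket_mvar structure_form_def)
  qed (simp_all add: br_zero_right x_closed[OF \<open>i \<in> I\<close>] lin_zero PB_zero br_add_right br_closed lin_add
      br_smult_right lin_smult PB_scale_right bivector_bracket_add_right[of structure_form, folded PB_def])
qed (simp_all add: br_zero_left assms(2) lin_zero PB_zero br_add_left br_closed lin_add
      br_smult_left lin_smult PB_scale_left bivector_bracket_add_left[of structure_form, folded PB_def])

lemma prime_p: "prime p"
  using prime_CHAR_semidom[where 'a = 'k] char_eq p_ge_3 by simp

lemma of_nat_p: "of_nat p = (0 :: 'k)"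
  using of_nat_CHAR[where 'a = 'k] char_eq by simp

lemma PB_mvar_outside: "i \<notin> I \<Longrightarrow> PB (mvar i) f = 0"
  by (simp add: PB_def bivector_bracket_def mvars_mvar structure_form_def)

lemma poisson_ring_PB: "poisson_ring PB p"
  unfolding PB_def
proof (rule poisson_ring_bivector_bracket[OF prime_p p_ge_3 of_nat_p structure_form_swap])
  fix i j k
  show "bivector_bracket structure_form (mvar i) (structure_form j k) + bivector_bracket structure_form (mvar j) (structure_form k i)
      + bivector_bracket structure_form (mvar k) (structure_form i j) = 0"
    unfolding PB_def[symmetric]
  proof (cases "i \<in> I \<and> j \<in> I \<and> k \<in> I")
    case True
    then have c: "x i \<in> carrier L" "x j \<in> carrier L" "x k \<in> carrier L"
      using x_closed by auto
    have "PB (lin (x a)) (lin (br (x b) (x c))) = lin (br (x a) (br (x b) (x c)))"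
      if "a \<in> I" "b \<in> I" "c \<in> I" for a b c
      using that x_closed by (intro PB_lin) (auto simp: br_closed)
    then have "PB (mvar i) (structure_form j k) + PB (mvar j) (structure_form k i) + PB (mvar k) (structure_form i j)
      = lin (br (x i) (br (x j) (x k))) + lin (br (x j) (br (x k) (x i))) + lin (br (x k) (br (x i) (x j)))"
      using True by (simp add: structure_form_def lin_x)
    also have "\<dots> = 0"
      using c jacobi[OF c] lin_zero by (simp add: br_closed flip: lin_add)
    finally show "PB (mvar i) (structure_form j k) + PB (mvar j) (structure_form k i) + PB (mvar k) (structure_form i j) = 0" .
  next
    case False
    then show "PB (mvar i) (structure_form j k) + PB (mvar j) (structure_form k i) + PB (mvar k) (structure_form i j) = 0"
      by (auto simp: structure_form_def PB_mvar_outside PB_zero)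
  qed
qed

sublocale S: poisson_ring PB p
  by (rule poisson_ring_PB)

definition var_image :: "'i \<Rightarrow> ('i, 'k) mpoly"
  where "var_image i = (if i \<in> I then lin (pmap (x i)) else 0)"

lemma ad_lin: "v \<in> carrier L \<Longrightarrow> w \<in> carrier L \<Longrightarrow> (PB (lin v) ^^ n) (lin w) = lin ((br v ^^ n) w) \<and> (br v ^^ n) w \<in> carrier L"
  by (induction n) (simp_all add: PB_lin br_closed)

text \<open>
  In characteristic \<open>p\<close> the \<open>p\<close>-th power of a derivation is a derivation, so the claim reduces to
  variables, where it is the restricted structure of \<open>L\<close>.
\<close>

lemma ad_mvar_image: "(PB (mvar i) ^^ p) f = PB (var_image i) f"
proof (cases "i \<in> I")
  case False
  then have "(PB (mvar i) ^^ p) f = 0"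
    using S.p_pos by (cases p) (simp_all add: PB_mvar_outside)
  then show ?thesis
    using False by (simp add: var_image_def)
next
  case True
  show ?thesis
  proof (induction f rule: mpoly_induct)
    case (const c)
    have "(PB (mvar i) ^^ p) (mconst c) = 0"
      using S.p_pos by (cases p) (simp_all add: PB_mconst_right funpow_Suc_right del: funpow.simps)
    then show ?case
      by (simp add: PB_mconst_right)
  next
    case (add f g)
    then show ?case
      by (simp add: S.ad_add S.B_add_right)
  next
    case (var j f)
    have "(PB (mvar i) ^^ p) (mvar j) = PB (var_image i) (mvar j)"
    proof (cases "j \<in> I")
      case False
      have "PB g (mvar j) = 0" for g
        using PB_mvar_outside[OF False] S.B_swap[of g "mvar j"] by simp
      then show ?thesis
        using S.p_pos by (cases p) (simp_all add: funpow_Suc_right del: funpow.simps)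
    next
      case j: True
      have "(PB (lin (x i)) ^^ p) (lin (x j)) = lin ((br (x i) ^^ p) (x j))"
        using ad_lin x_closed True j by simp
      also have "\<dots> = PB (lin (pmap (x i))) (lin (x j))"
        using True j x_closed by (simp add: ad_pmap PB_lin pmap_closed)
      finally show ?thesis
        using True j by (simp add: lin_x var_image_def)
    qed
    with var show ?case
      by (simp add: S.ad_power_p_leibniz S.B_leibniz_right)
  qed
qed

sublocale S: mpoly_poisson PB p var_image
proof
  show "PB (mconst c) f = 0" for c f
    by (simp add: PB_def)
  show "(PB (mvar i) ^^ p) f = PB (var_image i) f" for i f
    by (rule ad_mvar_image)
qed

lemma lin_path_coeff:
  assumes "v \<in> carrier L" "w \<in> carrier L"
  shows "lin (path_coeff v w k n) = Lambda_coeff PB (lin v) (lin w) k n"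
proof (induction k arbitrary: n)
  case 0
  then show ?case
    by (simp add: path_coeff_0 lin_zero)
next
  case (Suc k)
  show ?case
    using assms
    by (simp add: path_coeff_Suc lin_add br_closed path_coeff_closed lin_zero PB_lin[symmetric] Suc)
qed

lemma lin_finsum:
  assumes "finite A" "\<And>a. a \<in> A \<Longrightarrow> g a \<in> carrier L"
  shows "lin (\<Oplus>\<^bsub>L\<^esub>a\<in>A. g a) = (\<Sum>a\<in>A. lin (g a))"
  using assms
proof (induction A)
  case empty
  then show ?case
    by (simp add: lin_zero)
next
  case (insert a A)
  have "(\<Oplus>\<^bsub>L\<^esub>a\<in>insert a A. g a) = g a \<oplus>\<^bsub>L\<^esub> (\<Oplus>\<^bsub>L\<^esub>a\<in>A. g a)"
    using insert by (intro M.finsum_insert) auto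
  moreover have "(\<Oplus>\<^bsub>L\<^esub>a\<in>A. g a) \<in> carrier L"
    using insert by (intro M.finsum_closed) auto
  ultimately show ?case
    using insert by (simp add: lin_add)
qed

lemma lin_jacobson_Lambda:
  assumes "v \<in> carrier L" "w \<in> carrier L"
  shows "lin (jacobson_Lambda L br p v w) = Lambda_p PB p (lin v) (lin w)"
proof -
  have "lin (inverse (of_nat i) \<odot>\<^bsub>L\<^esub> path_coeff v w (p - 1) (i - 1))
      = of_nat (i ^ (p - 2)) * Lambda_coeff PB (lin v) (lin w) (p - 1) (i - 1)" if "i \<in> {1..p - 1}" for i
  proof -
    have "inverse (of_nat i) = (of_nat (i ^ (p - 2)) :: 'k)"
      by (rule inverse_of_nat_mod_p[OF prime_p p_ge_3 of_nat_p]) (use that in auto)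
    then show ?thesis
      using assms by (simp add: lin_smult path_coeff_closed lin_path_coeff mconst_of_nat del: of_nat_power)
  qed
  then show ?thesis
    unfolding jacobson_Lambda_eq Lambda_p_def
    using assms by (subst lin_finsum) (auto simp: path_coeff_closed intro!: sum.cong)
qed

lemma pmap_zero: "pmap \<zero>\<^bsub>L\<^esub> = \<zero>\<^bsub>L\<^esub>"
proof -
  have "pmap (0 \<odot>\<^bsub>L\<^esub> \<zero>\<^bsub>L\<^esub>) = 0 ^ p \<odot>\<^bsub>L\<^esub> pmap \<zero>\<^bsub>L\<^esub>"
    by (rule pmap_smult) simp
  then show ?thesis
    using S.p_pos pmap_closed[of "\<zero>\<^bsub>L\<^esub>"] by (simp add: zero_power)
qed

lemma p_map_lin:
  assumes "v \<in> carrier L"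
  shows "S.p_map (lin v) = lin (pmap v)"
  using assms
proof (induction v rule: basis_induct)
  case zero
  then show ?case
    using S.p_map_mconst[of 0] by (simp add: pmap_zero lin_zero)
next
  case (add v w)
  have "jacobson_Lambda L br p v w \<in> carrier L"
    unfolding jacobson_Lambda_eq using add by (intro M.finsum_closed) (auto simp: path_coeff_closed)
  with add show ?case
    by (simp add: lin_add S.p_map_add pmap_add pmap_closed lin_jacobson_Lambda)
next
  case (smult a v)
  then show ?case
    by (simp add: lin_smult S.p_map_scale pmap_smult pmap_closed)
next
  case (x i)
  then have "var_image i = lin (pmap (x i))"
    by (simp add: var_image_def)
  with x show ?case
    by (simp add: lin_x)
qed

end

section \<open>The truncated symmetric algebra\<close>

lemma mpoly_ring_simps [simp]:
  "carrier (mpoly_ring I) = {f. mvars f \<subseteq> I}" "f \<otimes>\<^bsub>mpoly_ring I\<^esub> g = f * g"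
  "f \<oplus>\<^bsub>mpoly_ring I\<^esub> g = f + g" "\<zero>\<^bsub>mpoly_ring I\<^esub> = 0" "\<one>\<^bsub>mpoly_ring I\<^esub> = 1"
  by (simp_all add: mpoly_ring_def ring_of_type_algebra_def)

lemma mvars_zero [simp]: "mvars 0 = {}"
  by (simp add: mvars_def)

lemma mvars_one [simp]: "mvars 1 = {}"
  by (simp add: mvars_def)

lemma mvars_add_in: "mvars f \<subseteq> I \<Longrightarrow> mvars g \<subseteq> I \<Longrightarrow> mvars (f + g) \<subseteq> I"
  using mvars_add[of f g] by blast

lemma mvars_mult_in: "mvars f \<subseteq> I \<Longrightarrow> mvars g \<subseteq> I \<Longrightarrow> mvars (f * g :: ('i, 'k::comm_ring_1) mpoly) \<subseteq> I"
  using mvars_mult[of f g] by blast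

lemma mvars_uminus_in: "mvars f \<subseteq> I \<Longrightarrow> mvars (- f :: ('i, 'k::comm_ring_1) mpoly) \<subseteq> I"
  by (simp add: mvars_uminus)

lemma mvars_diff_in: "mvars f \<subseteq> I \<Longrightarrow> mvars g \<subseteq> I \<Longrightarrow> mvars (f - g :: ('i, 'k::comm_ring_1) mpoly) \<subseteq> I"
  using mvars_add_in[of f I "- g"] mvars_uminus_in[of g I] by simp

lemma mvars_power_in: "mvars f \<subseteq> I \<Longrightarrow> mvars (f ^ n :: ('i, 'k::comm_ring_1) mpoly) \<subseteq> I"
  by (induction n) (simp_all add: mvars_mult_in)

lemmas mvars_in = mvars_add_in mvars_mult_in mvars_uminus_in mvars_diff_in mvars_power_in

lemma cring_mpoly_ring: "cring (mpoly_ring I :: ('i, 'k::comm_ring_1) mpoly ring)"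
proof (rule cringI)
  show "abelian_group (mpoly_ring I :: ('i, 'k) mpoly ring)"
  proof (rule abelian_groupI)
    fix f :: "('i, 'k) mpoly" assume "f \<in> carrier (mpoly_ring I)"
    then show "\<exists>g\<in>carrier (mpoly_ring I). g \<oplus>\<^bsub>mpoly_ring I\<^esub> f = \<zero>\<^bsub>mpoly_ring I\<^esub>"
      by (intro bexI[of _ "- f"]) (simp_all add: mvars_in)
  qed (simp_all add: mvars_in add_ac)
  show "comm_monoid (mpoly_ring I :: ('i, 'k) mpoly ring)"
    by (rule comm_monoidI) (simp_all add: mvars_in mult_ac)
qed (simp add: distrib_right)

lemma UN_const_eq: "A \<noteq> {} \<Longrightarrow> (\<And>a. a \<in> A \<Longrightarrow> F a = C) \<Longrightarrow> (\<Union>a\<in>A. F a) = C"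
  by blast

context lie_basis
begin

definition K :: "('i, 'k) mpoly set"
  where "K = {f. mvars f \<subseteq> I}"

abbreviation J :: "('i, 'k) mpoly set"
  where "J \<equiv> trunc_ideal p I"

lemma K_closed:
  "f \<in> K \<Longrightarrow> g \<in> K \<Longrightarrow> f + g \<in> K" "f \<in> K \<Longrightarrow> g \<in> K \<Longrightarrow> f * g \<in> K" "f \<in> K \<Longrightarrow> - f \<in> K"
  "f \<in> K \<Longrightarrow> g \<in> K \<Longrightarrow> f - g \<in> K" "f \<in> K \<Longrightarrow> f ^ n \<in> K" "0 \<in> K" "1 \<in> K" "mconst a \<in> K"
  by (simp_all add: K_def mvars_in)

lemma K_PB: "f \<in> K \<Longrightarrow> g \<in> K \<Longrightarrow> PB f g \<in> K"
proof -
  have "mvars (structure_form i j) \<subseteq> I" for i j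
    by (simp add: structure_form_def mvars_lin x_closed br_closed)
  then show "f \<in> K \<Longrightarrow> g \<in> K \<Longrightarrow> PB f g \<in> K"
    unfolding K_def PB_def mem_Collect_eq by (intro mvars_bivector_bracket)
qed

lemma K_lin: "v \<in> carrier L \<Longrightarrow> lin v \<in> K"
  by (simp add: K_def mvars_lin)

lemma K_p_map:
  assumes "f \<in> K"
  shows "S.p_map f \<in> K"
proof -
  have "mvars f \<subseteq> I"
    using assms by (simp add: K_def)
  then have "f \<in> K \<and> S.p_map f \<in> K"
  proof (induction f rule: mpoly_in_induct)
    case (const c)
    then show ?case
      by (simp add: K_closed)
  next
    case (add f g)
    have "Lambda_p PB p f g \<in> K"
      by (rule S.Lambda_p_closed[of K K]) (use add in \<open>auto simp: K_closed K_PB\<close>)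
    with add show ?case
      by (simp add: S.p_map_add K_closed)
  next
    case (var i f)
    have i: "mvar i \<in> K" "var_image i \<in> K"
      using var x_closed[OF \<open>i \<in> I\<close>] by (simp_all add: K_def mvars_mvar var_image_def pmap_closed mvars_lin)
    have "Phi_p PB p (mvar i) f \<in> K"
      by (rule S.Phi_p_closed[of K K]) (use var i in \<open>auto simp: K_closed K_PB\<close>)
    with var i show ?case
      by (simp add: S.p_map_mult K_closed)
  qed
  then show ?thesis ..
qed

lemma generators_in: "{mvar i ^ p | i. i \<in> I} \<subseteq> carrier (mpoly_ring I :: ('i, 'k) mpoly ring)"
proof
  fix f :: "('i, 'k) mpoly" assume "f \<in> {mvar i ^ p | i. i \<in> I}"
  then obtain i where "i \<in> I" "f = mvar i ^ p"
    by blast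
  then show "f \<in> carrier (mpoly_ring I)"
    by (simp add: mvars_power_in mvars_mvar)
qed

lemma ideal_J: "ideal J (mpoly_ring I)"
proof -
  interpret Q: cring "mpoly_ring I :: ('i, 'k) mpoly ring"
    by (rule cring_mpoly_ring)
  show ?thesis
    unfolding trunc_ideal_def
    by (rule Q.genideal_ideal[OF generators_in])
qed

lemma J_minimal:
  assumes "\<And>f. f \<in> A \<Longrightarrow> f \<in> K" "0 \<in> A" "\<And>f g. f \<in> A \<Longrightarrow> g \<in> A \<Longrightarrow> f + g \<in> A"
    and "\<And>f g. f \<in> A \<Longrightarrow> g \<in> K \<Longrightarrow> g * f \<in> A" "\<And>i. i \<in> I \<Longrightarrow> mvar i ^ p \<in> A"
  shows "J \<subseteq> A"
proof -
  interpret Q: cring "mpoly_ring I :: ('i, 'k) mpoly ring"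
    by (rule cring_mpoly_ring)
  have "ideal A (mpoly_ring I)"
  proof (rule idealI)
    show "subgroup A (add_monoid (mpoly_ring I))"
    proof (rule Q.add.subgroupI)
      show "A \<subseteq> carrier (mpoly_ring I)"
        using assms(1) by (auto simp: K_def)
      show "A \<noteq> {}"
        using assms(2) by blast
      fix f assume f: "f \<in> A"
      have "- f \<in> A"
        using assms(4)[OF f, of "- 1"] K_closed(3,7) by simp
      moreover have "\<ominus>\<^bsub>mpoly_ring I\<^esub> f = - f"
        by (rule Q.minus_equality) (use f assms(1) in \<open>auto simp: K_def mvars_in\<close>)
      ultimately show "\<ominus>\<^bsub>mpoly_ring I\<^esub> f \<in> A"
        by simp
    qed (simp add: assms)
  qed (use assms(4) Q.ring_axioms in \<open>auto simp: K_def mult.commute\<close>)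
  then show ?thesis
    unfolding trunc_ideal_def
    by (rule Q.genideal_minimal) (use assms(5) in auto)
qed

lemma J_closed:
  shows J_K: "f \<in> J \<Longrightarrow> f \<in> K" and J_0: "0 \<in> J" and J_add: "f \<in> J \<Longrightarrow> g \<in> J \<Longrightarrow> f + g \<in> J"
    and J_mult: "f \<in> J \<Longrightarrow> g \<in> K \<Longrightarrow> g * f \<in> J" and J_gen: "i \<in> I \<Longrightarrow> mvar i ^ p \<in> J"
proof -
  interpret ideal J "mpoly_ring I"
    by (rule ideal_J)
  show "f \<in> J \<Longrightarrow> f \<in> K"
    using a_Hcarr by (auto simp: K_def)
  show "0 \<in> J"
    using additive_subgroup.zero_closed[OF is_additive_subgroup] by simp
  show "f \<in> J \<Longrightarrow> g \<in> J \<Longrightarrow> f + g \<in> J"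
    using additive_subgroup.a_closed[OF is_additive_subgroup, of f g] by simp
  show "f \<in> J \<Longrightarrow> g \<in> K \<Longrightarrow> g * f \<in> J"
    using I_l_closed[of f g] by (simp add: K_def)
  show "i \<in> I \<Longrightarrow> mvar i ^ p \<in> J"
    unfolding trunc_ideal_def
    using genideal_self[OF generators_in] by blast
qed

lemma J_uminus: "f \<in> J \<Longrightarrow> - f \<in> J"
  using J_mult[of f "- 1"] K_closed(3,7) by simp

lemma J_diff: "f \<in> J \<Longrightarrow> g \<in> J \<Longrightarrow> f - g \<in> J"
  using J_add[of f "- g"] J_uminus[of g] by simp

lemma J_PB:
  assumes "f \<in> J" "g \<in> K"
  shows "PB g f \<in> J"
proof -
  have "J \<subseteq> {f \<in> J. \<forall>g\<in>K. PB g f \<in> J}"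
  proof (rule J_minimal)
    fix f g assume f: "f \<in> {f \<in> J. \<forall>g\<in>K. PB g f \<in> J}" and g: "g \<in> K"
    have "PB h (g * f) \<in> J" if h: "h \<in> K" for h
    proof -
      have "PB h (g * f) = g * PB h f + PB h g * f"
        by (simp add: S.B_leibniz_right mult.commute)
      then show ?thesis
        using f g h by (simp add: J_add J_mult K_PB)
    qed
    with f g show "g * f \<in> {f \<in> J. \<forall>g\<in>K. PB g f \<in> J}"
      by (simp add: J_mult)
  qed (simp_all add: J_K J_0 J_add J_gen S.B_add_right)
  with assms show ?thesis
    by blast
qed

lemma J_Lambda_p:
  assumes "f \<in> J" "g \<in> K"
  shows "Lambda_p PB p f g \<in> J" "Lambda_p PB p g f \<in> J"
proof -
  show "Lambda_p PB p f g \<in> J"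
    by (rule S.Lambda_p_closed[of J K]) (use assms in \<open>auto simp: J_0 J_add J_PB J_K\<close>)
  then show "Lambda_p PB p g f \<in> J"
    by (simp only: S.Lambda_p_swap[of g f])
qed

text \<open>
  The elements of the ideal whose image stays in the ideal form an ideal: for a sum, \<open>\<Lambda>\<^sub>p\<close> of two
  elements of a Poisson ideal stays in it, and for a product \<open>gf\<close> so do \<open>\<Phi>\<^sub>p(g, f)\<close> and the term with
  \<open>f\<^sup>p\<close>. It contains the generators because the \<open>p\<close>-map sends \<open>x\<^sub>i\<^sup>p\<close> to
  \<open>p x\<^sub>i\<^bsup>p(p-1)\<^esup> x\<^sub>i\<^sup>[\<^sup>p\<^sup>] = 0\<close>.
\<close>

lemma J_p_map:
  assumes "f \<in> J"
  shows "S.p_map f \<in> J"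
proof -
  have "J \<subseteq> {f \<in> J. S.p_map f \<in> J}"
  proof (rule J_minimal)
    show "0 \<in> {f \<in> J. S.p_map f \<in> J}"
      using S.p_map_mconst[of 0] by (simp add: J_0)
    show "f + g \<in> {f \<in> J. S.p_map f \<in> J}" if "f \<in> {f \<in> J. S.p_map f \<in> J}" "g \<in> {f \<in> J. S.p_map f \<in> J}" for f g
      using that J_Lambda_p(1)[of f g] by (simp add: S.p_map_add J_add J_K)
    show "mvar i ^ p \<in> {f \<in> J. S.p_map f \<in> J}" if "i \<in> I" for i
      using that by (simp add: J_gen S.p_map_power S.char_p J_0)
    show "g * f \<in> {f \<in> J. S.p_map f \<in> J}" if f: "f \<in> {f \<in> J. S.p_map f \<in> J}" and g: "g \<in> K" for f g
    proof -
      have "Phi_p PB p g f \<in> J"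
        by (rule S.Phi_p_closed[of J K])
           (use f g S.B_swap[of f g] in \<open>auto simp: J_0 J_add J_uminus J_mult J_PB J_K K_closed K_PB\<close>)
      moreover have "f ^ p * S.p_map g \<in> J"
      proof -
        have "f ^ p * S.p_map g = (f ^ (p - 1) * S.p_map g) * f"
          using p_ge_3 by (cases p) (simp_all add: mult_ac)
        moreover have "f ^ (p - 1) * S.p_map g \<in> K"
          using f g J_K by (simp add: K_closed K_p_map)
        ultimately show ?thesis
          using f J_mult by simp
      qed
      ultimately show ?thesis
        using f g by (simp add: S.p_map_mult J_add J_mult K_closed)
    qed
  qed (simp add: J_K)
  with assms show ?thesis
    by blast
qed

abbreviation cls :: "('i, 'k) mpoly \<Rightarrow> ('i, 'k) mpoly set"
  where "cls \<equiv> trunc_class p I"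

lemma mem_cls: "h \<in> cls f \<longleftrightarrow> h - f \<in> J"
proof -
  have "cls f = (\<Union>j\<in>J. {j + f})"
    by (simp add: trunc_class_def a_r_coset_def')
  then show ?thesis
    by (metis (no_types, lifting) UN_iff add_diff_cancel_right' diff_add_cancel singleton_iff)
qed

lemma cls_eq: "cls f = cls g \<longleftrightarrow> f - g \<in> J"
proof
  assume "cls f = cls g"
  then show "f - g \<in> J"
    using mem_cls[of f f] mem_cls[of f g] J_0 by simp
next
  assume *: "f - g \<in> J"
  have "h - f \<in> J \<longleftrightarrow> h - g \<in> J" for h
    using J_add[of "h - f" "f - g"] J_diff[of "h - g" "f - g"] * by auto
  then show "cls f = cls g"
    by (auto simp: mem_cls)
qed

lemma cls_self: "f \<in> cls f"
  by (simp add: mem_cls J_0)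

lemma mem_cls_K: "h \<in> cls f \<Longrightarrow> f \<in> K \<Longrightarrow> h \<in> K"
  using K_closed(1)[of "h - f" f] J_K by (simp add: mem_cls)

abbreviation T :: "('k, ('i, 'k) mpoly set) module"
  where "T \<equiv> trunc_sym p I"

lemma T_carrier: "carrier T = cls ` K"
  by (auto simp: trunc_sym_def ring.defs module.defs FactRing_def A_RCOSETS_def' trunc_class_def K_def)

lemma T_zero: "\<zero>\<^bsub>T\<^esub> = cls 0"
proof -
  have "\<zero>\<^bsub>T\<^esub> = J"
    by (simp add: trunc_sym_def ring.defs module.defs FactRing_def)
  also have "J = cls 0"
    by (rule Set.set_eqI) (simp add: mem_cls)
  finally show ?thesis .
qed

lemma T_one: "\<one>\<^bsub>T\<^esub> = cls 1"
  by (simp add: trunc_sym_def ring.defs module.defs FactRing_def trunc_class_def)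

lemma T_add: "cls f \<oplus>\<^bsub>T\<^esub> cls g = cls (f + g)"
proof -
  have "cls f \<oplus>\<^bsub>T\<^esub> cls g = (\<Union>h\<in>cls f. \<Union>k\<in>cls g. {h + k})"
    by (simp add: trunc_sym_def ring.defs module.defs FactRing_def set_add_def')
  also have "\<dots> = cls (f + g)"
  proof (rule Set.set_eqI)
    fix h
    show "h \<in> (\<Union>h\<in>cls f. \<Union>k\<in>cls g. {h + k}) \<longleftrightarrow> h \<in> cls (f + g)"
    proof
      assume "h \<in> (\<Union>h\<in>cls f. \<Union>k\<in>cls g. {h + k})"
      then obtain a b where "a - f \<in> J" "b - g \<in> J" "h = a + b"
        by (auto simp: mem_cls)
      then show "h \<in> cls (f + g)"
        using J_add[of "a - f" "b - g"] by (simp add: mem_cls algebra_simps)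
    next
      assume "h \<in> cls (f + g)"
      then have "h - g \<in> cls f"
        by (simp add: mem_cls algebra_simps)
      then show "h \<in> (\<Union>h\<in>cls f. \<Union>k\<in>cls g. {h + k})"
        using cls_self[of g] by (intro UN_I[of "h - g"] UN_I[of g]) auto
    qed
  qed
  finally show ?thesis .
qed

lemma T_mult:
  assumes "f \<in> K" "g \<in> K"
  shows "cls f \<otimes>\<^bsub>T\<^esub> cls g = cls (f * g)"
proof -
  have "cls f \<otimes>\<^bsub>T\<^esub> cls g = (\<Union>h\<in>cls f. \<Union>k\<in>cls g. cls (h * k))"
    by (simp add: trunc_sym_def ring.defs module.defs FactRing_def rcoset_mult_def trunc_class_def)
  also have "\<dots> = cls (f * g)"
  proof (intro UN_const_eq)
    fix h k assume "h \<in> cls f" "k \<in> cls g"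
    then have "k * (h - f) + f * (k - g) \<in> J"
      using assms mem_cls_K by (intro J_add J_mult) (auto simp: mem_cls)
    then show "cls (h * k) = cls (f * g)"
      by (simp add: cls_eq algebra_simps)
  qed (use cls_self in auto)
  finally show ?thesis .
qed

lemma T_smult: "a \<odot>\<^bsub>T\<^esub> cls f = cls (mconst a * f)"
proof -
  have "a \<odot>\<^bsub>T\<^esub> cls f = (\<Union>h\<in>cls f. cls (mconst a * h))"
    by (simp add: trunc_sym_def ring.defs module.defs)
  also have "\<dots> = cls (mconst a * f)"
  proof (intro UN_const_eq)
    fix h assume "h \<in> cls f"
    then have "mconst a * (h - f) \<in> J"
      by (intro J_mult K_closed) (auto simp: mem_cls)
    then show "cls (mconst a * h) = cls (mconst a * f)"
      by (simp add: cls_eq algebra_simps)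
  qed (use cls_self in auto)
  finally show ?thesis .
qed

abbreviation tbr :: "('i, 'k) mpoly set \<Rightarrow> ('i, 'k) mpoly set \<Rightarrow> ('i, 'k) mpoly set"
  where "tbr \<equiv> trunc_bracket L br p I x"

lemma poly_bracket_eq_PB: "f \<in> K \<Longrightarrow> g \<in> K \<Longrightarrow> poly_bracket L br I x f g = PB f g"
  unfolding poly_bracket_def PB_def bivector_bracket_def
  by (intro sum.cong refl) (auto simp: K_def structure_form_def)

lemma T_br:
  assumes "f \<in> K" "g \<in> K"
  shows "tbr (cls f) (cls g) = cls (PB f g)"
  unfolding trunc_bracket_def
proof (intro UN_const_eq)
  fix h k assume hk: "h \<in> cls f" "k \<in> cls g"
  then have K: "h \<in> K" "k \<in> K"
    using assms mem_cls_K by auto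
  have "PB h k - PB f g = PB h (k - g) - PB g (h - f)"
    using S.B_swap[of g h] S.B_swap[of g f] by (simp add: S.B_diff_right)
  moreover have "PB h (k - g) - PB g (h - f) \<in> J"
    using hk K assms by (intro J_diff[OF J_PB J_PB]) (simp_all add: mem_cls)
  ultimately show "cls (poly_bracket L br I x h k) = cls (PB f g)"
    using K by (simp add: cls_eq poly_bracket_eq_PB)
qed (use cls_self in auto)

lemmas T_simps = T_carrier T_zero T_one T_add T_mult T_smult T_br K_closed K_PB

lemma cring_T: "cring T"
proof (rule cringI)
  show "abelian_group T"
  proof (rule abelian_groupI)
    fix C assume "C \<in> carrier T"
    then obtain f where f: "f \<in> K" "C = cls f"
      by (auto simp: T_carrier)
    show "\<exists>D\<in>carrier T. D \<oplus>\<^bsub>T\<^esub> C = \<zero>\<^bsub>T\<^esub>"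
      by (rule bexI[of _ "cls (- f)"]) (use f in \<open>auto simp: T_simps\<close>)
  qed (auto simp: T_simps add_ac)
  show "comm_monoid T"
    by (rule comm_monoidI) (auto simp: T_simps mult_ac)
qed (auto simp: T_simps distrib_right)

lemma algebra_T: "algebra (ring_of_type_algebra :: 'k ring) T"
proof (rule algebraI)
  show "cring (ring_of_type_algebra :: 'k ring)"
    by (rule cring_from_type_algebra)
qed (use cring_T in \<open>auto simp: T_simps mconst_add mconst_mult algebra_simps\<close>)

lemma lie_algebra_T: "lie_algebra T tbr"
proof -
  interpret Alg: algebra "ring_of_type_algebra :: 'k ring" T
    by (rule algebra_T)
  show ?thesis
  proof
    fix C D E assume "C \<in> carrier T" "D \<in> carrier T" "E \<in> carrier T"
    then obtain f g h where "f \<in> K" "g \<in> K" "h \<in> K" "C = cls f" "D = cls g" "E = cls h"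
      by (auto simp: T_carrier)
    then show "tbr C (tbr D E) \<oplus>\<^bsub>T\<^esub> tbr D (tbr E C) \<oplus>\<^bsub>T\<^esub> tbr E (tbr C D) = \<zero>\<^bsub>T\<^esub>"
      using S.B_jacobi[of f g h] by (simp add: T_simps)
  qed (auto simp: T_simps S.B_add_left S.B_add_right PB_scale_left PB_scale_right)
qed

lemma poisson_algebra_T: "poisson_algebra T tbr"
proof -
  interpret Alg: algebra "ring_of_type_algebra :: 'k ring" T
    by (rule algebra_T)
  interpret Lie: lie_algebra T tbr
    by (rule lie_algebra_T)
  show ?thesis
    by unfold_locales (auto simp: T_simps S.B_leibniz)
qed

text \<open>
  Any representative would do, by \<open>J_p_map\<close> and the sum rule.
\<close>

definition quotient_p_map :: "('i, 'k) mpoly set \<Rightarrow> ('i, 'k) mpoly set"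
  where "quotient_p_map C = cls (S.p_map (SOME f. f \<in> K \<and> cls f = C))"

lemma quotient_p_map_cls:
  assumes "f \<in> K"
  shows "quotient_p_map (cls f) = cls (S.p_map f)"
proof -
  define g where "g = (SOME g. g \<in> K \<and> cls g = cls f)"
  have "g \<in> K \<and> cls g = cls f"
    unfolding g_def by (rule someI[of _ f]) (use assms in simp)
  then have g: "g \<in> K" "g - f \<in> J"
    by (auto simp: cls_eq)
  have "S.p_map g = S.p_map f + S.p_map (g - f) + Lambda_p PB p f (g - f)"
    using S.p_map_add[of f "g - f"] by simp
  then have "S.p_map g - S.p_map f = S.p_map (g - f) + Lambda_p PB p f (g - f)"
    by simp
  also have "\<dots> \<in> J"
    using g assms by (intro J_add J_p_map J_Lambda_p)
  finally have "cls (S.p_map g) = cls (S.p_map f)"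
    by (simp only: cls_eq)
  then show ?thesis
    unfolding quotient_p_map_def g_def[symmetric] .
qed

lemma T_ad: "f \<in> K \<Longrightarrow> g \<in> K \<Longrightarrow> (tbr (cls f) ^^ n) (cls g) = cls ((PB f ^^ n) g) \<and> (PB f ^^ n) g \<in> K"
  by (induction n) (simp_all add: T_br K_PB)

lemma T_jacobson_Lambda:
  assumes "f \<in> K" "g \<in> K"
  shows "jacobson_Lambda T tbr p (cls f) (cls g) = cls (Lambda_p PB p f g)"
proof -
  interpret A: lie_algebra T tbr
    by (rule lie_algebra_T)
  have c: "cls f \<in> carrier T" "cls g \<in> carrier T"
    using assms by (auto simp: T_carrier)
  have path: "A.path_coeff (cls f) (cls g) k n = cls (Lambda_coeff PB f g k n) \<and> Lambda_coeff PB f g k n \<in> K" for k n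
  proof (induction k arbitrary: n)
    case 0
    then show ?case
      using assms by (simp add: A.path_coeff_0 T_zero K_closed)
  next
    case (Suc k)
    then show ?case
      using assms c by (auto simp: A.path_coeff_Suc T_simps)
  qed
  have sum: "(\<Oplus>\<^bsub>T\<^esub>i\<in>A. cls (h i)) = cls (sum h A) \<and> sum h A \<in> K"
    if "finite A" "\<And>i. i \<in> A \<Longrightarrow> h i \<in> K" for A and h :: "nat \<Rightarrow> ('i, 'k) mpoly"
    using that
  proof (induction A)
    case empty
    then show ?case
      by (simp add: T_zero K_closed)
  next
    case (insert i A)
    have "(\<Oplus>\<^bsub>T\<^esub>i\<in>insert i A. cls (h i)) = cls (h i) \<oplus>\<^bsub>T\<^esub> (\<Oplus>\<^bsub>T\<^esub>i\<in>A. cls (h i))"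
      using insert by (intro A.M.finsum_insert) (auto simp: T_carrier)
    then show ?case
      using insert by (simp add: T_add K_closed)
  qed
  have "jacobson_Lambda T tbr p (cls f) (cls g)
      = (\<Oplus>\<^bsub>T\<^esub>i\<in>{1..p - 1}. cls (of_nat (i ^ (p - 2)) * Lambda_coeff PB f g (p - 1) (i - 1)))"
    unfolding A.jacobson_Lambda_eq
  proof (rule A.M.finsum_cong')
    fix i assume i: "i \<in> {1..p - 1}"
    have "inverse (of_nat i) = (of_nat (i ^ (p - 2)) :: 'k)"
      by (rule inverse_of_nat_mod_p[OF prime_p p_ge_3 of_nat_p]) (use i in auto)
    then show "inverse (of_nat i) \<odot>\<^bsub>T\<^esub> A.path_coeff (cls f) (cls g) (p - 1) (i - 1)
        = cls (of_nat (i ^ (p - 2)) * Lambda_coeff PB f g (p - 1) (i - 1))"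
      using path by (simp add: T_smult mconst_of_nat del: of_nat_power)
  qed (use path K_closed(2,8) in \<open>auto simp: T_carrier simp flip: mconst_of_nat simp del: of_nat_power\<close>)
  also have "\<dots> = cls (Lambda_p PB p f g)"
    unfolding Lambda_p_def
    by (rule conjunct1[OF sum])
       (use path K_closed(2,8) in \<open>auto simp flip: mconst_of_nat simp del: of_nat_power\<close>)
  finally show ?thesis .
qed

lemma restricted_lie_algebra_T: "restricted_lie_algebra T tbr p quotient_p_map"
proof -
  interpret A: lie_algebra T tbr
    by (rule lie_algebra_T)
  show ?thesis
  proof
    show "CHAR('k) = p"
      by (rule char_eq)
    fix C assume "C \<in> carrier T"
    then obtain f where f: "f \<in> K" "C = cls f"
      by (auto simp: T_carrier)
    show "quotient_p_map C \<in> carrier T"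
      using f by (auto simp: quotient_p_map_cls T_carrier K_p_map)
    show "quotient_p_map (a \<odot>\<^bsub>T\<^esub> C) = a ^ p \<odot>\<^bsub>T\<^esub> quotient_p_map C" for a
      using f by (simp add: T_smult quotient_p_map_cls K_closed S.p_map_scale)
    fix D assume "D \<in> carrier T"
    then obtain g where g: "g \<in> K" "D = cls g"
      by (auto simp: T_carrier)
    show "(tbr C ^^ p) D = tbr (quotient_p_map C) D"
      using f g by (simp add: T_ad quotient_p_map_cls T_br K_p_map S.ad_p_map)
    show "quotient_p_map (C \<oplus>\<^bsub>T\<^esub> D) = quotient_p_map C \<oplus>\<^bsub>T\<^esub> quotient_p_map D \<oplus>\<^bsub>T\<^esub> jacobson_Lambda T tbr p C D"
      using f g by (simp add: T_add quotient_p_map_cls K_closed T_jacobson_Lambda S.p_map_add)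
  qed
qed

lemma T_power:
  assumes "f \<in> K"
  shows "cls f [^]\<^bsub>T\<^esub> (n::nat) = cls (f ^ n)"
proof (induction n)
  case 0
  then show ?case
    by (simp add: T_one)
next
  case (Suc n)
  then show ?case
    using assms by (simp add: T_mult K_closed mult.commute)
qed

lemma restricted_poisson_algebra_T: "restricted_poisson_algebra T tbr p quotient_p_map"
proof -
  interpret A: poisson_algebra T tbr
    by (rule poisson_algebra_T)
  interpret A: restricted_lie_algebra T tbr p quotient_p_map
    by (rule restricted_lie_algebra_T)
  show ?thesis
  proof
    fix C assume "C \<in> carrier T"
    then obtain f where f: "f \<in> K" "C = cls f"
      by (auto simp: T_carrier)
    have double: "add_pow T (2::nat) (cls g) = cls (2 * g)" for g
    proof -
      have "add_pow T (Suc (Suc 0)) (cls g) = cls (g + g)"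
        by (simp add: add_pow_def T_add T_zero)
      then show ?thesis
        by (simp only: mult_2 numeral_2_eq_2)
    qed
    have "quotient_p_map (C [^]\<^bsub>T\<^esub> (2::nat)) = cls (2 * (f ^ p * S.p_map f))"
      unfolding f(2) T_power[OF f(1)] quotient_p_map_cls[OF K_closed(5)[OF f(1)]] S.p_map_square
      by (simp only: mult.assoc)
    moreover have "C [^]\<^bsub>T\<^esub> p \<otimes>\<^bsub>T\<^esub> quotient_p_map C = cls (f ^ p * S.p_map f)"
      unfolding f(2) T_power[OF f(1)] quotient_p_map_cls[OF f(1)]
      by (rule T_mult[OF K_closed(5)[OF f(1)] K_p_map[OF f(1)]])
    ultimately show "quotient_p_map (C [^]\<^bsub>T\<^esub> (2::nat)) = add_pow T (2::nat) (C [^]\<^bsub>T\<^esub> p \<otimes>\<^bsub>T\<^esub> quotient_p_map C)"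
      by (simp only: double)
  qed
qed

lemma quotient_p_map_incl: "v \<in> carrier L \<Longrightarrow> quotient_p_map (trunc_incl L p I x v) = trunc_incl L p I x (pmap v)"
  by (simp add: trunc_incl_def quotient_p_map_cls K_lin p_map_lin)

end

theorem theorem0p2:
  fixes L :: "('k::field, 'a, 'm) module_scheme"
    and br :: "'a \<Rightarrow> 'a \<Rightarrow> 'a" and pmap :: "'a \<Rightarrow> 'a"
    and p :: nat and I :: "'i set" and x :: "'i \<Rightarrow> 'a"
  assumes "CHAR('k) = p" and "p \<ge> 3"
    and "restricted_lie_algebra L br p pmap"
    and "is_basis L I x"
  shows "\<exists>P. restricted_poisson_algebra (trunc_sym p I) (trunc_bracket L br p I x) p P \<and>
    (\<forall>v\<in>carrier L. P (trunc_incl L p I x v) = trunc_incl L p I x (pmap v))"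
proof -
  interpret lie_basis L br p pmap I x
    by (intro lie_basis.intro lie_basis_axioms.intro assms)
  show ?thesis
    using restricted_poisson_algebra_T quotient_p_map_incl by blast
qed

end
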